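(* For a rank 2 distribution $D$ on a 5-dimensional manifold with small growth vector $(2,3,5)$ the following relation holds: $$\mathcal R_D=(D^2)^\perp\setminus(D^3)^\perp .$$
   Context: All objects are smooth. $D^1=D$, $D^j=D^{j-1}+[D,D^{j-1}]$; the small growth vector at $q$ is $(\dim D(q),\dim D^2(q),\dots)$. $\pi:T^*M\to M$ is the projection, $\sigma=-d s$ with $s$ the tautological 1-form. $(D^l)^\perp=\{(p,q)\in T^*M: p\cdot v=0\ \forall v\in D^l(q)\}$ (so here $(D^3)^\perp$ is the zero section). On $(D^2)^\perp\setminus(D^3)^\perp$ the kernel $\ker\sigma|_{(D^2)^\perp}$ is a line distribution; let $H$ be a local nowhere vanishing vector field spanning it. $\vec e$ is the Euler field (generator of fiberwise dilations). For $\lambda\in(D^2)^\perp\setminus(D^3)^\perp$ let $\mathcal J(\lambda)=\bigl(T_\lambda(T^*_{\pi(\lambda)}M)+\ker\sigma|_{D^\perp}(\lambda)\bigr)\cap T_\lambda(D^2)^\perp$ and $W_\lambda=\bigl(\vec e(\lambda)^\angle\cap T_\lambda(D^2)^\perp\bigr)/\mathrm{span}(H(\lambda),\vec e(\lambda))$ ($\angle$ = $\sigma$-skew-orthogonal complement), a 4-dimensional symplectic space. The reduced Jacobi curve through $\lambda$ is the curve of Lagrangian subspaces $t\mapsto \widetilde J(e^{tH}\lambda)=(e^{-tH})_*\mathcal J(e^{tH}\lambda)/\mathrm{span}(H(\lambda),\vec e(\lambda))$ in $W_\lambda$, considered up to reparametrization. The weight at $\tau$ of a curve $\Lambda(t)$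 of half-dimensional subspaces, represented in coordinates by a matrix curve $S_t$ (subspaces as graphs), is the order of zero of $t\mapsto\det(S_t-S_\tau)$ at $\tau$. $\mathcal R_D$ is the set of $\lambda\in(D^2)^\perp\setminus(D^3)^\perp$ such that the germ at $\lambda$ of the reduced Jacobi curve through $\lambda$ has constant (finite) weight. *)

theory Defs
  imports "HOL-Analysis.Analysis"
begin

section \<open>Smooth maps, curves and differential forms in Euclidean space\<close>

primrec Ck_on :: "nat \<Rightarrow> 'a::real_normed_vector set \<Rightarrow> ('a \<Rightarrow> 'b::real_normed_vector) \<Rightarrow> bool" where
  "Ck_on 0 S f \<longleftrightarrow> continuous_on S f"
| "Ck_on (Suc k) S f \<longleftrightarrow>
     (\<forall>x\<in>S. f differentiable (at x)) \<and> (\<forall>v. Ck_on k S (\<lambda>x. frechet_derivative f (at x) v))"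

definition smooth_on :: "'a::real_normed_vector set \<Rightarrow> ('a \<Rightarrow> 'b::real_normed_vector) \<Rightarrow> bool" where
  "smooth_on S f \<longleftrightarrow> open S \<and> (\<forall>k. Ck_on k S f)"

text \<open>Smoothness on an arbitrary subset (in the applications: an embedded submanifold) means that
  there are local smooth extensions to the ambient space.\<close>

definition smooth_map_on :: "'a::real_normed_vector set \<Rightarrow> ('a \<Rightarrow> 'b::real_normed_vector) \<Rightarrow> bool" where
  "smooth_map_on S f \<longleftrightarrow>
     (\<forall>x\<in>S. \<exists>U F. x \<in> U \<and> smooth_on U F \<and> (\<forall>y\<in>S \<inter> U. F y = f y))"

definition smooth_curve_in :: "'a::real_normed_vector set \<Rightarrow> 'a \<Rightarrow> 'a \<Rightarrow> (real \<Rightarrow> 'a) \<Rightarrow> bool" where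
  "smooth_curve_in P x v \<gamma> \<longleftrightarrow>
     \<gamma> 0 = x \<and> (\<gamma> has_vector_derivative v) (at 0) \<and>
     (\<exists>\<epsilon>>0. smooth_on {-\<epsilon><..<\<epsilon>} \<gamma> \<and> \<gamma> ` {-\<epsilon><..<\<epsilon>} \<subseteq> P)"

definition tangent_at :: "'a::real_normed_vector set \<Rightarrow> 'a \<Rightarrow> 'a set" where
  "tangent_at P x = {v. \<exists>\<gamma>. smooth_curve_in P x v \<gamma>}"

text \<open>The image of a set \<open>S\<close> of vectors tangent to \<open>P\<close> at \<open>x\<close> under the differential of \<open>f\<close>,
  which need only be defined on \<open>P\<close>.\<close>

definition pushforward ::
    "'a::real_normed_vector set \<Rightarrow> ('a \<Rightarrow> 'b::real_normed_vector) \<Rightarrow> 'a \<Rightarrow> 'a set \<Rightarrow> 'b set" where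
  "pushforward P f x S =
     {w. \<exists>v\<in>S. \<exists>\<gamma>. smooth_curve_in P x v \<gamma> \<and> (f \<circ> \<gamma> has_vector_derivative w) (at 0)}"

definition lie_bracket :: "('a::real_normed_vector \<Rightarrow> 'a) \<Rightarrow> ('a \<Rightarrow> 'a) \<Rightarrow> 'a \<Rightarrow> 'a" where
  "lie_bracket X Y x =
     frechet_derivative Y (at x) (X x) - frechet_derivative X (at x) (Y x)"

definition exterior_derivative ::
    "('a::real_normed_vector \<Rightarrow> 'a \<Rightarrow> real) \<Rightarrow> 'a \<Rightarrow> 'a \<Rightarrow> 'a \<Rightarrow> real" where
  "exterior_derivative \<omega> x u v =
     frechet_derivative (\<lambda>y. \<omega> y v) (at x) u - frechet_derivative (\<lambda>y. \<omega> y u) (at x) v"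


section \<open>Distributions on an open subset of Euclidean space\<close>

definition smooth_distribution :: "'e::euclidean_space set \<Rightarrow> nat \<Rightarrow> ('e \<Rightarrow> 'e set) \<Rightarrow> bool" where
  "smooth_distribution V k \<Delta> \<longleftrightarrow>
     (\<forall>x\<in>V. subspace (\<Delta> x) \<and> dim (\<Delta> x) = k) \<and>
     (\<forall>x\<in>V. \<exists>W X. x \<in> W \<and> W \<subseteq> V \<and> (\<forall>i<k. smooth_on W (X i)) \<and>
        (\<forall>y\<in>W. \<Delta> y = span ((\<lambda>i. X i y) ` {..<k})))"

definition local_section :: "'e::euclidean_space set \<Rightarrow> ('e \<Rightarrow> 'e set) \<Rightarrow> ('e \<Rightarrow> 'e) \<Rightarrow> bool" where
  "local_section W \<Delta> X \<longleftrightarrow> smooth_on W X \<and> (\<forall>x\<in>W. X x \<in> \<Delta> x)"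

text \<open>\<open>lie_flag V \<Delta> j\<close> is $D^j$: $D^1 = D$ and $D^j = D^{j-1} + [D, D^{j-1}]$.  The value at index
  \<open>0\<close> is a dummy.\<close>

fun lie_flag :: "'e::euclidean_space set \<Rightarrow> ('e \<Rightarrow> 'e set) \<Rightarrow> nat \<Rightarrow> 'e \<Rightarrow> 'e set" where
  "lie_flag V \<Delta> 0 = (\<lambda>x. {0})"
| "lie_flag V \<Delta> (Suc 0) = \<Delta>"
| "lie_flag V \<Delta> (Suc (Suc j)) = (\<lambda>x. span (lie_flag V \<Delta> (Suc j) x \<union>
     {lie_bracket X Y x | W X Y. x \<in> W \<and> W \<subseteq> V \<and>
        local_section W \<Delta> X \<and> local_section W (lie_flag V \<Delta> (Suc j)) Y}))"


section \<open>Symplectic geometry of the cotangent bundle in canonical coordinates\<close>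

text \<open>The cotangent bundle of an open set \<open>V\<close> is \<open>V \<times> UNIV\<close>, with the base point as first
  component; covectors act through the inner product.\<close>

definition tautological_form :: "'e::euclidean_space \<times> 'e \<Rightarrow> 'e \<times> 'e \<Rightarrow> real" where
  "tautological_form \<xi> u = snd \<xi> \<bullet> fst u"

definition symp :: "'e::euclidean_space \<times> 'e \<Rightarrow> 'e \<times> 'e \<Rightarrow> 'e \<times> 'e \<Rightarrow> real" where
  "symp \<xi> u v = - exterior_derivative tautological_form \<xi> u v"

definition euler :: "'e::euclidean_space \<times> 'e \<Rightarrow> 'e \<times> 'e" where
  "euler \<xi> = (0, snd \<xi>)"

definition vertical :: "('e::euclidean_space \<times> 'e) set" where
  "vertical = {0} \<times> UNIV"

text \<open>\<open>ann V \<Delta> l\<close> is $(D^l)^\perp$.\<close>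

definition ann :: "'e::euclidean_space set \<Rightarrow> ('e \<Rightarrow> 'e set) \<Rightarrow> nat \<Rightarrow> ('e \<times> 'e) set" where
  "ann V \<Delta> l = {(q, p). q \<in> V \<and> (\<forall>v\<in>lie_flag V \<Delta> l q. p \<bullet> v = 0)}"

definition symp_kernel :: "('e::euclidean_space \<times> 'e) set \<Rightarrow> 'e \<times> 'e \<Rightarrow> ('e \<times> 'e) set" where
  "symp_kernel P \<xi> = {u \<in> tangent_at P \<xi>. \<forall>v\<in>tangent_at P \<xi>. symp \<xi> u v = 0}"

definition jacobi_space ::
    "'e::euclidean_space set \<Rightarrow> ('e \<Rightarrow> 'e set) \<Rightarrow> 'e \<times> 'e \<Rightarrow> ('e \<times> 'e) set" where
  "jacobi_space V \<Delta> \<xi> =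
     {u + w | u w. u \<in> vertical \<and> w \<in> symp_kernel (ann V \<Delta> 1) \<xi>} \<inter> tangent_at (ann V \<Delta> 2) \<xi>"

definition char_field ::
    "'e::euclidean_space set \<Rightarrow> ('e \<Rightarrow> 'e set) \<Rightarrow> ('e \<times> 'e) set \<Rightarrow> ('e \<times> 'e \<Rightarrow> 'e \<times> 'e) \<Rightarrow> bool" where
  "char_field V \<Delta> U H \<longleftrightarrow>
     openin (top_of_set (ann V \<Delta> 2 - ann V \<Delta> 3)) U \<and> smooth_map_on U H \<and>
     (\<forall>\<mu>\<in>U. H \<mu> \<noteq> 0 \<and> symp_kernel (ann V \<Delta> 2) \<mu> = span {H \<mu>})"

text \<open>\<open>\<Phi> t = e\<^sup>t\<^sup>H\<close> is defined for \<open>\<bar>t\<bar> < \<delta>\<close> on the neighbourhood \<open>G\<close> of \<open>\<xi>\<close> in \<open>U\<close>.\<close>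

definition local_flow ::
    "'a::real_normed_vector set \<Rightarrow> ('a \<Rightarrow> 'a) \<Rightarrow> 'a \<Rightarrow> real \<Rightarrow> 'a set \<Rightarrow> (real \<Rightarrow> 'a \<Rightarrow> 'a) \<Rightarrow> bool" where
  "local_flow U H \<xi> \<delta> G \<Phi> \<longleftrightarrow>
     \<delta> > 0 \<and> openin (top_of_set U) G \<and> \<xi> \<in> G \<and>
     smooth_map_on ({-\<delta><..<\<delta>} \<times> G) (\<lambda>(t, \<mu>). \<Phi> t \<mu>) \<and>
     (\<forall>\<mu>\<in>G. \<Phi> 0 \<mu> = \<mu> \<and>
        (\<forall>t\<in>{-\<delta><..<\<delta>}. \<Phi> t \<mu> \<in> U \<and>
           ((\<lambda>s. \<Phi> s \<mu>) has_vector_derivative H (\<Phi> t \<mu>)) (at t)))"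

text \<open>The value at \<open>t\<close> is $(e^{-tH})_* \mathcal J(e^{tH}\xi)$, before passing to the quotient
  $W_\xi$.\<close>

definition jacobi_curve ::
    "'e::euclidean_space set \<Rightarrow> ('e \<Rightarrow> 'e set) \<Rightarrow> (real \<Rightarrow> 'e \<times> 'e \<Rightarrow> 'e \<times> 'e) \<Rightarrow>
     'e \<times> 'e \<Rightarrow> real \<Rightarrow> ('e \<times> 'e) set" where
  "jacobi_curve V \<Delta> \<Phi> \<xi> t =
     pushforward (ann V \<Delta> 2 - ann V \<Delta> 3) (\<Phi> (- t)) (\<Phi> t \<xi>) (jacobi_space V \<Delta> (\<Phi> t \<xi>))"


section \<open>Weight of the reduced Jacobi curve\<close>

definition zero_order_at :: "(real \<Rightarrow> real) \<Rightarrow> real \<Rightarrow> nat \<Rightarrow> bool" where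
  "zero_order_at f \<tau> m \<longleftrightarrow> (\<forall>i<m. (deriv ^^ i) f \<tau> = 0) \<and> (deriv ^^ m) f \<tau> \<noteq> 0"

text \<open>Linear coordinates on the quotient space \<open>A / B\<close>, presented as a linear map defined on \<open>A\<close>
  with kernel \<open>B\<close>; the image of \<open>C / B\<close> in these coordinates is \<open>\<psi> ` C\<close>.\<close>

definition quotient_coords ::
    "'a::real_vector set \<Rightarrow> 'a set \<Rightarrow> ('a \<Rightarrow> 'b::real_vector) \<Rightarrow> bool" where
  "quotient_coords A B \<psi> \<longleftrightarrow> linear \<psi> \<and> \<psi> ` A = UNIV \<and> {a \<in> A. \<psi> a = 0} = B"

text \<open>The curve \<open>\<Lambda>\<close> of half-dimensional subspaces of the \<open>2 n\<close>-dimensional space \<open>A / B\<close> has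
  weight \<open>m\<close> at \<open>\<tau>\<close>; the type \<open>'n\<close> has \<open>n\<close> elements.\<close>

definition has_weight ::
    "'n::finite itself \<Rightarrow> 'a::real_vector set \<Rightarrow> 'a set \<Rightarrow> (real \<Rightarrow> 'a set) \<Rightarrow> real \<Rightarrow> nat \<Rightarrow> bool" where
  "has_weight _ A B \<Lambda> \<tau> m \<longleftrightarrow>
     (\<exists>(\<psi> :: 'a \<Rightarrow> (real ^ 'n) \<times> (real ^ 'n)) (S :: real \<Rightarrow> real ^ 'n ^ 'n). \<exists>\<epsilon>>0.
        quotient_coords A B \<psi> \<and>
        smooth_on {\<tau> - \<epsilon><..<\<tau> + \<epsilon>} S \<and>
        (\<forall>t\<in>{\<tau> - \<epsilon><..<\<tau> + \<epsilon>}. \<psi> ` \<Lambda> t = range (\<lambda>x. (x, S t *v x))) \<and>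
        zero_order_at (\<lambda>t. det (S t - S \<tau>)) \<tau> m)"

text \<open>The field \<open>H\<close> is determined up to a nonvanishing factor, which reparametrizes the curve, and
  its flow germ is determined by \<open>H\<close>.  We demand that a field \<open>H\<close> exists and that the weight is
  constant for each such \<open>H\<close>; local flows of smooth fields always exist.\<close>

definition constant_weight_germ ::
    "'e::euclidean_space set \<Rightarrow> ('e \<Rightarrow> 'e set) \<Rightarrow> 'e \<times> 'e \<Rightarrow> bool" where
  "constant_weight_germ V \<Delta> \<xi> \<longleftrightarrow>
     (\<exists>U H. \<xi> \<in> U \<and> char_field V \<Delta> U H) \<and>
     (\<forall>U H \<delta> G \<Phi>. \<xi> \<in> U \<and> char_field V \<Delta> U H \<and> local_flow U H \<xi> \<delta> G \<Phi> \<longrightarrow>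
        (\<exists>m. \<exists>\<epsilon>>0. \<forall>\<tau>\<in>{-\<epsilon><..<\<epsilon>}.
           has_weight TYPE(2)
             {u \<in> tangent_at (ann V \<Delta> 2) \<xi>. symp \<xi> (euler \<xi>) u = 0}
             (span {H \<xi>, euler \<xi>})
             (jacobi_curve V \<Delta> \<Phi> \<xi>) \<tau> m))"


section \<open>Distributions on manifolds\<close>

type_synonym ('m, 'e) chart = "'m set \<times> ('m \<Rightarrow> 'e)"

abbreviation chart_image :: "('m, 'e) chart \<Rightarrow> 'e set" where
  "chart_image c \<equiv> snd c ` fst c"

abbreviation chart_inv :: "('m, 'e) chart \<Rightarrow> 'e \<Rightarrow> 'm" where
  "chart_inv c \<equiv> inv_into (fst c) (snd c)"

definition smooth_atlas ::
    "('m::topological_space, 'e::euclidean_space) chart set \<Rightarrow> bool" where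
  "smooth_atlas A \<longleftrightarrow>
     (\<Union>c\<in>A. fst c) = UNIV \<and>
     (\<forall>c\<in>A. open (fst c) \<and> open (chart_image c) \<and>
        homeomorphism (fst c) (chart_image c) (snd c) (chart_inv c)) \<and>
     (\<forall>c\<in>A. \<forall>c'\<in>A. smooth_on (snd c ` (fst c \<inter> fst c')) (snd c' \<circ> chart_inv c))"

definition charts_at :: "('m, 'e) chart set \<Rightarrow> 'm \<Rightarrow> ('m, 'e) chart set" where
  "charts_at A q = {c \<in> A. q \<in> fst c}"

definition transition_deriv ::
    "('m, 'e::euclidean_space) chart \<Rightarrow> ('m, 'e) chart \<Rightarrow> 'm \<Rightarrow> 'e \<Rightarrow> 'e" where
  "transition_deriv c c' q = frechet_derivative (snd c' \<circ> chart_inv c) (at (snd c q))"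

text \<open>A tangent (co)vector is the family of its coordinate representations in the charts at the
  base point; charts that do not contain the base point are assigned the value \<open>0\<close>.\<close>

definition tangent_space ::
    "('m, 'e::euclidean_space) chart set \<Rightarrow> 'm \<Rightarrow> (('m, 'e) chart \<Rightarrow> 'e) set" where
  "tangent_space A q =
     {v. (\<forall>c\<in>charts_at A q. \<forall>c'\<in>charts_at A q. v c' = transition_deriv c c' q (v c)) \<and>
         (\<forall>c. c \<notin> charts_at A q \<longrightarrow> v c = 0)}"

definition cotangent_space ::
    "('m, 'e::euclidean_space) chart set \<Rightarrow> 'm \<Rightarrow> (('m, 'e) chart \<Rightarrow> 'e) set" where
  "cotangent_space A q =
     {p. (\<forall>c\<in>charts_at A q. \<forall>c'\<in>charts_at A q. \<forall>v. p c \<bullet> v = p c' \<bullet> transition_deriv c c' q v) \<and>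
         (\<forall>c. c \<notin> charts_at A q \<longrightarrow> p c = 0)}"

definition in_chart ::
    "('m, 'e) chart \<Rightarrow> ('m \<Rightarrow> (('m, 'e) chart \<Rightarrow> 'e) set) \<Rightarrow> 'e \<Rightarrow> 'e set" where
  "in_chart c D x = (\<lambda>v. v c) ` D (chart_inv c x)"

definition distribution ::
    "('m, 'e::euclidean_space) chart set \<Rightarrow> nat \<Rightarrow> ('m \<Rightarrow> (('m, 'e) chart \<Rightarrow> 'e) set) \<Rightarrow> bool" where
  "distribution A k D \<longleftrightarrow>
     (\<forall>q. D q \<subseteq> tangent_space A q) \<and>
     (\<forall>c\<in>A. smooth_distribution (chart_image c) k (in_chart c D))"

text \<open>The constructions above are local and natural under diffeomorphisms, so on a manifold they
  are evaluated in the coordinates of the charts at the given point (equivalently, of any one of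
  them).\<close>

definition has_small_growth_vector ::
    "('m, 'e::euclidean_space) chart set \<Rightarrow> ('m \<Rightarrow> (('m, 'e) chart \<Rightarrow> 'e) set) \<Rightarrow> 'm \<Rightarrow> nat list \<Rightarrow> bool" where
  "has_small_growth_vector A D q ns \<longleftrightarrow>
     (\<forall>c\<in>charts_at A q. \<forall>j<length ns.
        dim (lie_flag (chart_image c) (in_chart c D) (Suc j) (snd c q)) = ns ! j)"

definition annihilator ::
    "('m, 'e::euclidean_space) chart set \<Rightarrow> ('m \<Rightarrow> (('m, 'e) chart \<Rightarrow> 'e) set) \<Rightarrow> nat \<Rightarrow>
     ('m \<times> (('m, 'e) chart \<Rightarrow> 'e)) set" where
  "annihilator A D l =
     {(q, p). p \<in> cotangent_space A q \<and>
        (\<forall>c\<in>charts_at A q. (snd c q, p c) \<in> ann (chart_image c) (in_chart c D) l)}"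

definition regular_locus ::
    "('m, 'e::euclidean_space) chart set \<Rightarrow> ('m \<Rightarrow> (('m, 'e) chart \<Rightarrow> 'e) set) \<Rightarrow>
     ('m \<times> (('m, 'e) chart \<Rightarrow> 'e)) set" where
  "regular_locus A D =
     {(q, p) \<in> annihilator A D 2 - annihilator A D 3.
        \<forall>c\<in>charts_at A q.
          constant_weight_germ (chart_image c) (in_chart c D) (snd c q, p c)}"

end

theory Submission
  imports Defs
begin

text \<open>Near a point choose a frame with \<open>X 0, X 1\<close> spanning \<open>D\<close>, \<open>X 2 = [X 0, X 1]\<close>,
  \<open>X 3 = [X 0, X 2]\<close> and \<open>X 4 = [X 1, X 2]\<close>.  On the annihilator of the second flag space,
  with fibre coordinates \<open>m3, m4\<close> the momenta of \<open>X 3, X 4\<close>, the characteristic field \<open>H\<close>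
  is a multiple of \<open>m4 X 0 - m3 X 1\<close> modulo vertical directions.  Let \<open>F\<close> be the vertical
  field rotating \<open>(m3, m4)\<close>.  Modulo \<open>H\<close> and the Euler field, \<open>F\<close> and \<open>[H, F]\<close> span the
  Jacobi space, whereas \<open>[H, [H, F]]\<close> has a nonzero \<open>X 2\<close> component and
  \<open>[H, [H, [H, F]]]\<close> a nonzero component along \<open>m4 X 3 - m3 X 4\<close>.  Pulling \<open>F\<close> back along
  the flow of \<open>H\<close> therefore gives a curve \<open>w\<close> in the 4-dimensional quotient that together
  with its first three derivatives is a basis at every time, and the reduced Jacobi curve is
  the span of \<open>w\<close> and its first derivative.  In coordinates adapted to this basis at \<open>\<tau>\<close>,
  \<open>det (S t - S \<tau>)\<close> is a unit times the Wronskian of two functions vanishing to orders 2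
  and 3, which vanishes to order 4.  So the weight is 4 everywhere.\<close>

section \<open>Calculus of smooth maps\<close>

text \<open>The obstacle is that the annihilator of the second flag space is a 7-dimensional
  submanifold of a 10-dimensional space on which \<open>H\<close> has only local smooth extensions,
  while brackets and differentials of flows live on open sets. All computations are therefore moved
  to an open set of triples (q, m3, m4). The engine there is the rule that the pull-back of a field
  Y along the flow of H has the pull-back of [H, Y] as its time derivative. Iterated derivatives of
  the curve become iterated brackets, and independence of the curve and its derivatives at time t
  reduces to pointwise independence of six fields at the orbit point. Since H is known only up to a
  nonvanishing factor f, brackets are computed modulo earlier members of the frame; the components
  that decide independence are then free of derivatives of f. The dimensions fit: 7, minus 1 for the
  complement of the Euler field, minus 2 for H and Euler, is 4. The weight comes from the model
  t^2/2, t^3/6, whose Wronskian is t^4/12.\<close>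

abbreviation fderiv :: "('a::real_normed_vector \<Rightarrow> 'b::real_normed_vector) \<Rightarrow> 'a \<Rightarrow> 'a \<Rightarrow> 'b" where
  "fderiv f x \<equiv> frechet_derivative f (at x)"

lemma linear_euclidean_sum:
  fixes f :: "'a::euclidean_space \<Rightarrow> 'b::real_vector"
  assumes "linear f"
  shows "(\<Sum>b\<in>Basis. (v \<bullet> b) *\<^sub>R f b) = f v"
  using linear_sum[OF assms, of "\<lambda>b. (v \<bullet> b) *\<^sub>R b" Basis]
  by (simp add: linear_scale[OF assms] euclidean_representation)

lemma has_vector_derivative_chain:
  assumes "(g has_vector_derivative g') (at t)" "(f has_derivative f') (at (g t))"
  shows "((\<lambda>s. f (g s)) has_vector_derivative f' g') (at t)"
  using vector_derivative_diff_chain_within[OF assms(1), of f f'] has_derivative_at_withinI[OF assms(2)]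
  by (simp add: o_def)

section \<open>Closure properties of the classes C^k and of smooth maps\<close>

lemma Ck_on_Suc_imp: "Ck_on (Suc k) S f \<Longrightarrow> Ck_on k S f"
proof (induction k arbitrary: f)
  case 0
  then show ?case
    by (auto intro!: differentiable_imp_continuous_on differentiable_at_imp_differentiable_on)
next
  case (Suc k)
  then show ?case by simp
qed

lemma Ck_on_subset: "Ck_on k S f \<Longrightarrow> T \<subseteq> S \<Longrightarrow> Ck_on k T f"
  by (induction k arbitrary: f) (auto intro: continuous_on_subset)

lemma frechet_derivative_cong_open:
  assumes "open S" "x \<in> S" "\<And>y. y \<in> S \<Longrightarrow> f y = g y"
  shows "fderiv f x = fderiv g x"
    and "f differentiable (at x) \<longleftrightarrow> g differentiable (at x)"
proof -
  have "(f has_derivative D) (at x) \<longleftrightarrow> (g has_derivative D) (at x)" for D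
    using assms has_derivative_transform_within_open by metis
  then show "fderiv f x = fderiv g x"
    and "f differentiable (at x) \<longleftrightarrow> g differentiable (at x)"
    by (simp_all add: frechet_derivative_def differentiable_def)
qed

lemma Ck_on_cong:
  assumes "open S" "\<And>y. y \<in> S \<Longrightarrow> f y = g y" "Ck_on k S f"
  shows "Ck_on k S g"
  using assms(2,3)
proof (induction k arbitrary: f g)
  case 0
  then show ?case by (metis Ck_on.simps(1) continuous_on_eq)
next
  case (Suc k)
  have "g differentiable (at x)" if "x \<in> S" for x
    using frechet_derivative_cong_open(2)[OF assms(1) that, of f g] Suc.prems that
    by (metis Ck_on.simps(2))
  moreover have "Ck_on k S (\<lambda>x. fderiv g x v)" for v
  proof (rule Suc.IH)
    show "fderiv f y v = fderiv g y v" if "y \<in> S" for y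
      using frechet_derivative_cong_open(1)[OF assms(1) that, of f g] Suc.prems(1) by metis
    show "Ck_on k S (\<lambda>x. fderiv f x v)"
      using Suc.prems(2) by simp
  qed
  ultimately show ?case by simp
qed

lemma Ck_on_local:
  assumes "\<And>x. x \<in> S \<Longrightarrow> \<exists>T. open T \<and> x \<in> T \<and> Ck_on k T f"
  shows "Ck_on k S f"
  using assms
proof (induction k arbitrary: f)
  case 0
  then show ?case
  proof (clarsimp simp: continuous_on_eq_continuous_within)
    fix x assume "x \<in> S"
    with 0 obtain T where "open T" "x \<in> T" "continuous_on T f" by force
    then show "continuous (at x within S) f"
      by (simp add: continuous_on_eq_continuous_at continuous_at_imp_continuous_within)
  qed
next
  case (Suc k)
  have "Ck_on k S (\<lambda>x. fderiv f x v)" for v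
  proof (rule Suc.IH)
    fix x assume "x \<in> S"
    with Suc.prems obtain T where "open T" "x \<in> T" "Ck_on (Suc k) T f" by metis
    then show "\<exists>T. open T \<and> x \<in> T \<and> Ck_on k T (\<lambda>x. fderiv f x v)" by auto
  qed
  moreover have "f differentiable (at x)" if "x \<in> S" for x
    using Suc.prems[OF that] by auto
  ultimately show ?case by simp
qed

lemma Ck_on_const [intro]: "Ck_on k S (\<lambda>x. c)"
  by (induction k arbitrary: c) auto

lemma Ck_on_bounded_linear:
  assumes "bounded_linear f"
  shows "Ck_on k S f"
proof (cases k)
  case 0
  with assms show ?thesis by (simp add: linear_continuous_on)
next
  case (Suc j)
  have "fderiv f x = f" for x
    using frechet_derivative_at[OF bounded_linear_imp_has_derivative[OF assms]] by metis
  with Suc assms show ?thesis by (auto intro: bounded_linear_imp_differentiable)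
qed

lemma Ck_on_add:
  assumes "open S"
  shows "Ck_on k S f \<Longrightarrow> Ck_on k S g \<Longrightarrow> Ck_on k S (\<lambda>x. f x + g x)"
proof (induction k arbitrary: f g)
  case 0
  then show ?case by (simp add: continuous_on_add)
next
  case (Suc k)
  have d: "((\<lambda>x. f x + g x) has_derivative
      (\<lambda>v. fderiv f x v + fderiv g x v)) (at x)"
    if "x \<in> S" for x
    using Suc.prems that by (intro has_derivative_add) (auto simp: frechet_derivative_works[symmetric])
  have "Ck_on k S (\<lambda>x. fderiv (\<lambda>x. f x + g x) x v)" for v
  proof (rule Ck_on_cong[OF assms])
    show "Ck_on k S (\<lambda>x. fderiv f x v + fderiv g x v)"
      using Suc by auto
  qed (simp add: frechet_derivative_at[OF d, symmetric])
  with d show ?case by (auto simp: differentiable_def)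
qed

lemma (in bounded_bilinear) Ck_on_bilinear:
  assumes "open S"
  shows "Ck_on k S f \<Longrightarrow> Ck_on k S g \<Longrightarrow> Ck_on k S (\<lambda>x. prod (f x) (g x))"
proof (induction k arbitrary: f g)
  case 0
  then show ?case by (simp add: continuous_on)
next
  case (Suc k)
  have d: "((\<lambda>x. prod (f x) (g x)) has_derivative
      (\<lambda>v. prod (f x) (fderiv g x v) + prod (fderiv f x v) (g x))) (at x)"
    if "x \<in> S" for x
    using Suc.prems that by (intro FDERIV) (auto simp: frechet_derivative_works[symmetric])
  have "Ck_on k S (\<lambda>x. fderiv (\<lambda>x. prod (f x) (g x)) x v)" for v
  proof (rule Ck_on_cong[OF assms])
    show "Ck_on k S (\<lambda>x. prod (f x) (fderiv g x v)
       + prod (fderiv f x v) (g x))"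
      using Suc Ck_on_Suc_imp[OF Suc.prems(1)] Ck_on_Suc_imp[OF Suc.prems(2)]
      by (intro Ck_on_add[OF assms] Suc.IH) auto
  qed (simp add: frechet_derivative_at[OF d, symmetric])
  with d show ?case by (auto simp: differentiable_def)
qed

lemma Ck_on_sum:
  assumes "open S" "\<And>i. i \<in> I \<Longrightarrow> Ck_on k S (f i)"
  shows "Ck_on k S (\<lambda>x. \<Sum>i\<in>I. f i x)"
  using assms(2)
  by (induction I rule: infinite_finite_induct) (auto intro: Ck_on_add[OF assms(1)])

text \<open>\<open>Ck_on\<close> speaks of derivatives in fixed directions only, but the chain rule
  differentiates \<open>g\<close> in the moving direction \<open>fderiv f x v\<close>. Expanding
  that direction in \<open>Basis\<close> leaves fixed directions with scalar coefficients, to which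
  the induction hypothesis applies.\<close>

lemma Ck_on_compose:
  fixes f :: "'a::real_normed_vector \<Rightarrow> 'b::euclidean_space" and g :: "'b \<Rightarrow> 'c::real_normed_vector"
  assumes "open S" "open T"
  shows "Ck_on k S f \<Longrightarrow> Ck_on k T g \<Longrightarrow> f ` S \<subseteq> T \<Longrightarrow> Ck_on k S (\<lambda>x. g (f x))"
proof (induction k arbitrary: f g)
  case 0
  then show ?case by (auto intro: continuous_on_compose2)
next
  case (Suc k)
  have d: "((\<lambda>x. g (f x)) has_derivative
      (\<lambda>v. fderiv g (f x) (fderiv f x v))) (at x)"
    if "x \<in> S" for x
    using diff_chain_at[of f "fderiv f x" x g "fderiv g (f x)"]
      Suc.prems that by (auto simp: frechet_derivative_works[symmetric] o_def image_subset_iff)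
  have "Ck_on k S (\<lambda>x. fderiv (\<lambda>x. g (f x)) x v)" for v
  proof (rule Ck_on_cong[OF assms(1)])
    show "Ck_on k S (\<lambda>x. \<Sum>b\<in>Basis. (fderiv f x v \<bullet> b) *\<^sub>R
          fderiv g (f x) b)"
    proof (intro Ck_on_sum[OF assms(1)] bounded_bilinear.Ck_on_bilinear[OF bounded_bilinear_scaleR assms(1)])
      show "Ck_on k S (\<lambda>x. fderiv f x v \<bullet> b)" for b
        using Suc.prems by (intro bounded_bilinear.Ck_on_bilinear[OF bounded_bilinear_inner assms(1)]) auto
      show "Ck_on k S (\<lambda>x. fderiv g (f x) b)" for b
        using Suc.prems Ck_on_Suc_imp[OF Suc.prems(1)]
        by (intro Suc.IH[of f "\<lambda>y. fderiv g y b"]) auto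
    qed
    fix x assume x: "x \<in> S"
    then have "g differentiable (at (f x))" using Suc.prems by auto
    then have l: "linear (fderiv g (f x))" by (rule linear_frechet_derivative)
    show "(\<Sum>b\<in>Basis. (fderiv f x v \<bullet> b) *\<^sub>R fderiv g (f x) b) =
        fderiv (\<lambda>x. g (f x)) x v"
      by (simp add: frechet_derivative_at[OF d[OF x], symmetric] linear_euclidean_sum[OF l])
  qed
  with d show ?case by (auto simp: differentiable_def)
qed

text \<open>The derivative of 1/f is a product of 1/f, Df and 1/f, so the induction closes on 1/f
  itself while f loses one order.\<close>

lemma Ck_on_inverse:
  fixes f :: "'a::real_normed_vector \<Rightarrow> real"
  assumes "open S" "\<And>x. x \<in> S \<Longrightarrow> f x \<noteq> 0"
  shows "Ck_on k S f \<Longrightarrow> Ck_on k S (\<lambda>x. inverse (f x))"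
proof (induction k)
  case 0
  then show ?case using assms by (auto intro: continuous_intros)
next
  case (Suc k)
  have d: "((\<lambda>x. inverse (f x)) has_derivative
      (\<lambda>v. - (inverse (f x) * fderiv f x v * inverse (f x)))) (at x)"
    if "x \<in> S" for x
    using Suc.prems that assms(2)
    by (intro Deriv.has_derivative_inverse) (auto simp: frechet_derivative_works[symmetric])
  have "Ck_on k S (\<lambda>x. fderiv (\<lambda>x. inverse (f x)) x v)" for v
  proof (rule Ck_on_cong[OF assms(1)])
    show "Ck_on k S (\<lambda>x. (-1) * ((inverse (f x) * fderiv f x v) * inverse (f x)))"
      using Suc Ck_on_Suc_imp[OF Suc.prems]
      by (intro bounded_bilinear.Ck_on_bilinear[OF bounded_bilinear_mult assms(1)]) auto
  qed (simp add: frechet_derivative_at[OF d, symmetric])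
  with d show ?case by (auto simp: differentiable_def)
qed

lemma smooth_on_open: "smooth_on S f \<Longrightarrow> open S"
  by (simp add: smooth_on_def)

lemma smooth_on_subset: "smooth_on S f \<Longrightarrow> open T \<Longrightarrow> T \<subseteq> S \<Longrightarrow> smooth_on T f"
  by (auto simp: smooth_on_def intro: Ck_on_subset)

lemma smooth_on_cong: "smooth_on S f \<Longrightarrow> (\<And>y. y \<in> S \<Longrightarrow> f y = g y) \<Longrightarrow> smooth_on S g"
  by (auto simp: smooth_on_def intro: Ck_on_cong)

lemma smooth_on_local:
  assumes "open S" "\<And>x. x \<in> S \<Longrightarrow> \<exists>T. x \<in> T \<and> smooth_on T f"
  shows "smooth_on S f"
  using assms by (auto simp: smooth_on_def intro!: Ck_on_local)

lemma smooth_on_const [intro, simp]: "open S \<Longrightarrow> smooth_on S (\<lambda>x. c)"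
  by (auto simp: smooth_on_def)

lemma smooth_on_bounded_linear: "open S \<Longrightarrow> bounded_linear f \<Longrightarrow> smooth_on S f"
  by (auto simp: smooth_on_def intro: Ck_on_bounded_linear)

lemma smooth_on_linear:
  fixes f :: "'a::euclidean_space \<Rightarrow> 'b::real_normed_vector"
  shows "open S \<Longrightarrow> linear f \<Longrightarrow> smooth_on S f"
  by (simp add: smooth_on_bounded_linear linear_conv_bounded_linear)

lemma smooth_on_id: "open S \<Longrightarrow> smooth_on S (\<lambda>x. x)"
  by (rule smooth_on_bounded_linear) (auto intro: bounded_linear_ident)

lemma smooth_on_add: "smooth_on S f \<Longrightarrow> smooth_on S g \<Longrightarrow> smooth_on S (\<lambda>x. f x + g x)"
  by (auto simp: smooth_on_def intro: Ck_on_add)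

lemma smooth_on_sum:
  "open S \<Longrightarrow> (\<And>i. i \<in> I \<Longrightarrow> smooth_on S (f i)) \<Longrightarrow> smooth_on S (\<lambda>x. \<Sum>i\<in>I. f i x)"
  by (auto simp: smooth_on_def intro: Ck_on_sum)

lemma (in bounded_bilinear) smooth_on_bilinear:
  "smooth_on S f \<Longrightarrow> smooth_on S g \<Longrightarrow> smooth_on S (\<lambda>x. prod (f x) (g x))"
  by (auto simp: smooth_on_def intro: Ck_on_bilinear)

lemmas smooth_on_scaleR = bounded_bilinear.smooth_on_bilinear[OF bounded_bilinear_scaleR]
lemmas smooth_on_inner = bounded_bilinear.smooth_on_bilinear[OF bounded_bilinear_inner]
lemmas smooth_on_mult = bounded_bilinear.smooth_on_bilinear[OF bounded_bilinear_mult]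

lemma smooth_on_compose:
  fixes f :: "'a::real_normed_vector \<Rightarrow> 'b::euclidean_space" and g :: "'b \<Rightarrow> 'c::real_normed_vector"
  shows "smooth_on T g \<Longrightarrow> smooth_on S f \<Longrightarrow> f ` S \<subseteq> T \<Longrightarrow> smooth_on S (\<lambda>x. g (f x))"
  by (auto simp: smooth_on_def intro: Ck_on_compose)

lemma smooth_on_compose_linear:
  fixes f :: "'a::real_normed_vector \<Rightarrow> 'b::euclidean_space" and g :: "'b \<Rightarrow> 'c::real_normed_vector"
  shows "linear g \<Longrightarrow> smooth_on S f \<Longrightarrow> smooth_on S (\<lambda>x. g (f x))"
  by (rule smooth_on_compose[of UNIV g]) (auto intro: smooth_on_linear)

lemma smooth_on_uminus: "smooth_on S f \<Longrightarrow> smooth_on S (\<lambda>x. - f x)"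
  using smooth_on_scaleR[of S "\<lambda>_. -1" f] by (auto dest: smooth_on_open)

lemma smooth_on_diff: "smooth_on S f \<Longrightarrow> smooth_on S g \<Longrightarrow> smooth_on S (\<lambda>x. f x - g x)"
  using smooth_on_add[of S f "\<lambda>x. - g x"] smooth_on_uminus[of S g] by simp

lemma smooth_on_inverse:
  fixes f :: "'a::real_normed_vector \<Rightarrow> real"
  shows "smooth_on S f \<Longrightarrow> (\<And>x. x \<in> S \<Longrightarrow> f x \<noteq> 0) \<Longrightarrow> smooth_on S (\<lambda>x. inverse (f x))"
  by (auto simp: smooth_on_def intro: Ck_on_inverse)

lemma smooth_on_divide:
  fixes f g :: "'a::real_normed_vector \<Rightarrow> real"
  shows "smooth_on S f \<Longrightarrow> smooth_on S g \<Longrightarrow> (\<And>x. x \<in> S \<Longrightarrow> g x \<noteq> 0) \<Longrightarrow> smooth_on S (\<lambda>x. f x / g x)"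
  by (simp add: divide_inverse smooth_on_mult smooth_on_inverse)

lemma smooth_on_prod:
  fixes f :: "'i \<Rightarrow> 'a::real_normed_vector \<Rightarrow> real"
  assumes "open S" "\<And>i. i \<in> I \<Longrightarrow> smooth_on S (f i)"
  shows "smooth_on S (\<lambda>x. \<Prod>i\<in>I. f i x)"
  using assms(2)
  by (induction I rule: infinite_finite_induct) (auto intro: smooth_on_mult assms)

text \<open>For a linear outer map the derivative is again an outer composition with the same map,
  so no basis of the intermediate space enters; this is what makes pairs of maps into arbitrary
  normed spaces available.\<close>

lemma Ck_on_compose_bounded_linear:
  assumes g: "bounded_linear g" and "open S"
  shows "Ck_on k S f \<Longrightarrow> Ck_on k S (\<lambda>x. g (f x))"
proof (induction k arbitrary: f)
  case 0
  then show ?case by (simp add: bounded_linear.continuous_on[OF g])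
next
  case (Suc k)
  have d: "((\<lambda>x. g (f x)) has_derivative (\<lambda>v. g (fderiv f x v))) (at x)" if "x \<in> S" for x
    using Suc.prems that
    by (intro bounded_linear.has_derivative[OF g]) (auto simp: frechet_derivative_works[symmetric])
  have "Ck_on k S (\<lambda>x. fderiv (\<lambda>x. g (f x)) x v)" for v
    using Suc.prems
    by (intro Ck_on_cong[OF assms(2) _ Suc.IH[of "\<lambda>x. fderiv f x v"]])
      (auto simp: frechet_derivative_at[OF d, symmetric])
  with d show ?case by (auto simp: differentiable_def)
qed

lemma smooth_on_Pair:
  fixes f :: "'a::real_normed_vector \<Rightarrow> 'b::real_normed_vector" and g :: "'a \<Rightarrow> 'c::real_normed_vector"
  assumes "smooth_on S f" "smooth_on S g"
  shows "smooth_on S (\<lambda>x. (f x, g x))"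
proof -
  have bl: "bounded_linear (\<lambda>x. (x, 0) :: 'b \<times> 'c)" "bounded_linear (\<lambda>x. (0, x) :: 'b \<times> 'c)"
    by (intro bounded_linear_Pair bounded_linear_ident bounded_linear_zero)+
  have "smooth_on S (\<lambda>x. (f x, 0 :: 'c))" "smooth_on S (\<lambda>x. (0 :: 'b, g x))"
    using assms Ck_on_compose_bounded_linear[OF bl(1), of S _ f]
      Ck_on_compose_bounded_linear[OF bl(2), of S _ g] by (simp_all add: smooth_on_def)
  then have "smooth_on S (\<lambda>x. (f x, 0) + (0, g x))" by (rule smooth_on_add)
  then show ?thesis by simp
qed

lemma smooth_on_vec:
  fixes f :: "'n::finite \<Rightarrow> 'a::real_normed_vector \<Rightarrow> 'b::euclidean_space"
  assumes "open S" "\<And>i. smooth_on S (f i)"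
  shows "smooth_on S (\<lambda>x. \<chi> i. f i x)"
proof -
  have lin: "linear (\<lambda>y::'b. \<chi> j. if j = i then y else 0)" for i :: 'n
    by (rule linearI) (auto simp: vec_eq_iff)
  have "smooth_on S (\<lambda>x. \<Sum>i\<in>UNIV. (\<chi> j. if j = i then f i x else 0))"
    by (intro smooth_on_sum assms(1) smooth_on_compose_linear[OF lin] assms(2))
  moreover have "(\<Sum>i\<in>UNIV. (\<chi> j. if j = i then f i x else 0)) = (\<chi> i. f i x)" for x
    by (simp add: vec_eq_iff)
  ultimately show ?thesis by simp
qed

lemma smooth_on_differentiable: "smooth_on S f \<Longrightarrow> x \<in> S \<Longrightarrow> f differentiable (at x)"
  unfolding smooth_on_def using Ck_on.simps(2)[of 0 S f] by blast

lemma smooth_on_has_derivative: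
  "smooth_on S f \<Longrightarrow> x \<in> S \<Longrightarrow> (f has_derivative fderiv f x) (at x)"
  by (simp add: frechet_derivative_works[symmetric] smooth_on_differentiable)

lemma smooth_on_continuous: "smooth_on S f \<Longrightarrow> continuous_on S f"
  unfolding smooth_on_def using Ck_on.simps(1)[of S f] by blast

lemma smooth_on_linear_derivative: "smooth_on S f \<Longrightarrow> x \<in> S \<Longrightarrow> linear (fderiv f x)"
  by (rule linear_frechet_derivative) (rule smooth_on_differentiable)

lemma smooth_on_derivative_const:
  "smooth_on S f \<Longrightarrow> smooth_on S (\<lambda>x. fderiv f x v)"
  unfolding smooth_on_def using Ck_on.simps(2)[of _ S f] by blast

text \<open>Both the point and the direction of the derivative may move. This covers Lie brackets
  (point and direction are fields) and differentials of a flow along an orbit (point and direction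
  are curves).\<close>

lemma smooth_on_derivative_at:
  fixes f :: "'b::euclidean_space \<Rightarrow> 'c::real_normed_vector" and g :: "'a::real_normed_vector \<Rightarrow> 'b"
  assumes f: "smooth_on T f" and g: "smooth_on S g" "g ` S \<subseteq> T" and v: "smooth_on S v"
  shows "smooth_on S (\<lambda>x. fderiv f (g x) (v x))"
proof -
  have "smooth_on S (\<lambda>x. \<Sum>b\<in>Basis. (v x \<bullet> b) *\<^sub>R fderiv f (g x) b)"
    using smooth_on_open[OF v]
    by (intro smooth_on_sum smooth_on_scaleR smooth_on_inner v smooth_on_const
        smooth_on_compose[OF smooth_on_derivative_const[OF f] g]) auto
  moreover have "(\<Sum>b\<in>Basis. (v x \<bullet> b) *\<^sub>R fderiv f (g x) b) =
      fderiv f (g x) (v x)" if "x \<in> S" for x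
  proof -
    have "linear (fderiv f (g x))"
      using smooth_on_linear_derivative[OF f] g that by auto
    then show ?thesis by (rule linear_euclidean_sum)
  qed
  ultimately show ?thesis by (rule smooth_on_cong)
qed

lemma smooth_on_derivative:
  fixes f :: "'b::euclidean_space \<Rightarrow> 'c::real_normed_vector"
  assumes "smooth_on S f" "smooth_on S v"
  shows "smooth_on S (\<lambda>x. fderiv f x (v x))"
  by (rule smooth_on_derivative_at[OF assms(1) smooth_on_id _ assms(2)])
    (use assms smooth_on_open in auto)

lemma smooth_on_lie_bracket:
  fixes X Y :: "'a::euclidean_space \<Rightarrow> 'a"
  shows "smooth_on S X \<Longrightarrow> smooth_on S Y \<Longrightarrow> smooth_on S (lie_bracket X Y)"
  unfolding lie_bracket_def[abs_def] by (intro smooth_on_diff smooth_on_derivative)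

lemma smooth_on_has_vector_derivative:
  fixes f :: "real \<Rightarrow> 'a::real_normed_vector"
  assumes "smooth_on S f" "t \<in> S"
  shows "(f has_vector_derivative fderiv f t 1) (at t)"
  using smooth_on_has_derivative[OF assms] smooth_on_linear_derivative[OF assms]
  unfolding has_vector_derivative_def by (simp add: linear_scale[symmetric])

section \<open>Flows of smooth vector fields\<close>

text \<open>Here \<open>f(s, r) = F (x + s u + r v)\<close> is the integral over \<open>{-h..s}\<close> of its partial
  derivative in \<open>s\<close>, plus \<open>f(-h, r)\<close>; differentiating under the integral sign avoids the
  double mean value argument.\<close>

lemma smooth_on_second_derivative_symmetric:
  fixes F :: "'a::euclidean_space \<Rightarrow> 'b::euclidean_space"
  assumes F: "smooth_on S F" and x: "x \<in> S"
  shows "fderiv (\<lambda>p. fderiv F p u) x v =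
         fderiv (\<lambda>p. fderiv F p v) x u"
proof -
  define D where "D = (\<lambda>w p. fderiv F p w)"
  have D: "smooth_on S (D w)" for w unfolding D_def by (rule smooth_on_derivative_const[OF F])
  let ?l = "\<lambda>s r. x + s *\<^sub>R u + r *\<^sub>R v"
  obtain e where e: "e > 0" "ball x e \<subseteq> S"
    using smooth_on_open[OF F] x open_contains_ball by blast
  define n where "n = norm u + norm v + 1"
  have n: "n > 0" unfolding n_def by (simp add: add_nonneg_pos)
  \<comment> \<open>Chosen so that the whole square of parameters of size at most h stays in the
    ball; the summand 1 in \<open>n\<close> keeps the quotient meaningful when u = v = 0.\<close>
  define h where "h = e / (2 * n)"
  have h: "h > 0" using e n by (simp add: h_def)
  have l: "?l s r \<in> S" if "\<bar>s\<bar> \<le> h" "\<bar>r\<bar> \<le> h" for s r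
  proof -
    have "norm (s *\<^sub>R u + r *\<^sub>R v) \<le> \<bar>s\<bar> * norm u + \<bar>r\<bar> * norm v"
      using norm_triangle_ineq[of "s *\<^sub>R u" "r *\<^sub>R v"] by simp
    also have "\<dots> \<le> h * norm u + h * norm v"
      using that by (intro add_mono mult_right_mono) auto
    also have "\<dots> < 2 * (h * (norm u + norm v + 1))"
      using h by (simp add: algebra_simps add_nonneg_pos)
    also have "\<dots> = e"
      using n by (simp add: h_def n_def[symmetric])
    finally have "dist x (?l s r) < e" by (simp add: dist_norm norm_minus_commute algebra_simps)
    then show ?thesis using e(2) by auto
  qed
  have along_u: "((\<lambda>s. f (?l s r)) has_vector_derivative fderiv f (?l s r) u) (at s)"
    if "smooth_on S f" "\<bar>s\<bar> \<le> h" "\<bar>r\<bar> \<le> h" for f :: "'a \<Rightarrow> 'b" and s r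
    by (rule has_vector_derivative_chain[of "\<lambda>s. ?l s r" u s f])
      (auto intro!: derivative_eq_intros smooth_on_has_derivative[OF that(1)] l that(2,3))
  have along_v: "((\<lambda>r. f (?l s r)) has_vector_derivative fderiv f (?l s r) v) (at r)"
    if "smooth_on S f" "\<bar>s\<bar> \<le> h" "\<bar>r\<bar> \<le> h" for f :: "'a \<Rightarrow> 'b" and s r
    by (rule has_vector_derivative_chain[of "\<lambda>r. ?l s r" v r f])
      (auto intro!: derivative_eq_intros smooth_on_has_derivative[OF that(1)] l that(2,3))
  have cont: "continuous_on {(r, s). \<bar>s\<bar> \<le> h \<and> \<bar>r\<bar> \<le> h} (\<lambda>(r, s). f (?l s r))"
    if "smooth_on S f" for f :: "'a \<Rightarrow> 'b"
    unfolding case_prod_unfold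
    by (rule continuous_on_compose2[OF smooth_on_continuous[OF that]])
      (auto intro!: continuous_intros l)
  have integrable: "continuous_on {-h..s} (\<lambda>\<sigma>. f (?l \<sigma> r))"
    if "smooth_on S f" "\<bar>s\<bar> \<le> h" "\<bar>r\<bar> \<le> h" for f :: "'a \<Rightarrow> 'b" and s r
    by (rule continuous_on_compose2[OF smooth_on_continuous[OF that(1)]])
      (use that in \<open>auto intro!: continuous_intros l\<close>)
  define E where "E = (\<lambda>p. fderiv (D u) p v)"
  have E: "smooth_on S E" unfolding E_def by (rule smooth_on_derivative_const[OF D])
  \<comment> \<open>Both sides are the r-derivative at 0 of one integral, taken under the integral
    sign and after evaluating it. Starting at -h instead of 0 makes 0 an interior point, so that the
    later derivative in s at 0 is two-sided.\<close>
  have main: "integral {-h..s} (\<lambda>\<sigma>. E (?l \<sigma> 0)) = D v (?l s 0) - D v (?l (-h) 0)"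
    if s: "\<bar>s\<bar> \<le> h" for s
  proof (rule vector_derivative_unique_at)
    have "((\<lambda>r. integral (cbox (-h) s) (\<lambda>\<sigma>. D u (?l \<sigma> r))) has_vector_derivative
        integral (cbox (-h) s) (\<lambda>\<sigma>. E (?l \<sigma> 0))) (at 0 within {-h<..<h})"
    proof (rule leibniz_rule_vector_derivative)
      show "((\<lambda>r. D u (?l \<sigma> r)) has_vector_derivative E (?l \<sigma> r)) (at r within {-h<..<h})"
        if "r \<in> {-h<..<h}" "\<sigma> \<in> cbox (-h) s" for r \<sigma>
        using along_v[OF D, of \<sigma> r u] that s unfolding E_def
        by (auto intro: has_vector_derivative_at_within)
      show "(\<lambda>\<sigma>. D u (?l \<sigma> r)) integrable_on cbox (-h) s" if "r \<in> {-h<..<h}" for r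
        unfolding cbox_interval using that
        by (intro integrable_continuous_real integrable[OF D s]) auto
      show "continuous_on ({-h<..<h} \<times> cbox (-h) s) (\<lambda>(r, \<sigma>). E (?l \<sigma> r))"
        by (rule continuous_on_subset[OF cont[OF E]]) (use s in auto)
    qed (use h in auto)
    moreover have "at 0 within {-h<..<h} = at 0" using h by (intro at_within_open) auto
    ultimately show "((\<lambda>r. integral {-h..s} (\<lambda>\<sigma>. D u (?l \<sigma> r))) has_vector_derivative
        integral {-h..s} (\<lambda>\<sigma>. E (?l \<sigma> 0))) (at 0)"
      by (simp only: cbox_interval)
    have eq: "integral {-h..s} (\<lambda>\<sigma>. D u (?l \<sigma> r)) = F (?l s r) - F (?l (-h) r)"
      if r: "r \<in> {-h<..<h}" for r
    proof (rule integral_unique, rule fundamental_theorem_of_calculus)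
      show "((\<lambda>\<sigma>. F (?l \<sigma> r)) has_vector_derivative D u (?l \<sigma> r)) (at \<sigma> within {-h..s})"
        if "\<sigma> \<in> {-h..s}" for \<sigma>
        using along_u[OF F, of \<sigma> r] that s r unfolding D_def
        by (auto intro: has_vector_derivative_at_within)
    qed (use s in auto)
    show "((\<lambda>r. integral {-h..s} (\<lambda>\<sigma>. D u (?l \<sigma> r))) has_vector_derivative
        D v (?l s 0) - D v (?l (-h) 0)) (at 0)"
    proof (rule has_vector_derivative_transform_within_open[of "\<lambda>r. F (?l s r) - F (?l (-h) r)" _ _ "{-h<..<h}"])
      show "((\<lambda>r. F (?l s r) - F (?l (-h) r)) has_vector_derivative
          D v (?l s 0) - D v (?l (-h) 0)) (at 0)"
        unfolding D_def using h s
        by (intro has_vector_derivative_diff along_v[OF F]) auto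
    qed (use h eq in auto)
  qed
  have "E (?l 0 0) = fderiv (D v) (?l 0 0) u"
  proof (rule vector_derivative_unique_at)
    have "((\<lambda>s. integral {-h..s} (\<lambda>\<sigma>. E (?l \<sigma> 0))) has_vector_derivative E (?l 0 0)) (at 0 within {-h..h})"
      by (rule integral_has_vector_derivative[OF integrable[OF E]]) (use h in auto)
    then show "((\<lambda>s. integral {-h..s} (\<lambda>\<sigma>. E (?l \<sigma> 0))) has_vector_derivative E (?l 0 0)) (at 0)"
      using h by (simp add: at_within_Icc_at)
    show "((\<lambda>s. integral {-h..s} (\<lambda>\<sigma>. E (?l \<sigma> 0))) has_vector_derivative
        fderiv (D v) (?l 0 0) u) (at 0)"
    proof (rule has_vector_derivative_transform_within_open[of "\<lambda>s. D v (?l s 0) - D v (?l (-h) 0)" _ _ "{-h<..<h}"])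
      show "((\<lambda>s. D v (?l s 0) - D v (?l (-h) 0)) has_vector_derivative
          fderiv (D v) (?l 0 0) u) (at 0)"
        using has_vector_derivative_diff[OF along_u[OF D, of 0 0 v] has_vector_derivative_const] h by simp
    qed (use h main in auto)
  qed
  then show ?thesis by (simp add: E_def D_def)
qed

text \<open>Gronwall's argument: the squared distance of the two solutions times exp(-2 L t) cannot
  increase, and it starts at 0.\<close>

lemma ode_unique_forward:
  fixes x y :: "real \<Rightarrow> 'a::real_inner"
  assumes x: "\<And>t. 0 \<le> t \<Longrightarrow> t \<le> b \<Longrightarrow> (x has_vector_derivative H (x t)) (at t)"
    and y: "\<And>t. 0 \<le> t \<Longrightarrow> t \<le> b \<Longrightarrow> (y has_vector_derivative H (y t)) (at t)"
    and L: "\<And>t. 0 \<le> t \<Longrightarrow> t \<le> b \<Longrightarrow> norm (H (x t) - H (y t)) \<le> L * norm (x t - y t)"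
    and "x 0 = y 0" "0 \<le> b"
  shows "x b = y b"
proof -
  define g where "g t = ((x t - y t) \<bullet> (x t - y t)) * exp (- 2 * L * t)" for t
  have "g b \<le> g 0"
  proof (rule DERIV_nonpos_imp_nonincreasing[OF \<open>0 \<le> b\<close>])
    fix t assume t: "0 \<le> t" "t \<le> b"
    have "((\<lambda>t. (x t - y t) \<bullet> (x t - y t)) has_real_derivative
        2 * ((H (x t) - H (y t)) \<bullet> (x t - y t))) (at t)"
      using bounded_bilinear.has_vector_derivative[OF bounded_bilinear_inner
          has_vector_derivative_diff[OF x[OF t] y[OF t]] has_vector_derivative_diff[OF x[OF t] y[OF t]]]
      by (simp add: has_real_derivative_iff_has_vector_derivative inner_commute)
    then have "(g has_real_derivative 2 * ((H (x t) - H (y t)) \<bullet> (x t - y t)) * exp (- 2 * L * t) +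
        (- 2 * L) * exp (- 2 * L * t) * ((x t - y t) \<bullet> (x t - y t))) (at t)"
      unfolding g_def[abs_def] by (auto intro!: derivative_eq_intros)
    moreover have "(H (x t) - H (y t)) \<bullet> (x t - y t) \<le> L * ((x t - y t) \<bullet> (x t - y t))"
    proof -
      have "(H (x t) - H (y t)) \<bullet> (x t - y t) \<le> norm (H (x t) - H (y t)) * norm (x t - y t)"
        by (rule norm_cauchy_schwarz)
      also have "\<dots> \<le> (L * norm (x t - y t)) * norm (x t - y t)"
        by (rule mult_right_mono[OF L[OF t]]) simp
      finally show ?thesis by (simp add: power2_norm_eq_inner[symmetric] power2_eq_square mult.assoc)
    qed
    then have "(2 * ((H (x t) - H (y t)) \<bullet> (x t - y t))) * exp (- 2 * L * t)
        \<le> (2 * (L * ((x t - y t) \<bullet> (x t - y t)))) * exp (- 2 * L * t)"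
      by (intro mult_right_mono) auto
    ultimately show "\<exists>d. (g has_real_derivative d) (at t) \<and> d \<le> 0"
      by (intro exI[of _ "2 * ((H (x t) - H (y t)) \<bullet> (x t - y t)) * exp (- 2 * L * t) +
        (- 2 * L) * exp (- 2 * L * t) * ((x t - y t) \<bullet> (x t - y t))"]) (simp add: algebra_simps)
  qed
  then have "(x b - y b) \<bullet> (x b - y b) * exp (- 2 * L * b) \<le> 0"
    by (simp add: g_def \<open>x 0 = y 0\<close>)
  then have "(x b - y b) \<bullet> (x b - y b) \<le> 0"
    by (simp add: mult_le_0_iff)
  then show ?thesis by (metis inner_ge_zero inner_eq_zero_iff order.antisym right_minus_eq)
qed

lemma ode_unique:
  fixes x y :: "real \<Rightarrow> 'a::real_inner"
  assumes x: "\<And>t. \<bar>t\<bar> < r \<Longrightarrow> (x has_vector_derivative H (x t)) (at t)"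
    and y: "\<And>t. \<bar>t\<bar> < r \<Longrightarrow> (y has_vector_derivative H (y t)) (at t)"
    and L: "\<And>t. \<bar>t\<bar> < r \<Longrightarrow> norm (H (x t) - H (y t)) \<le> L * norm (x t - y t)"
    and "x 0 = y 0" "\<bar>b\<bar> < r"
  shows "x b = y b"
proof (cases "b \<ge> 0")
  case True
  show ?thesis
    by (rule ode_unique_forward[of b x H y L]) (rule x y L \<open>x 0 = y 0\<close> True; use assms(5) in simp)+
next
  case False
  have *: "((\<lambda>t. z (- t)) has_vector_derivative - H (z (- t))) (at t)"
    if "(z has_vector_derivative H (z (- t))) (at (- t))" for z t
    using vector_diff_chain_at[OF has_vector_derivative_minus[OF has_vector_derivative_id] that]
    by (simp add: o_def)
  \<comment> \<open>Reversing time turns solutions for H into solutions for -H, which obey the same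
    Lipschitz bound.\<close>
  have "x (- (- b)) = y (- (- b))"
  proof (rule ode_unique_forward[where H = "\<lambda>z. - H z" and L = L and x = "\<lambda>t. x (- t)" and y = "\<lambda>t. y (- t)"])
    show "norm (- H (x (- t)) - - H (y (- t))) \<le> L * norm (x (- t) - y (- t))"
      if "0 \<le> t" "t \<le> - b" for t
      using L[of "- t"] that assms(5) by (simp add: norm_minus_commute)
  qed (use assms False * in auto)
  then show ?thesis by simp
qed

text \<open>The ball is compact, so the sum of the norms of the partial derivatives is bounded on
  it, and this sum dominates the operator norm; the ball is convex, so the mean value inequality
  applies.\<close>

lemma smooth_on_lipschitz_cball:
  fixes f :: "'a::euclidean_space \<Rightarrow> 'b::real_normed_vector"
  assumes f: "smooth_on S f" and "cball x r \<subseteq> S"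
  shows "\<exists>L. \<forall>y\<in>cball x r. \<forall>z\<in>cball x r. norm (f y - f z) \<le> L * norm (y - z)"
proof -
  let ?D = "\<lambda>y. \<Sum>b\<in>Basis. norm (fderiv f y b)"
  have "continuous_on (cball x r) ?D"
    by (intro continuous_intros continuous_on_subset[OF smooth_on_continuous assms(2)]
        smooth_on_derivative_const[OF f])
  then have "bounded (?D ` cball x r)"
    by (intro compact_imp_bounded compact_continuous_image) auto
  then obtain L where L: "\<And>y. y \<in> cball x r \<Longrightarrow> norm (?D y) \<le> L"
    unfolding bounded_iff by blast
  have on: "onorm (fderiv f y) \<le> L" if y: "y \<in> cball x r" for y
  proof (rule onorm_le)
    fix v :: 'a
    have l: "linear (fderiv f y)"
      using smooth_on_linear_derivative[OF f] assms(2) y by auto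
    have "fderiv f y v = (\<Sum>b\<in>Basis. (v \<bullet> b) *\<^sub>R fderiv f y b)"
      by (simp add: linear_euclidean_sum[OF l])
    also have "norm \<dots> \<le> (\<Sum>b\<in>Basis. norm v * norm (fderiv f y b))"
      by (rule sum_norm_le) (auto intro!: mult_right_mono simp: Basis_le_norm)
    also have "\<dots> = norm v * ?D y" by (simp add: sum_distrib_left)
    also have "\<dots> \<le> norm v * L" using L[OF y] by (intro mult_left_mono) auto
    finally show "norm (fderiv f y v) \<le> L * norm v" by (simp add: mult.commute)
  qed
  show ?thesis
  proof (intro exI ballI)
    fix y z assume "y \<in> cball x r" "z \<in> cball x r"
    then show "norm (f y - f z) \<le> L * norm (y - z)"
      using on has_derivative_at_withinI[OF smooth_on_has_derivative[OF f]] assms(2)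
      by (intro differentiable_bound[of "cball x r" f "\<lambda>y. fderiv f y"]) blast+
  qed
qed

text \<open>The counterpart of \<open>local_flow\<close> on an open set, where the differential of
  the flow is a Frechet derivative: trajectories start in \<open>G\<close> and run in
  \<open>M\<close>.\<close>

locale smooth_flow =
  fixes M G :: "'a::euclidean_space set" and H :: "'a \<Rightarrow> 'a" and \<phi> :: "real \<Rightarrow> 'a \<Rightarrow> 'a"
    and \<delta> :: real and \<xi> :: 'a
  assumes H: "smooth_on M H" and G: "open G" "G \<subseteq> M" "\<xi> \<in> G" and \<delta>: "\<delta> > 0"
    and smooth_\<phi>: "smooth_on ({-\<delta><..<\<delta>} \<times> G) (\<lambda>(t, x). \<phi> t x)"
    and flow_zero: "\<And>x. x \<in> G \<Longrightarrow> \<phi> 0 x = x"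
    and flow_in: "\<And>t x. \<bar>t\<bar> < \<delta> \<Longrightarrow> x \<in> G \<Longrightarrow> \<phi> t x \<in> M"
    and flow_ode: "\<And>t x. \<bar>t\<bar> < \<delta> \<Longrightarrow> x \<in> G \<Longrightarrow> ((\<lambda>s. \<phi> s x) has_vector_derivative H (\<phi> t x)) (at t)"
begin

lemma flow_near:
  assumes "open N" "\<xi> \<in> N"
  obtains e where "0 < e" "e \<le> \<delta>" "ball \<xi> e \<subseteq> G"
    "\<And>t x. \<bar>t\<bar> < e \<Longrightarrow> x \<in> ball \<xi> e \<Longrightarrow> \<phi> t x \<in> N"
proof -
  have "open ((\<lambda>(t, x). \<phi> t x) -` N \<inter> ({-\<delta><..<\<delta>} \<times> G))"
    using continuous_open_preimage[OF smooth_on_continuous[OF smooth_\<phi>] smooth_on_open[OF smooth_\<phi>] assms(1)]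
    by (simp add: Int_commute)
  moreover have "(0, \<xi>) \<in> (\<lambda>(t, x). \<phi> t x) -` N \<inter> ({-\<delta><..<\<delta>} \<times> G)"
    using assms G \<delta> flow_zero by auto
  ultimately obtain A B where AB: "open A" "open B" "0 \<in> A" "\<xi> \<in> B"
    "A \<times> B \<subseteq> (\<lambda>(t, x). \<phi> t x) -` N \<inter> ({-\<delta><..<\<delta>} \<times> G)"
    by (rule open_prod_elim) auto
  obtain a where a: "a > 0" "ball 0 a \<subseteq> A" using AB open_contains_ball by blast
  obtain b where b: "b > 0" "ball \<xi> b \<subseteq> B" using AB open_contains_ball by blast
  have m: "\<phi> t x \<in> N \<and> x \<in> G" if "\<bar>t\<bar> < a" "x \<in> ball \<xi> b" for t x
  proof -
    have "t \<in> A" "x \<in> B" using a(2) b(2) that by auto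
    then show ?thesis using AB(5) by auto
  qed
  show ?thesis
    by (rule that[of "min \<delta> (min a b)"]) (use a(1) b(1) \<delta> m m[of 0] in auto)
qed

text \<open>A local flow is given without a group law. Uniqueness supplies it: s -> \<phi> s (\<phi>
  t x) and s -> \<phi> (t + s) x solve the same equation and agree at s = 0; the value at s = -t is
  the claim.\<close>

lemma flow_local_group:
  obtains e where "0 < e" "e \<le> \<delta>" "ball \<xi> e \<subseteq> G"
    "\<And>t x. \<bar>t\<bar> < e \<Longrightarrow> x \<in> ball \<xi> e \<Longrightarrow> \<phi> t x \<in> G"
    "\<And>t x. \<bar>t\<bar> < e \<Longrightarrow> x \<in> ball \<xi> e \<Longrightarrow> \<phi> (- t) (\<phi> t x) = x"
proof -
  obtain r where r: "r > 0" "cball \<xi> r \<subseteq> M"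
    using G open_contains_cball[of G] by (meson subset_trans)
  obtain L where L: "\<And>y z. y \<in> cball \<xi> r \<Longrightarrow> z \<in> cball \<xi> r \<Longrightarrow> norm (H y - H z) \<le> L * norm (y - z)"
    using smooth_on_lipschitz_cball[OF H r(2)] by blast
  obtain e1 where e1: "0 < e1" "e1 \<le> \<delta>" "ball \<xi> e1 \<subseteq> G"
    "\<And>t x. \<bar>t\<bar> < e1 \<Longrightarrow> x \<in> ball \<xi> e1 \<Longrightarrow> \<phi> t x \<in> ball \<xi> r"
    by (rule flow_near[of "ball \<xi> r"]) (use r in auto)
  obtain e2 where e2: "0 < e2" "e2 \<le> \<delta>" "ball \<xi> e2 \<subseteq> G"
    "\<And>t x. \<bar>t\<bar> < e2 \<Longrightarrow> x \<in> ball \<xi> e2 \<Longrightarrow> \<phi> t x \<in> ball \<xi> e1"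
    by (rule flow_near[of "ball \<xi> e1"]) (use e1 in auto)
  \<comment> \<open>Below \<open>e2\<close> the point \<phi> t x is a start point for which
    \<open>e1\<close> works; the half keeps t + s below \<open>e1\<close> when both times are below
    e.\<close>
  define e where "e = min e2 (e1 / 2)"
  have e: "0 < e" "e \<le> \<delta>" "e \<le> e2" "e \<le> e1 / 2" using e1 e2 by (auto simp: e_def)
  show ?thesis
  proof (rule that[of e])
    show "0 < e" "e \<le> \<delta>" "ball \<xi> e \<subseteq> G" using e e2 by auto
    fix t x assume t: "\<bar>t\<bar> < e" and x: "x \<in> ball \<xi> e"
    then have y: "\<phi> t x \<in> ball \<xi> e1" using e2 e by auto
    then show "\<phi> t x \<in> G" using e1 by auto
    have xG: "x \<in> G" using e e2 x by auto
    have "\<phi> (- t) (\<phi> t x) = \<phi> (t + - t) x"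
    proof (rule ode_unique[where x = "\<lambda>s. \<phi> s (\<phi> t x)" and y = "\<lambda>s. \<phi> (t + s) x" and r = e and H = H and L = L])
      fix s assume s: "\<bar>s\<bar> < e"
      show "((\<lambda>s. \<phi> s (\<phi> t x)) has_vector_derivative H (\<phi> s (\<phi> t x))) (at s)"
        using flow_ode s e \<open>\<phi> t x \<in> G\<close> by auto
      have "((\<lambda>s. \<phi> s x) has_vector_derivative H (\<phi> (t + s) x)) (at (t + s))"
        using s t e e1 xG by (intro flow_ode) auto
      then show "((\<lambda>s. \<phi> (t + s) x) has_vector_derivative H (\<phi> (t + s) x)) (at s)"
        using vector_diff_chain_at[of "\<lambda>s. t + s" 1 s "\<lambda>s. \<phi> s x"]
          has_vector_derivative_add[OF has_vector_derivative_const[of t] has_vector_derivative_id[of "at s"]]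
        by (simp add: o_def)
      have "\<phi> s (\<phi> t x) \<in> ball \<xi> r" using e1(4)[OF _ y] s e e1 by auto
      moreover have "\<phi> (t + s) x \<in> ball \<xi> r" using e1(4)[of "t + s" x] s t x e e1 by auto
      ultimately show "norm (H (\<phi> s (\<phi> t x)) - H (\<phi> (t + s) x)) \<le> L * norm (\<phi> s (\<phi> t x) - \<phi> (t + s) x)"
        using L by auto
    qed (use t flow_zero \<open>\<phi> t x \<in> G\<close> in auto)
    then show "\<phi> (- t) (\<phi> t x) = x" using flow_zero xG by simp
  qed
qed

end

section \<open>The linearized flow along one orbit\<close>

locale smooth_flow_inverse = smooth_flow +
  fixes e :: real
  assumes e: "0 < e" "e \<le> \<delta>" "ball \<xi> e \<subseteq> G"
    and flow_G: "\<And>t x. \<bar>t\<bar> < e \<Longrightarrow> x \<in> ball \<xi> e \<Longrightarrow> \<phi> t x \<in> G"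
    and flow_inverse: "\<And>t x. \<bar>t\<bar> < e \<Longrightarrow> x \<in> ball \<xi> e \<Longrightarrow> \<phi> (- t) (\<phi> t x) = x"
begin

definition orbit :: "real \<Rightarrow> 'a" where "orbit t = \<phi> t \<xi>"

definition A :: "real \<Rightarrow> 'a \<Rightarrow> 'a" where "A t = fderiv (\<phi> t) \<xi>"

text \<open>The differential of the flow for time -t at the orbit point, that is, the map that
  carries spaces along the orbit into the fixed tangent space at \<xi>. \<open>A t\<close> turns out
  to be its inverse.\<close>

definition B :: "real \<Rightarrow> 'a \<Rightarrow> 'a" where "B t = fderiv (\<phi> (- t)) (orbit t)"

lemma orbit_in: "\<bar>t\<bar> < e \<Longrightarrow> orbit t \<in> G"
  using flow_G e by (simp add: orbit_def)

lemma orbit_zero: "orbit 0 = \<xi>"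
  using flow_zero G by (simp add: orbit_def)

lemma space_derivative:
  assumes "\<bar>t\<bar> < \<delta>" "x \<in> G"
  shows "(\<phi> t has_derivative (\<lambda>v. fderiv (\<lambda>(t, x). \<phi> t x) (t, x) (0, v))) (at x)"
proof -
  have "((\<lambda>(t, x). \<phi> t x) has_derivative fderiv (\<lambda>(t, x). \<phi> t x) (t, x)) (at (t, x))"
    using assms by (intro smooth_on_has_derivative[OF smooth_\<phi>]) auto
  from diff_chain_at[OF has_derivative_Pair[OF has_derivative_const has_derivative_ident] this]
  show ?thesis by (simp add: o_def)
qed

lemma A_eq: "\<bar>t\<bar> < e \<Longrightarrow> A t v = fderiv (\<lambda>(t, x). \<phi> t x) (t, \<xi>) (0, v)"
  using frechet_derivative_at[OF space_derivative[of t \<xi>], THEN fun_cong, of v] e G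
  by (simp add: A_def)

lemma B_eq: "\<bar>t\<bar> < e \<Longrightarrow> B t v = fderiv (\<lambda>(t, x). \<phi> t x) (- t, orbit t) (0, v)"
  using frechet_derivative_at[OF space_derivative[of "- t" "orbit t"], THEN fun_cong, of v] e orbit_in[of t]
  by (simp add: B_def)

lemma linear_A: "\<bar>t\<bar> < e \<Longrightarrow> linear (A t)"
  using space_derivative[of t \<xi>] e G unfolding A_def
  by (intro linear_frechet_derivative) (auto simp: differentiable_def)

lemma linear_B: "\<bar>t\<bar> < e \<Longrightarrow> linear (B t)"
  using space_derivative[of "- t" "orbit t"] e orbit_in unfolding B_def
  by (intro linear_frechet_derivative) (auto simp: differentiable_def)

lemma B_derivative: "\<bar>t\<bar> < e \<Longrightarrow> (\<phi> (- t) has_derivative B t) (at (orbit t))"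
  using space_derivative[of "- t" "orbit t"] e orbit_in
  unfolding B_def by (auto simp: differentiable_def frechet_derivative_works[symmetric])

lemma B_A: assumes t: "\<bar>t\<bar> < e" shows "B t (A t v) = v"
proof -
  have "(\<phi> t has_derivative A t) (at \<xi>)" "(\<phi> (- t) has_derivative B t) (at (\<phi> t \<xi>))"
    using space_derivative[of t \<xi>] B_derivative[OF t] t e G
    unfolding A_def orbit_def by (auto simp: differentiable_def frechet_derivative_works[symmetric])
  from diff_chain_at[OF this] have "(\<phi> (- t) \<circ> \<phi> t has_derivative B t \<circ> A t) (at \<xi>)" .
  then have "((\<lambda>x. x) has_derivative B t \<circ> A t) (at \<xi>)"
    by (rule has_derivative_transform_within_open[of _ _ _ _ "ball \<xi> e"]) (use t e flow_inverse in auto)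
  then have "B t \<circ> A t = (\<lambda>x. x)" using has_derivative_ident has_derivative_unique by blast
  then show ?thesis by (metis comp_apply)
qed

text \<open>A left inverse of an endomorphism of a finite-dimensional space is two-sided.\<close>

lemma A_B: assumes t: "\<bar>t\<bar> < e" shows "A t (B t v) = v"
  using linear_inverse_left[OF linear_A[OF t] linear_B[OF t]] B_A[OF t] by (metis comp_apply eq_id_iff)

lemma smooth_orbit: "smooth_on {-e<..<e} orbit"
proof -
  have "smooth_on {-e<..<e} (\<lambda>t. (\<lambda>(t, x). \<phi> t x) (t, \<xi>))"
    by (rule smooth_on_compose[OF smooth_\<phi>]) (use e G in \<open>auto intro!: smooth_on_Pair smooth_on_id\<close>)
  then show ?thesis by (simp add: orbit_def[abs_def])
qed

lemma orbit_ode: "\<bar>t\<bar> < e \<Longrightarrow> (orbit has_vector_derivative H (orbit t)) (at t)"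
  using flow_ode[of t \<xi>] e G by (simp add: orbit_def[abs_def])

lemma smooth_B:
  assumes "smooth_on {-e<..<e} v"
  shows "smooth_on {-e<..<e} (\<lambda>t. B t (v t))"
proof -
  have "smooth_on {-e<..<e} (\<lambda>t. fderiv (\<lambda>(t, x). \<phi> t x) (- t, orbit t) (0, v t))"
    by (rule smooth_on_derivative_at[OF smooth_\<phi>])
      (use e G orbit_in in \<open>auto intro!: smooth_on_Pair smooth_on_id smooth_on_uminus smooth_orbit assms\<close>)
  then show ?thesis by (rule smooth_on_cong) (simp add: B_eq abs_less_iff)
qed

text \<open>The variational equation. \<open>A\<close> is a space derivative of the flow; symmetry
  of second derivatives lets the time derivative be taken first, where it equals H along the flow,
  and then the space derivative is the chain rule.\<close>

lemma A_ode:
  assumes t: "\<bar>t\<bar> < e"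
  shows "((\<lambda>s. A s v) has_vector_derivative fderiv H (orbit t) (A t v)) (at t)"
proof -
  let ?\<phi> = "\<lambda>(t, x). \<phi> t x" and ?S = "{-\<delta><..<\<delta>} \<times> G"
  let ?E = "\<lambda>p. fderiv ?\<phi> p (0, v)" and ?T = "\<lambda>p. fderiv ?\<phi> p (1, 0)"
  have in_S: "(t, \<xi>) \<in> ?S" using t e G by auto
  have "((\<lambda>s. (s, \<xi>)) has_vector_derivative (1, 0)) (at t)"
    by (auto intro!: derivative_eq_intros)
  then have "((\<lambda>s. ?E (s, \<xi>)) has_vector_derivative fderiv ?E (t, \<xi>) (1, 0)) (at t)"
    by (rule has_vector_derivative_chain)
      (rule smooth_on_has_derivative[OF smooth_on_derivative_const[OF smooth_\<phi>] in_S])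
  then have "((\<lambda>s. A s v) has_vector_derivative fderiv ?E (t, \<xi>) (1, 0)) (at t)"
    by (rule has_vector_derivative_transform_within_open[of _ _ _ "{-e<..<e}"])
      (use t in \<open>auto simp: A_eq abs_less_iff\<close>)
  moreover have "fderiv ?E (t, \<xi>) (1, 0) = fderiv ?T (t, \<xi>) (0, v)"
    by (rule smooth_on_second_derivative_symmetric[OF smooth_\<phi> in_S])
  moreover have "fderiv ?T (t, \<xi>) (0, v) = fderiv H (orbit t) (A t v)"
  proof -
    \<comment> \<open>The flow equation holds on the whole open box, not only along the orbit, so it
      may be differentiated in space.\<close>
    have T: "?T p = H (?\<phi> p)" if "p \<in> ?S" for p
    proof -
      obtain s x where "p = (s, x)" by (cases p)
      then have p: "p = (s, x)" "\<bar>s\<bar> < \<delta>" "x \<in> G" using that by auto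
      have "((\<lambda>s. (s, x)) has_vector_derivative (1, 0)) (at s)"
        by (auto intro!: derivative_eq_intros)
      then have "((\<lambda>s. \<phi> s x) has_vector_derivative ?T p) (at s)"
        using has_vector_derivative_chain[of "\<lambda>s. (s, x)" "(1, 0)" s ?\<phi>]
          smooth_on_has_derivative[OF smooth_\<phi> that] p(1) by simp
      with flow_ode[OF p(2,3)] p(1) show ?thesis
        using vector_derivative_unique_at by fastforce
    qed
    have "(?\<phi> has_derivative fderiv ?\<phi> (t, \<xi>)) (at (t, \<xi>))"
      by (rule smooth_on_has_derivative[OF smooth_\<phi> in_S])
    moreover have "(H has_derivative fderiv H (orbit t)) (at (?\<phi> (t, \<xi>)))"
      using smooth_on_has_derivative[OF H, of "orbit t"] orbit_in[OF t] G by (auto simp: orbit_def)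
    ultimately have "(H \<circ> ?\<phi> has_derivative fderiv H (orbit t) \<circ> fderiv ?\<phi> (t, \<xi>))
        (at (t, \<xi>))"
      by (rule diff_chain_at)
    then have "(?T has_derivative fderiv H (orbit t) \<circ> fderiv ?\<phi> (t, \<xi>))
        (at (t, \<xi>))"
      by (rule has_derivative_transform_within_open[of _ _ _ _ ?S])
        (use smooth_on_open[OF smooth_\<phi>] in_S T in auto)
    then show ?thesis using frechet_derivative_at A_eq[OF t] by (metis comp_apply)
  qed
  ultimately show ?thesis by simp
qed

text \<open>The derivative of the inverse family \<open>B\<close> is never computed. The pull-back w
  is smooth, so it has some derivative w'; differentiating Y(orbit) = A w by the variational
  equation and by the chain rule gives DH Y + A w' = DY H, hence A w' = [H, Y].\<close>

lemma pullback_ode: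
  assumes Y: "smooth_on M Y" and t: "\<bar>t\<bar> < e"
  shows "((\<lambda>s. B s (Y (orbit s))) has_vector_derivative B t (lie_bracket H Y (orbit t))) (at t)"
proof -
  let ?w = "\<lambda>s. B s (Y (orbit s))"
  have orbit_M: "orbit s \<in> M" if "\<bar>s\<bar> < e" for s using orbit_in[OF that] G by auto
  have "smooth_on {-e<..<e} ?w"
    by (intro smooth_B smooth_on_compose[OF Y smooth_orbit]) (auto simp: abs_less_iff intro!: orbit_M)
  then obtain w' where w': "(?w has_vector_derivative w') (at t)"
    using smooth_on_has_vector_derivative t by (metis abs_less_iff greaterThanLessThan_iff minus_less_iff)
  \<comment> \<open>Written in the basis, the family of linear maps \<open>A s\<close> applied to a
    moving vector becomes a sum of scalar multiples, to which the product rule applies.\<close>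
  have "((\<lambda>s. \<Sum>b\<in>Basis. (?w s \<bullet> b) *\<^sub>R A s b) has_vector_derivative
      (\<Sum>b\<in>Basis. (?w t \<bullet> b) *\<^sub>R fderiv H (orbit t) (A t b) + (w' \<bullet> b) *\<^sub>R A t b)) (at t)"
    by (intro has_vector_derivative_sum bounded_bilinear.has_vector_derivative[OF bounded_bilinear_scaleR]
        A_ode[OF t] bounded_linear.has_vector_derivative[OF bounded_linear_inner_left w'])
  moreover have "(\<Sum>b\<in>Basis. (u \<bullet> b) *\<^sub>R fderiv H (orbit t) (A t b)) =
      fderiv H (orbit t) (A t u)" for u
  proof -
    have l: "linear (fderiv H (orbit t) \<circ> A t)"
      by (intro linear_compose linear_A[OF t] smooth_on_linear_derivative[OF H] orbit_M[OF t])
    show ?thesis using linear_euclidean_sum[OF l] by simp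
  qed
  ultimately have "((\<lambda>s. \<Sum>b\<in>Basis. (?w s \<bullet> b) *\<^sub>R A s b) has_vector_derivative
      fderiv H (orbit t) (A t (?w t)) + A t w') (at t)"
    using linear_euclidean_sum[OF linear_A[OF t]] by (simp add: sum.distrib)
  then have 1: "((\<lambda>s. Y (orbit s)) has_vector_derivative
      fderiv H (orbit t) (A t (?w t)) + A t w') (at t)"
  proof (rule has_vector_derivative_transform_within_open[of _ _ _ "{-e<..<e}"])
    fix s assume "s \<in> {-e<..<e}"
    then have s: "\<bar>s\<bar> < e" by auto
    show "(\<Sum>b\<in>Basis. (?w s \<bullet> b) *\<^sub>R A s b) = Y (orbit s)"
      using linear_euclidean_sum[OF linear_A[OF s]] A_B[OF s] by simp
  qed (use t in auto)
  have 2: "((\<lambda>s. Y (orbit s)) has_vector_derivative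
      fderiv Y (orbit t) (H (orbit t))) (at t)"
    by (rule has_vector_derivative_chain[OF orbit_ode[OF t] smooth_on_has_derivative[OF Y orbit_M[OF t]]])
  have "A t w' = lie_bracket H Y (orbit t)"
    using vector_derivative_unique_at[OF 1 2] by (simp add: A_B[OF t] lie_bracket_def algebra_simps)
  then show ?thesis using w' B_A[OF t] by metis
qed

lemma smooth_pullback: "smooth_on M Y \<Longrightarrow> smooth_on {-e<..<e} (\<lambda>s. B s (Y (orbit s)))"
  using G orbit_in by (intro smooth_B smooth_on_compose[OF _ smooth_orbit]) (auto simp: abs_less_iff)

lemma B_zero: "B 0 v = v"
proof -
  have "(\<phi> 0 has_derivative (\<lambda>x. x)) (at \<xi>)"
    by (rule has_derivative_transform_within_open[OF has_derivative_ident G(1) G(3)])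
      (simp add: flow_zero)
  then show ?thesis
    using frechet_derivative_at[of "\<phi> 0" "\<lambda>x. x" \<xi>] by (simp add: B_def orbit_zero fun_eq_iff)
qed

end

section \<open>Order of vanishing and weight\<close>

lemma smooth_on_deriv:
  fixes f :: "real \<Rightarrow> real"
  assumes "smooth_on S f"
  shows "t \<in> S \<Longrightarrow> (f has_real_derivative deriv f t) (at t)" and "smooth_on S (deriv f)"
proof -
  have d: "(f has_real_derivative fderiv f t 1) (at t)" if "t \<in> S" for t
    using smooth_on_has_vector_derivative[OF assms that]
    by (simp add: has_real_derivative_iff_has_vector_derivative)
  have eq: "fderiv f t 1 = deriv f t" if "t \<in> S" for t
    using DERIV_imp_deriv[OF d[OF that]] by simp
  show "(f has_real_derivative deriv f t) (at t)" if "t \<in> S"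
    using d[OF that] eq[OF that] by simp
  show "smooth_on S (deriv f)"
    using smooth_on_derivative_const[OF assms, of 1] eq by (rule smooth_on_cong)
qed

lemma smooth_on_higher_deriv:
  fixes f :: "real \<Rightarrow> real"
  shows "smooth_on S f \<Longrightarrow> smooth_on S ((deriv ^^ n) f)"
  by (induction n) (auto intro: smooth_on_deriv)

lemma higher_deriv_cong_open:
  fixes f g :: "real \<Rightarrow> real"
  assumes "open S" "t \<in> S" "\<And>s. s \<in> S \<Longrightarrow> f s = g s"
  shows "(deriv ^^ n) f t = (deriv ^^ n) g t"
proof -
  have "\<forall>t\<in>S. (deriv ^^ n) f t = (deriv ^^ n) g t"
  proof (induction n)
    case (Suc n)
    have "deriv ((deriv ^^ n) f) t = deriv ((deriv ^^ n) g) t" if "t \<in> S" for t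
      using Suc assms(1) that by (intro deriv_cong_ev) (auto simp: eventually_nhds)
    then show ?case by simp
  qed (use assms in auto)
  with assms show ?thesis by auto
qed

text \<open>Iterated \<open>deriv\<close> adds derivatives at the outside, whereas a known formula
  describes the first, innermost one; this peels off the latter.\<close>

lemma higher_deriv_Suc:
  fixes f f' :: "real \<Rightarrow> real"
  assumes "open S" "t \<in> S" "\<And>s. s \<in> S \<Longrightarrow> (f has_real_derivative f' s) (at s)"
  shows "(deriv ^^ Suc n) f t = (deriv ^^ n) f' t"
proof -
  have "(deriv ^^ Suc n) f t = (deriv ^^ n) (deriv f) t" by (simp only: funpow_Suc_right o_apply)
  also have "\<dots> = (deriv ^^ n) f' t"
    using assms by (intro higher_deriv_cong_open[of S]) (auto dest: DERIV_imp_deriv)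
  finally show ?thesis .
qed

lemma higher_deriv_add:
  fixes f g :: "real \<Rightarrow> real"
  assumes "smooth_on S f" "smooth_on S g" "t \<in> S"
  shows "(deriv ^^ n) (\<lambda>s. f s + g s) t = (deriv ^^ n) f t + (deriv ^^ n) g t"
  using assms(1,2)
proof (induction n arbitrary: f g)
  case (Suc n)
  note d = smooth_on_deriv[OF Suc.prems(1)] smooth_on_deriv[OF Suc.prems(2)]
  have "(deriv ^^ Suc n) (\<lambda>s. f s + g s) t = (deriv ^^ n) (\<lambda>s. deriv f s + deriv g s) t"
    using d by (intro higher_deriv_Suc[OF smooth_on_open[OF assms(1)] assms(3)] DERIV_add)
  also have "\<dots> = (deriv ^^ n) (deriv f) t + (deriv ^^ n) (deriv g) t"
    by (rule Suc.IH) (rule d)+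
  finally show ?case by (simp only: funpow_Suc_right o_apply)
qed simp

text \<open>In Leibniz' formula every other term contains a lower derivative of f. The induction
  splits (f g)' into f' g + f g': the first summand is the previous case for f', the second has the
  leading term (f^(n)) g', which vanishes because n is below the order.\<close>

lemma higher_deriv_mult_leading:
  fixes f g :: "real \<Rightarrow> real"
  assumes "smooth_on S f" "smooth_on S g" "t \<in> S" "\<And>i. i < n \<Longrightarrow> (deriv ^^ i) f t = 0"
  shows "(deriv ^^ n) (\<lambda>s. f s * g s) t = (deriv ^^ n) f t * g t"
  using assms(1,2,4)
proof (induction n arbitrary: f g)
  case (Suc n)
  note d = smooth_on_deriv[OF Suc.prems(1)] smooth_on_deriv[OF Suc.prems(2)]
  have "(deriv ^^ Suc n) (\<lambda>s. f s * g s) t = (deriv ^^ n) (\<lambda>s. deriv f s * g s + f s * deriv g s) t"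
    using DERIV_mult[OF d(1) d(3)]
    by (intro higher_deriv_Suc[OF smooth_on_open[OF assms(1)] assms(3)]) (simp add: algebra_simps)
  also have "\<dots> = (deriv ^^ n) (\<lambda>s. deriv f s * g s) t + (deriv ^^ n) (\<lambda>s. f s * deriv g s) t"
    using d Suc.prems assms(3) by (intro higher_deriv_add smooth_on_mult)
  also have "(deriv ^^ n) (\<lambda>s. f s * deriv g s) t = (deriv ^^ n) f t * deriv g t"
    using Suc.prems d by (intro Suc.IH) auto
  also have "(deriv ^^ n) f t = 0" using Suc.prems by auto
  also have "(deriv ^^ n) (\<lambda>s. deriv f s * g s) t = (deriv ^^ n) (deriv f) t * g t"
  proof (rule Suc.IH)
    show "(deriv ^^ i) (deriv f) t = 0" if "i < n" for i
      using Suc.prems(3)[of "Suc i"] that by (simp only: funpow_Suc_right o_apply Suc_less_eq)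
  qed (use d Suc.prems in auto)
  finally show ?case by (simp only: funpow_Suc_right o_apply mult_zero_left add_0_right)
qed simp

lemma zero_order_at_mult:
  assumes "smooth_on S f" "smooth_on S g" "t \<in> S" "zero_order_at f t m" "g t \<noteq> 0"
  shows "zero_order_at (\<lambda>s. f s * g s) t m"
  using higher_deriv_mult_leading[OF assms(1-3)] assms(4,5)
  by (auto simp: zero_order_at_def)

lemma zero_order_at_cong:
  assumes "open S" "t \<in> S" "\<And>s. s \<in> S \<Longrightarrow> f s = g s" "zero_order_at f t m"
  shows "zero_order_at g t m"
  using assms(4) higher_deriv_cong_open[OF assms(1-3)] by (simp add: zero_order_at_def)

text \<open>Up to order three y and z look like t^2/2 and t^3/6, whose Wronskian is t^4/12; its
  fourth derivative is the 2 that appears at the end.\<close>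

lemma zero_order_at_wronskian:
  fixes y z :: "real \<Rightarrow> real"
  assumes y: "smooth_on S y" and z: "smooth_on S z" and t: "t \<in> S"
    and y0: "y t = 0" "deriv y t = 0" "(deriv ^^ 2) y t = 1" "(deriv ^^ 3) y t = 0"
    and z0: "z t = 0" "deriv z t = 0" "(deriv ^^ 2) z t = 0" "(deriv ^^ 3) z t = 1"
  shows "zero_order_at (\<lambda>t. y t * deriv z t - deriv y t * z t) t 4"
proof -
  define Y where "Y k = (deriv ^^ k) y" for k
  define Z where "Z k = (deriv ^^ k) z" for k
  have Y: "(Y k has_real_derivative Y (Suc k) s) (at s)" if "s \<in> S" for k s
    using smooth_on_deriv(1)[OF smooth_on_higher_deriv[OF y] that] by (simp add: Y_def)
  have Z: "(Z k has_real_derivative Z (Suc k) s) (at s)" if "s \<in> S" for k s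
    using smooth_on_deriv(1)[OF smooth_on_higher_deriv[OF z] that] by (simp add: Z_def)
  \<comment> \<open>The j-th derivative of the Wronskian in closed form, after cancellation. At t
    each product contains one of Y 0, Y 1, Z 0, Z 1, Z 2 and vanishes, with the single exception of
    2 Y 2 Z 3 in \<open>N 4\<close>.\<close>
  define N where "N j =
     (if j = 0 then (\<lambda>t. Y 0 t * Z 1 t - Y 1 t * Z 0 t)
      else if j = 1 then (\<lambda>t. Y 0 t * Z 2 t - Y 2 t * Z 0 t)
      else if j = 2 then (\<lambda>t. Y 1 t * Z 2 t + Y 0 t * Z 3 t - Y 3 t * Z 0 t - Y 2 t * Z 1 t)
      else if j = 3 then (\<lambda>t. 2 * (Y 1 t * Z 3 t) + Y 0 t * Z 4 t - Y 4 t * Z 0 t - 2 * (Y 3 t * Z 1 t))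
      else (\<lambda>t. 2 * (Y 2 t * Z 3 t) + 3 * (Y 1 t * Z 4 t) + Y 0 t * Z 5 t
           - Y 5 t * Z 0 t - 3 * (Y 4 t * Z 1 t) - 2 * (Y 3 t * Z 2 t)))" for j :: nat
  have step: "(N j has_real_derivative N (Suc j) s) (at s)" if "s \<in> S" "j < 4" for j s
  proof -
    note DERIV = DERIV_cmult DERIV_diff DERIV_add DERIV_mult Y[OF that(1)] Z[OF that(1)]
    have "j = 0 \<or> j = 1 \<or> j = 2 \<or> j = 3" using that(2) by linarith
    then consider "j = 0" | "j = 1" | "j = 2" | "j = 3" by blast
    then show ?thesis
    proof cases
      case 1
      then show ?thesis
        by (simp add: N_def) (rule DERIV_cong, (rule DERIV)+, simp add: eval_nat_numeral algebra_simps)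
    next
      case 2
      then show ?thesis
        by (simp add: N_def) (rule DERIV_cong, (rule DERIV)+, simp add: eval_nat_numeral algebra_simps)
    next
      case 3
      then show ?thesis
        by (simp add: N_def) (rule DERIV_cong, (rule DERIV)+, simp add: eval_nat_numeral algebra_simps)
    next
      case 4
      then show ?thesis
        by (simp add: N_def) (rule DERIV_cong, (rule DERIV)+, simp add: eval_nat_numeral algebra_simps)
    qed
  qed
  have D: "(deriv ^^ i) (N 0) t = N i t" if "i \<le> 4" for i
  proof -
    have "(deriv ^^ i) (N j) s = N (j + i) s" if "i + j \<le> 4" "s \<in> S" for i j s
      using that
    proof (induction i arbitrary: j)
      case (Suc i)
      have "(deriv ^^ Suc i) (N j) s = (deriv ^^ i) (N (Suc j)) s"
        using Suc.prems by (intro higher_deriv_Suc[OF smooth_on_open[OF y]] step) auto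
      then show ?case using Suc.IH[of "Suc j"] Suc.prems by simp
    qed simp
    from this[of i 0] t that show ?thesis by simp
  qed
  have "Y 0 t = 0" "Y 1 t = 0" "Y 2 t = 1" "Y 3 t = 0" "Z 0 t = 0" "Z 1 t = 0" "Z 2 t = 0" "Z 3 t = 1"
    using y0 z0 by (simp_all add: Y_def Z_def)
  then have "N 0 t = 0" "N 1 t = 0" "N 2 t = 0" "N 3 t = 0" "N 4 t = 2"
    by (simp_all add: N_def)
  then have "N i t = 0" if "i < 4" for i
  proof -
    have "i = 0 \<or> i = 1 \<or> i = 2 \<or> i = 3" using that by linarith
    then show ?thesis using \<open>N 0 t = 0\<close> \<open>N 1 t = 0\<close> \<open>N 2 t = 0\<close> \<open>N 3 t = 0\<close> by auto
  qed
  then have "zero_order_at (N 0) t 4"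
    using D \<open>N 4 t = 2\<close> by (simp add: zero_order_at_def)
  then show ?thesis by (simp add: N_def Y_def Z_def)
qed

lemma span_two: "x \<in> span {a, b} \<longleftrightarrow> (\<exists>c d. x = c *\<^sub>R a + d *\<^sub>R b)"
  by (auto simp: span_breakdown_eq algebra_simps)

text \<open>With X and Y the matrices whose columns are the first and second coordinate parts of
  \<open>w0\<close> and \<open>w1\<close>, the curve is the graph of S = Y X^(-1), so det S = det Y
  / det X. As \<open>w1\<close> is the derivative of \<open>w0\<close>, det Y is a Wronskian. The
  coordinates are adapted to the four vectors at \<tau>, so the two functions in it have the
  derivatives (0, 0, 1, 0) and (0, 0, 0, 1) there.\<close>

lemma has_weight_four:
  fixes w0 w1 w2 w3 :: "real \<Rightarrow> 'a::euclidean_space"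
  assumes w: "smooth_on {-e<..<e} w0" "smooth_on {-e<..<e} w1"
    and d: "\<And>t. \<bar>t\<bar> < e \<Longrightarrow> (w0 has_vector_derivative w1 t) (at t)"
      "\<And>t. \<bar>t\<bar> < e \<Longrightarrow> (w1 has_vector_derivative w2 t) (at t)"
      "\<And>t. \<bar>t\<bar> < e \<Longrightarrow> (w2 has_vector_derivative w3 t) (at t)"
    and indep: "\<And>t. \<bar>t\<bar> < e \<Longrightarrow> independent {b0, b1, w0 t, w1 t, w2 t, w3 t}
        \<and> distinct [b0, b1, w0 t, w1 t, w2 t, w3 t]"
    and A: "dim A \<le> 6" "subspace A" "\<And>t. \<bar>t\<bar> < e \<Longrightarrow> {b0, b1, w0 t, w1 t, w2 t, w3 t} \<subseteq> A"
    and L: "\<And>t. \<bar>t\<bar> < e \<Longrightarrow> \<Lambda> t = span {b0, b1, w0 t, w1 t}"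
    and \<tau>: "\<bar>\<tau>\<bar> < e"
  shows "has_weight TYPE(2) A (span {b0, b1}) \<Lambda> \<tau> 4"
proof -
  let ?C = "{b0, b1, w0 \<tau>, w1 \<tau>, w2 \<tau>, w3 \<tau>}"
  let ?e1 = "axis 1 1 :: real ^ 2" and ?e2 = "axis 2 1 :: real ^ 2"
  \<comment> \<open>The default 0 covers \<open>b0\<close> and \<open>b1\<close>, which must span
    the kernel. The subspace at \<tau> becomes the first factor, hence the graph of the zero
    matrix.\<close>
  define f where "f x = (if x = w0 \<tau> then (?e1, 0) else if x = w1 \<tau> then (?e2, 0)
      else if x = w2 \<tau> then (0, ?e1) else if x = w3 \<tau> then (0, ?e2) else 0)" for x
  obtain \<psi> where \<psi>: "linear \<psi>" "\<forall>x\<in>?C. \<psi> x = f x"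
    using linear_independent_extend[of ?C f] indep[OF \<tau>] by blast
  have \<psi>_basis: "\<psi> b0 = 0" "\<psi> b1 = 0" "\<psi> (w0 \<tau>) = (?e1, 0)" "\<psi> (w1 \<tau>) = (?e2, 0)"
    "\<psi> (w2 \<tau>) = (0, ?e1)" "\<psi> (w3 \<tau>) = (0, ?e2)"
    using \<psi>(2) indep[OF \<tau>] by (auto simp: f_def)
  note lin = linear_add[OF \<psi>(1)] linear_scale[OF \<psi>(1)] linear_diff[OF \<psi>(1)]
  have e12: "a *\<^sub>R ?e1 + b *\<^sub>R ?e2 = 0 \<longleftrightarrow> a = 0 \<and> b = 0" for a b
    by (auto simp: vec_eq_iff forall_2 axis_def)
  \<comment> \<open>Six independent vectors in a space of dimension at most 6 form a basis of it, so
    \<psi> is controlled on all of \<open>A\<close>.\<close>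
  have "card ?C = 6" using indep[OF \<tau>] by simp
  then have "A \<subseteq> span ?C"
    using A indep[OF \<tau>] \<tau> by (intro card_ge_dim_independent) auto
  have coords: "\<exists>c0 c1 k0 k1 k2 k3. a = c0 *\<^sub>R b0 + c1 *\<^sub>R b1 + k0 *\<^sub>R w0 \<tau> + k1 *\<^sub>R w1 \<tau> + k2 *\<^sub>R w2 \<tau> + k3 *\<^sub>R w3 \<tau>"
    if "a \<in> A" for a
  proof -
    have "a \<in> span ?C" using that \<open>A \<subseteq> span ?C\<close> by auto
    then obtain c0 c1 k0 k1 k2 k3 where
      "a - c0 *\<^sub>R b0 - c1 *\<^sub>R b1 - k0 *\<^sub>R w0 \<tau> - k1 *\<^sub>R w1 \<tau> - k2 *\<^sub>R w2 \<tau> - k3 *\<^sub>R w3 \<tau> = 0"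
      by (auto simp: span_breakdown_eq)
    then show ?thesis
      by (intro exI[of _ c0] exI[of _ c1] exI[of _ k0] exI[of _ k1] exI[of _ k2] exI[of _ k3])
        (simp add: algebra_simps)
  qed
  have quot: "quotient_coords A (span {b0, b1}) \<psi>"
    unfolding quotient_coords_def
  proof (intro conjI)
    show "linear \<psi>" by fact
    show "\<psi> ` A = UNIV"
    proof (intro equalityI subsetI UNIV_I)
      fix p :: "(real ^ 2) \<times> (real ^ 2)"
      let ?a = "(fst p $ 1) *\<^sub>R w0 \<tau> + (fst p $ 2) *\<^sub>R w1 \<tau> + (snd p $ 1) *\<^sub>R w2 \<tau> + (snd p $ 2) *\<^sub>R w3 \<tau>"
      have "?a \<in> A" using A \<tau> by (intro subspace_add subspace_scale) auto
      moreover have "\<psi> ?a = p"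
        by (simp add: lin \<psi>_basis prod_eq_iff vec_eq_iff forall_2 axis_def)
      ultimately show "p \<in> \<psi> ` A" by (metis imageI)
    qed
    show "{a \<in> A. \<psi> a = 0} = span {b0, b1}"
    proof (intro equalityI subsetI)
      fix a assume "a \<in> {a \<in> A. \<psi> a = 0}"
      then have a: "a \<in> A" "\<psi> a = 0" by auto
      obtain c0 c1 k0 k1 k2 k3 where
        eq: "a = c0 *\<^sub>R b0 + c1 *\<^sub>R b1 + k0 *\<^sub>R w0 \<tau> + k1 *\<^sub>R w1 \<tau> + k2 *\<^sub>R w2 \<tau> + k3 *\<^sub>R w3 \<tau>"
        using coords[OF a(1)] by blast
      have "k0 = 0 \<and> k1 = 0 \<and> k2 = 0 \<and> k3 = 0"
        using a(2) unfolding eq by (simp add: lin \<psi>_basis prod_eq_iff e12)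
      then show "a \<in> span {b0, b1}" using eq by (auto simp: span_two)
    next
      fix a assume "a \<in> span {b0, b1}"
      then obtain c d where a: "a = c *\<^sub>R b0 + d *\<^sub>R b1" by (auto simp: span_two)
      have "a \<in> A" using A \<tau> unfolding a by (intro subspace_add subspace_scale) auto
      then show "a \<in> {a \<in> A. \<psi> a = 0}" by (simp add: a lin \<psi>_basis)
    qed
  qed
  define x where "x i t = fst (\<psi> (w0 t)) $ i" for i t
  define y where "y i t = snd (\<psi> (w0 t)) $ i" for i t
  define x' where "x' i t = fst (\<psi> (w1 t)) $ i" for i t
  define y' where "y' i t = snd (\<psi> (w1 t)) $ i" for i t
  have linx: "linear (\<lambda>v. fst (\<psi> v) $ i)" "linear (\<lambda>v. snd (\<psi> v) $ i)" for i
    using \<psi>(1) by (auto simp: linear_iff)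
  have smooth: "smooth_on {-e<..<e} (x i)" "smooth_on {-e<..<e} (y i)"
    "smooth_on {-e<..<e} (x' i)" "smooth_on {-e<..<e} (y' i)" for i
    unfolding x_def[abs_def] y_def[abs_def] x'_def[abs_def] y'_def[abs_def]
    by (intro smooth_on_compose_linear[OF linx(1)] smooth_on_compose_linear[OF linx(2)] w)+
  have vd: "((\<lambda>t. h (u t)) has_real_derivative h u') (at t)"
    if "linear h" "(u has_vector_derivative u') (at t)" for h :: "'a \<Rightarrow> real" and u u' t
    using bounded_linear.has_vector_derivative[OF _ that(2), of h] that(1)
    by (simp add: has_real_derivative_iff_has_vector_derivative linear_conv_bounded_linear)
  \<comment> \<open>This is det X. It is 1 at \<tau>, hence nonzero nearby, which is exactly when
    the subspace is a graph over the first factor.\<close>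
  define D where "D t = x 1 t * x' 2 t - x 2 t * x' 1 t" for t
  have "smooth_on {-e<..<e} D"
    unfolding D_def[abs_def] by (intro smooth_on_diff smooth_on_mult smooth)
  moreover have "D \<tau> = 1"
    by (simp add: D_def x_def x'_def \<psi>_basis axis_def)
  ultimately have "isCont D \<tau>"
    using \<tau> smooth_on_continuous[of "{-e<..<e}" D] continuous_on_eq_continuous_at[of "{-e<..<e}" D]
    by (metis abs_less_iff greaterThanLessThan_iff minus_less_iff open_greaterThanLessThan)
  then obtain \<epsilon>1 where \<epsilon>1: "\<epsilon>1 > 0" "\<And>t. dist \<tau> t < \<epsilon>1 \<Longrightarrow> D t \<noteq> 0"
    using continuous_at_avoid[of \<tau> D 0] \<open>D \<tau> = 1\<close> by auto
  define \<epsilon> where "\<epsilon> = min \<epsilon>1 (e - \<bar>\<tau>\<bar>)"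
  have \<epsilon>: "\<epsilon> > 0" using \<epsilon>1 \<tau> by (simp add: \<epsilon>_def)
  let ?I = "{\<tau> - \<epsilon><..<\<tau> + \<epsilon>}"
  have I: "?I \<subseteq> {-e<..<e}" "\<And>t. t \<in> ?I \<Longrightarrow> D t \<noteq> 0" "\<And>t. t \<in> ?I \<Longrightarrow> \<bar>t\<bar> < e"
  proof -
    show "\<And>t. t \<in> ?I \<Longrightarrow> \<bar>t\<bar> < e" unfolding \<epsilon>_def by auto
    then show "?I \<subseteq> {-e<..<e}" by fastforce
    show "\<And>t. t \<in> ?I \<Longrightarrow> D t \<noteq> 0" using \<epsilon>1 unfolding \<epsilon>_def by (auto simp: dist_real_def)
  qed
  have \<tau>I: "\<tau> \<in> ?I" using \<epsilon> by auto
  note smoothI = smooth[THEN smooth_on_subset, OF _ I(1), simplified]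
  \<comment> \<open>The product Y X^(-1), with the inverse of the 2 by 2 matrix X written
    out.\<close>
  define S :: "real \<Rightarrow> real ^ 2 ^ 2" where "S t = (\<chi> i j. (if j = 1 then y i t * x' 2 t - y' i t * x 2 t
      else y' i t * x 1 t - y i t * x' 1 t) / D t)" for t
  have S_smooth: "smooth_on ?I S"
  proof -
    have "smooth_on ?I (\<lambda>t. (if j = 1 then y i t * x' 2 t - y' i t * x 2 t
      else y' i t * x 1 t - y i t * x' 1 t) / D t)" for i j :: 2
      using I(2) unfolding D_def
      by (cases "j = 1") (auto intro!: smooth_on_divide smooth_on_diff smooth_on_mult smoothI)
    then show ?thesis unfolding S_def[abs_def] by (intro smooth_on_vec) auto
  qed
  have S_apply: "S t *v fst (\<psi> (w0 t)) = snd (\<psi> (w0 t))" "S t *v fst (\<psi> (w1 t)) = snd (\<psi> (w1 t))"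
    if "t \<in> ?I" for t
    using I(2)[OF that] unfolding S_def x_def[symmetric] y_def[symmetric] x'_def[symmetric] y'_def[symmetric]
    by (simp_all add: vec_eq_iff forall_2 matrix_vector_mult_def sum_2
        x_def[symmetric] y_def[symmetric] x'_def[symmetric] y'_def[symmetric] add_divide_distrib[symmetric]
        nonzero_divide_eq_eq)
      (simp_all add: D_def algebra_simps)
  have graph: "\<psi> ` \<Lambda> t = range (\<lambda>x. (x, S t *v x))" if t: "t \<in> ?I" for t
  proof (intro equalityI subsetI)
    fix p assume "p \<in> \<psi> ` \<Lambda> t"
    then obtain v where v: "v \<in> span {b0, b1, w0 t, w1 t}" "p = \<psi> v" using L[OF I(3)[OF t]] by auto
    then obtain c0 c1 k0 k1 where "v - c0 *\<^sub>R b0 - c1 *\<^sub>R b1 - k0 *\<^sub>R w0 t - k1 *\<^sub>R w1 t = 0"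
      by (auto simp: span_breakdown_eq)
    then have v_eq: "v = c0 *\<^sub>R b0 + c1 *\<^sub>R b1 + k0 *\<^sub>R w0 t + k1 *\<^sub>R w1 t" by (simp add: algebra_simps)
    have "p = k0 *\<^sub>R \<psi> (w0 t) + k1 *\<^sub>R \<psi> (w1 t)"
      unfolding v(2) v_eq by (simp add: lin \<psi>_basis)
    then have "snd p = S t *v fst p"
      by (simp add: matrix_vector_right_distrib matrix_vector_mult_scaleR S_apply[OF t])
    then show "p \<in> range (\<lambda>x. (x, S t *v x))"
      by (intro image_eqI[of _ _ "fst p"]) (simp_all add: prod_eq_iff)
  next
    fix p assume "p \<in> range (\<lambda>x. (x, S t *v x))"
    then obtain u where u: "p = (u, S t *v u)" by auto
    \<comment> \<open>Cramer's rule for u = k0 x + k1 x', x and x' being the first parts of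
      \<open>w0 t\<close> and \<open>w1 t\<close>.\<close>
    define k0 k1 where k: "k0 = (u $ 1 * x' 2 t - u $ 2 * x' 1 t) / D t"
      "k1 = (x 1 t * u $ 2 - x 2 t * u $ 1) / D t"
    have "u $ 1 = k0 * x 1 t + k1 * x' 1 t" "u $ 2 = k0 * x 2 t + k1 * x' 2 t"
      using I(2)[OF t] unfolding k times_divide_eq_left add_divide_distrib[symmetric]
      by (simp_all add: nonzero_eq_divide_eq) (simp_all add: D_def algebra_simps)
    then have "fst (k0 *\<^sub>R \<psi> (w0 t) + k1 *\<^sub>R \<psi> (w1 t)) = u"
      by (simp add: vec_eq_iff forall_2 x_def x'_def)
    then have "k0 *\<^sub>R \<psi> (w0 t) + k1 *\<^sub>R \<psi> (w1 t) = p"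
      using S_apply[OF t] unfolding u
      by (auto simp: prod_eq_iff matrix_vector_right_distrib matrix_vector_mult_scaleR)
    moreover have "k0 *\<^sub>R w0 t + k1 *\<^sub>R w1 t \<in> \<Lambda> t"
      unfolding L[OF I(3)[OF t]] by (intro span_add span_scale span_base) auto
    ultimately show "p \<in> \<psi> ` \<Lambda> t" by (metis (no_types, lifting) imageI lin(1,2))
  qed
  have y_at: "y i \<tau> = 0" "y' i \<tau> = 0" for i
    by (simp_all add: y_def y'_def \<psi>_basis)
  have "S \<tau> = 0" by (simp add: S_def vec_eq_iff y_at)
  have y'_deriv: "deriv (y i) t = y' i t" if "\<bar>t\<bar> < e" for i t
    unfolding y_def[abs_def] y'_def by (rule DERIV_imp_deriv) (rule vd[OF linx(2) d(1)[OF that]])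
  have y2: "(deriv ^^ 2) (y i) t = snd (\<psi> (w2 t)) $ i" if t: "\<bar>t\<bar> < e" for i t
  proof -
    have "(deriv ^^ Suc 1) (y i) t = (deriv ^^ 1) (y' i) t"
      using t vd[OF linx(2) d(1)] unfolding y_def[abs_def] y'_def
      by (intro higher_deriv_Suc[of "{-e<..<e}"]) auto
    also have "\<dots> = snd (\<psi> (w2 t)) $ i"
      unfolding y'_def[abs_def] using DERIV_imp_deriv[OF vd[OF linx(2) d(2)[OF t]]] by simp
    finally show ?thesis by (simp add: numeral_2_eq_2)
  qed
  have y3: "(deriv ^^ 3) (y i) t = snd (\<psi> (w3 t)) $ i" if t: "\<bar>t\<bar> < e" for i t
  proof -
    have "(deriv ^^ 3) (y i) t = deriv ((deriv ^^ 2) (y i)) t" by (simp add: numeral_3_eq_3 numeral_2_eq_2)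
    also have "\<dots> = deriv (\<lambda>t. snd (\<psi> (w2 t)) $ i) t"
      using t y2 by (intro deriv_cong_ev eventually_nhds[THEN iffD2] exI[of _ "{-e<..<e}"]) auto
    also have "\<dots> = snd (\<psi> (w3 t)) $ i" by (rule DERIV_imp_deriv) (rule vd[OF linx(2) d(3)[OF t]])
    finally show ?thesis .
  qed
  have "zero_order_at (\<lambda>t. y 1 t * deriv (y 2) t - deriv (y 1) t * y 2 t) \<tau> 4"
    by (rule zero_order_at_wronskian[OF smoothI(2) smoothI(2) \<tau>I])
      (simp_all add: y_at y'_deriv[OF \<tau>] y2[OF \<tau>] y3[OF \<tau>] \<psi>_basis axis_def)
  then have "zero_order_at (\<lambda>t. (y 1 t * deriv (y 2) t - deriv (y 1) t * y 2 t) * inverse (D t)) \<tau> 4"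
    using I(2) \<tau>I unfolding D_def
    by (intro zero_order_at_mult[of ?I] smooth_on_inverse smooth_on_diff smooth_on_mult smoothI smooth_on_deriv(2)) auto
  then have "zero_order_at (\<lambda>t. det (S t - S \<tau>)) \<tau> 4"
  proof (rule zero_order_at_cong[of ?I, rotated 3])
    fix t assume t: "t \<in> ?I"
    \<comment> \<open>The numerator factors as det Y det X; one of the two factors 1 / det X
      cancels.\<close>
    have "det (S t) = ((y 1 t * x' 2 t - y' 1 t * x 2 t) * (y' 2 t * x 1 t - y 2 t * x' 1 t)
       - (y' 1 t * x 1 t - y 1 t * x' 1 t) * (y 2 t * x' 2 t - y' 2 t * x 2 t)) * (inverse (D t) * inverse (D t))"
      by (simp add: det_2 S_def divide_inverse algebra_simps)
    also have "\<dots> = (y 1 t * y' 2 t - y' 1 t * y 2 t) * (D t * inverse (D t)) * inverse (D t)"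
      unfolding D_def by algebra
    also have "\<dots> = (y 1 t * y' 2 t - y' 1 t * y 2 t) * inverse (D t)" using I(2)[OF t] by simp
    finally show "(y 1 t * deriv (y 2) t - deriv (y 1) t * y 2 t) * inverse (D t) = det (S t - S \<tau>)"
      using y'_deriv I(3)[OF t] \<open>S \<tau> = 0\<close> by simp
  qed (use \<tau>I in auto)
  with \<epsilon> quot S_smooth graph show ?thesis
    unfolding has_weight_def by blast
qed

section \<open>Smooth frames and the derived flag\<close>

lemma smooth_on_det:
  fixes M :: "'a::real_normed_vector \<Rightarrow> real ^ 'n ^ 'n"
  assumes "open W" "\<And>i j. smooth_on W (\<lambda>y. M y $ i $ j)"
  shows "smooth_on W (\<lambda>y. det (M y))"
  unfolding det_def using assms
  by (intro smooth_on_sum smooth_on_mult smooth_on_prod) auto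

text \<open>Numbering the fields lets initial segments of one frame span the successive members of
  the flag.\<close>

abbreviation frame_span :: "(nat \<Rightarrow> 'a \<Rightarrow> 'b::real_vector) \<Rightarrow> nat \<Rightarrow> 'a \<Rightarrow> 'b set" where
  "frame_span X k y \<equiv> span ((\<lambda>i. X i y) ` {..<k})"

text \<open>The dual coframe is given by Cramer's rule, which makes its smoothness obvious.\<close>

lemma dual_coframe:
  fixes X :: "nat \<Rightarrow> 'a::real_normed_vector \<Rightarrow> real ^ 'n"
  assumes W: "open W" and X: "\<And>i. i < CARD('n) \<Longrightarrow> smooth_on W (X i)"
    and span: "\<And>y. y \<in> W \<Longrightarrow> frame_span X (CARD('n)) y = UNIV"
  obtains \<theta> where "\<And>i. i < CARD('n) \<Longrightarrow> smooth_on W (\<theta> i)"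
    "\<And>i j y. y \<in> W \<Longrightarrow> i < CARD('n) \<Longrightarrow> j < CARD('n) \<Longrightarrow> \<theta> i y \<bullet> X j y = (if i = j then 1 else 0)"
proof -
  \<comment> \<open>Frames are numbered by naturals, rows of a matrix by the index type;
    \<open>g\<close> translates.\<close>
  obtain g :: "'n \<Rightarrow> nat" where g: "bij_betw g UNIV {..<CARD('n)}"
    using ex_bij_betw_finite_nat[of "UNIV :: 'n set"] by (auto simp: atLeast0LessThan)
  have g_less: "g i < CARD('n)" for i using g by (auto simp: bij_betw_def)
  define M where "M y = (\<chi> i. X (g i) y)" for y
  have det: "det (M y) \<noteq> 0" if "y \<in> W" for y
  proof -
    have "rows (M y) = (\<lambda>i. X i y) ` g ` UNIV"
      by (auto simp: rows_def row_def M_def image_def)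
    then have "span (rows (M y)) = UNIV"
      using span[OF that] g by (simp add: bij_betw_def)
    then show ?thesis
      using matrix_left_invertible_span_rows[of "M y"] invertible_det_nz invertible_left_inverse by blast
  qed
  have M_smooth: "smooth_on W (\<lambda>y. M y $ i $ j)" for i j
  proof -
    have "smooth_on W (\<lambda>y. X (g i) y \<bullet> axis j 1)" by (intro smooth_on_inner X g_less smooth_on_const W)
    then show ?thesis by (simp add: M_def inner_axis)
  qed
  \<comment> \<open>The matrix of the frame with column l replaced by a unit vector, as in Cramer's
    rule for M \<eta> = e_k.\<close>
  define K where "K k l y = (\<chi> i j. if j = l then axis k 1 $ i else M y $ i $ j)" for k l y
  define \<eta> where "\<eta> k y = (\<chi> l. det (K k l y) / det (M y))" for k y
  have K: "smooth_on W (\<lambda>y. K k l y $ i $ j)" for k l i j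
    using M_smooth W by (cases "j = l") (auto simp: K_def)
  have \<eta>: "smooth_on W (\<eta> k)" for k
    unfolding \<eta>_def[abs_def]
    by (intro smooth_on_vec W smooth_on_divide smooth_on_det M_smooth K det)
  have dual: "\<eta> k y \<bullet> X (g j) y = (if k = j then 1 else 0)" if "y \<in> W" for k j y
  proof -
    have "M y *v \<eta> k y = axis k 1"
      unfolding cramer[OF det[OF that]] by (simp add: \<eta>_def K_def)
    then have "(M y *v \<eta> k y) $ j = (if k = j then 1 else 0)" by (simp add: axis_def)
    then show ?thesis
      by (simp add: matrix_vector_mult_def M_def inner_vec_def mult.commute)
  qed
  define h where "h = inv g"
  have h: "g (h i) = i" if "i < CARD('n)" for i
    unfolding h_def using g that by (metis bij_betw_def f_inv_into_f lessThan_iff)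
  show ?thesis
  proof (rule that[of "\<lambda>i. \<eta> (h i)"])
    fix i j y assume "y \<in> W" "i < CARD('n)" "j < CARD('n)"
    then show "\<eta> (h i) y \<bullet> X j y = (if i = j then 1 else 0)"
      using dual[of y "h i" "h j"] h[of i] h[of j] by (metis (full_types))
  qed (rule \<eta>)
qed

locale frame =
  fixes W :: "'a::euclidean_space set" and X \<theta> :: "nat \<Rightarrow> 'a \<Rightarrow> 'a"
  assumes W: "open W"
    and X: "\<And>i. i < DIM('a) \<Longrightarrow> smooth_on W (X i)"
    and \<theta>: "\<And>i. i < DIM('a) \<Longrightarrow> smooth_on W (\<theta> i)"
    and X_span: "\<And>y. y \<in> W \<Longrightarrow> frame_span X (DIM('a)) y = UNIV"
    and dual: "\<And>i j y. y \<in> W \<Longrightarrow> i < DIM('a) \<Longrightarrow> j < DIM('a) \<Longrightarrow> \<theta> i y \<bullet> X j y = (if i = j then 1 else 0)"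
begin

lemma coeff_span:
  assumes "y \<in> W" "k \<le> DIM('a)" "v \<in> frame_span X k y"
  shows "v = (\<Sum>i<k. (\<theta> i y \<bullet> v) *\<^sub>R X i y)"
  using assms(3)
proof (induction rule: span_induct_alt)
  case (step c x z)
  then obtain j where j: "j < k" "x = X j y" by auto
  have "(\<Sum>i<k. (\<theta> i y \<bullet> x) *\<^sub>R X i y) = (\<Sum>i<k. if i = j then X i y else 0)"
    using assms j by (intro sum.cong) (auto simp: dual)
  then show ?case
    using step.IH j by (simp add: inner_add_right scaleR_left.add sum.distrib
        scaleR_scaleR[symmetric] scaleR_sum_right[symmetric] del: scaleR_scaleR)
qed simp

lemma expand: "y \<in> W \<Longrightarrow> v = (\<Sum>i<DIM('a). (\<theta> i y \<bullet> v) *\<^sub>R X i y)"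
  using coeff_span[of y "DIM('a)" v] X_span by auto

lemma expand_dual: 
  assumes y: "y \<in> W"
  shows "p = (\<Sum>i<DIM('a). (p \<bullet> X i y) *\<^sub>R \<theta> i y)"
proof -
  have "p \<bullet> v = (\<Sum>i<DIM('a). (p \<bullet> X i y) *\<^sub>R \<theta> i y) \<bullet> v" for v
  proof -
    have "p \<bullet> v = p \<bullet> (\<Sum>i<DIM('a). (\<theta> i y \<bullet> v) *\<^sub>R X i y)" using expand[OF y, of v] by metis
    also have "\<dots> = (\<Sum>i<DIM('a). (p \<bullet> X i y) *\<^sub>R \<theta> i y) \<bullet> v"
      by (simp add: inner_sum_left inner_sum_right mult.commute)
    finally show ?thesis .
  qed
  then show ?thesis by (metis vector_eq_rdot)
qed

end

text \<open>Constant fields complete the given vectors to a basis at x, and a nonzero determinant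
  persists near x. The gain is the dual coframe, through which coefficients with respect to a
  partial frame become smooth functions.\<close>

lemma frame_extension:
  fixes X :: "nat \<Rightarrow> real ^ 'n \<Rightarrow> real ^ 'n"
  assumes X: "\<And>i. i < k \<Longrightarrow> smooth_on W (X i)" and "open W" and x: "x \<in> W"
    and dim: "dim ((\<lambda>i. X i x) ` {..<k}) = k"
  obtains W' X' \<theta> where "x \<in> W'" "W' \<subseteq> W" "\<And>i. i < k \<Longrightarrow> X' i = X i" "frame W' X' \<theta>"
proof -
  let ?n = "CARD('n)"
  let ?S = "(\<lambda>i. X i x) ` {..<k}"
  have "card ?S \<le> k" using card_image_le[of "{..<k}" "\<lambda>i. X i x"] by simp
  moreover have "dim ?S \<le> card ?S" by (rule dim_le_card') simp
  ultimately have card: "card ?S = k" using dim by simp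
  then have inj: "inj_on (\<lambda>i. X i x) {..<k}" by (simp add: eq_card_imp_inj_on)
  have indep: "independent ?S"
    using card dim by (intro card_le_dim_spanning[of ?S ?S]) (auto intro: span_base)
  obtain B where B: "?S \<subseteq> B" "independent B" "UNIV \<subseteq> span B"
    using maximal_independent_subset_extend[of ?S UNIV] indep by auto
  have cardB: "card B = ?n" and finB: "finite B"
    using B basis_card_eq_dim[of B UNIV] independent_bound[of B] by (auto simp: dim_UNIV)
  have "card (B - ?S) = ?n - k" using card_Diff_subset[of ?S B] B(1) card cardB by simp
  then obtain h where h: "bij_betw h {k..<?n} (B - ?S)"
    using finB by (metis card_atLeastLessThan finite_Diff finite_atLeastLessThan finite_same_card_bij)
  have kn: "k \<le> ?n" using card card_mono[OF finB B(1)] cardB by simp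
  define X' where "X' i = (if i < k then X i else (\<lambda>_. h i))" for i
  have X': "smooth_on W (X' i)" for i using X \<open>open W\<close> by (auto simp: X'_def)
  obtain g :: "'n \<Rightarrow> nat" where g: "bij_betw g UNIV {..<?n}"
    using ex_bij_betw_finite_nat[of "UNIV :: 'n set"] by (auto simp: atLeast0LessThan)
  define M where "M y = (\<chi> i. X' (g i) y)" for y
  have rows: "span (rows (M y)) = UNIV \<longleftrightarrow> det (M y) \<noteq> 0" for y
    using matrix_left_invertible_span_rows[of "M y"] invertible_det_nz invertible_left_inverse by blast
  have rows_eq: "rows (M y) = (\<lambda>i. X' i y) ` {..<?n}" for y
  proof -
    have "rows (M y) = (\<lambda>i. X' i y) ` g ` UNIV"
      by (auto simp: rows_def row_def M_def image_def)
    then show ?thesis using g by (simp add: bij_betw_def)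
  qed
  have "(\<lambda>i. X' i x) ` {..<?n} = B"
  proof -
    have "{..<?n} = {..<k} \<union> {k..<?n}" using kn by auto
    then have "(\<lambda>i. X' i x) ` {..<?n} = ?S \<union> h ` {k..<?n}"
      by (auto simp: X'_def image_Un)
    then show ?thesis using h B(1) by (auto simp: bij_betw_def)
  qed
  then have det_x: "det (M x) \<noteq> 0" using B rows[of x] rows_eq[of x] by auto
  have "smooth_on W (\<lambda>y. det (M y))"
  proof (rule smooth_on_det[OF \<open>open W\<close>])
    fix i j
    have "smooth_on W (\<lambda>y. X' (g i) y \<bullet> axis j 1)" by (intro smooth_on_inner X' smooth_on_const \<open>open W\<close>)
    then show "smooth_on W (\<lambda>y. M y $ i $ j)" by (simp add: M_def inner_axis)
  qed
  then have "continuous_on W (\<lambda>y. det (M y))" by (rule smooth_on_continuous)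
  then have "open (W \<inter> (\<lambda>y. det (M y)) -` (- {0}))"
    by (rule continuous_open_preimage[OF _ \<open>open W\<close>]) auto
  moreover define W' where "W' = W \<inter> (\<lambda>y. det (M y)) -` (- {0})"
  ultimately have W': "open W'" "x \<in> W'" "W' \<subseteq> W" using x det_x by auto
  have X'W: "smooth_on W' (X' i)" for i using X' W' smooth_on_subset by blast
  have span: "frame_span X' ?n y = UNIV" if "y \<in> W'" for y
    using that rows[of y] rows_eq[of y] by (auto simp: W'_def)
  obtain \<theta> where \<theta>: "\<And>i. i < ?n \<Longrightarrow> smooth_on W' (\<theta> i)"
    "\<And>i j y. y \<in> W' \<Longrightarrow> i < ?n \<Longrightarrow> j < ?n \<Longrightarrow> \<theta> i y \<bullet> X' j y = (if i = j then 1 else 0)"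
    by (rule dual_coframe[OF W'(1) X'W span]) auto
  show ?thesis
  proof (rule that[OF W'(2,3)])
    show "frame W' X' \<theta>" using W' X'W span \<theta> by unfold_locales auto
  qed (simp add: X'_def)
qed

section \<open>Brackets of sections and the derived flag in a bracket frame\<close>

text \<open>Leibniz' rule for fields whose projections are combinations of base fields with
  coefficients depending on the upper point. With the identity as \<pi> it describes brackets of
  sections of the flag; with \<open>fst\<close> it computes base components of brackets on the
  annihilator.\<close>

lemma lie_bracket_projection:
  fixes U V :: "'z::euclidean_space \<Rightarrow> 'z" and X :: "nat \<Rightarrow> 'e::euclidean_space \<Rightarrow> 'e"
  assumes \<pi>: "linear \<pi>" and N: "open N" "z \<in> N" and I: "finite I" and J: "finite J"
    and U: "U differentiable (at z)" and V: "V differentiable (at z)"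
    and u: "\<And>i. i \<in> I \<Longrightarrow> u i differentiable (at z)" and v: "\<And>j. j \<in> J \<Longrightarrow> v j differentiable (at z)"
    and X: "\<And>i. i \<in> I \<union> J \<Longrightarrow> X i differentiable (at (\<pi> z))"
    and Ueq: "\<And>y. y \<in> N \<Longrightarrow> \<pi> (U y) = (\<Sum>i\<in>I. u i y *\<^sub>R X i (\<pi> y))"
    and Veq: "\<And>y. y \<in> N \<Longrightarrow> \<pi> (V y) = (\<Sum>j\<in>J. v j y *\<^sub>R X j (\<pi> y))"
  shows "\<pi> (lie_bracket U V z) =
     (\<Sum>j\<in>J. fderiv (v j) z (U z) *\<^sub>R X j (\<pi> z))
     - (\<Sum>i\<in>I. fderiv (u i) z (V z) *\<^sub>R X i (\<pi> z))
     + (\<Sum>i\<in>I. \<Sum>j\<in>J. (u i z * v j z) *\<^sub>R lie_bracket (X i) (X j) (\<pi> z))"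
proof -
  have b: "bounded_linear \<pi>" using \<pi> by (simp add: linear_conv_bounded_linear)
  have key: "\<pi> (fderiv F z h) = (\<Sum>i\<in>K. fderiv (f i) z h *\<^sub>R X i (\<pi> z)
      + f i z *\<^sub>R fderiv (X i) (\<pi> z) (\<pi> h))"
    if F: "F differentiable (at z)" and f: "\<And>i. i \<in> K \<Longrightarrow> f i differentiable (at z)"
      and K: "K \<subseteq> I \<union> J" and eq: "\<And>y. y \<in> N \<Longrightarrow> \<pi> (F y) = (\<Sum>i\<in>K. f i y *\<^sub>R X i (\<pi> y))"
    for F K f h
  proof -
    have 1: "((\<lambda>y. \<pi> (F y)) has_derivative (\<lambda>h. \<pi> (fderiv F z h))) (at z)"
      by (rule bounded_linear.has_derivative[OF b]) (use F in \<open>simp add: frechet_derivative_works[symmetric]\<close>)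
    have "((\<lambda>y. X i (\<pi> y)) has_derivative (\<lambda>h. fderiv (X i) (\<pi> z) (\<pi> h))) (at z)"
      if "i \<in> K" for i
      using diff_chain_at[OF bounded_linear_imp_has_derivative[OF b], of "X i" "fderiv (X i) (\<pi> z)" z]
        X[of i] K that by (auto simp: o_def frechet_derivative_works[symmetric])
    then have "((\<lambda>y. \<Sum>i\<in>K. f i y *\<^sub>R X i (\<pi> y)) has_derivative
       (\<lambda>h. \<Sum>i\<in>K. f i z *\<^sub>R fderiv (X i) (\<pi> z) (\<pi> h)
         + fderiv (f i) z h *\<^sub>R X i (\<pi> z))) (at z)"
      using f by (intro has_derivative_sum has_derivative_scaleR) (auto simp: frechet_derivative_works[symmetric])
    then have "((\<lambda>y. \<pi> (F y)) has_derivative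
       (\<lambda>h. \<Sum>i\<in>K. f i z *\<^sub>R fderiv (X i) (\<pi> z) (\<pi> h)
         + fderiv (f i) z h *\<^sub>R X i (\<pi> z))) (at z)"
      by (rule has_derivative_transform_within_open[OF _ N]) (simp add: eq)
    from has_derivative_unique[OF 1 this] show ?thesis by (simp add: fun_eq_iff add.commute)
  qed
  have lX: "linear (fderiv (X i) (\<pi> z))" if "i \<in> I \<union> J" for i
    by (rule linear_frechet_derivative[OF X[OF that]])
  have 1: "\<pi> (fderiv V z (U z)) = (\<Sum>j\<in>J. fderiv (v j) z (U z) *\<^sub>R X j (\<pi> z))
      + (\<Sum>j\<in>J. \<Sum>i\<in>I. (u i z * v j z) *\<^sub>R fderiv (X j) (\<pi> z) (X i (\<pi> z)))"
    unfolding key[OF V v _ Veq, simplified] sum.distrib Ueq[OF N(2)]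
    by (auto intro!: sum.cong simp: linear_sum[OF lX] linear_scale[OF lX] scaleR_sum_right mult.commute)
  have 2: "\<pi> (fderiv U z (V z)) = (\<Sum>i\<in>I. fderiv (u i) z (V z) *\<^sub>R X i (\<pi> z))
      + (\<Sum>i\<in>I. \<Sum>j\<in>J. (u i z * v j z) *\<^sub>R fderiv (X i) (\<pi> z) (X j (\<pi> z)))"
    unfolding key[OF U u _ Ueq, simplified] sum.distrib Veq[OF N(2)]
    by (auto intro!: sum.cong simp: linear_sum[OF lX] linear_scale[OF lX] scaleR_sum_right)
  have "\<pi> (lie_bracket U V z) = \<pi> (fderiv V z (U z)) - \<pi> (fderiv U z (V z))"
    unfolding lie_bracket_def by (rule linear_diff[OF \<pi>])
  also have "\<dots> = (\<Sum>j\<in>J. fderiv (v j) z (U z) *\<^sub>R X j (\<pi> z))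
     - (\<Sum>i\<in>I. fderiv (u i) z (V z) *\<^sub>R X i (\<pi> z))
     + (\<Sum>i\<in>I. \<Sum>j\<in>J. (u i z * v j z) *\<^sub>R lie_bracket (X i) (X j) (\<pi> z))"
    unfolding 1 2 lie_bracket_def scaleR_diff_right sum_subtractf
    by (subst sum.swap[of _ I J]) simp
  finally show ?thesis .
qed

text \<open>In Leibniz' rule differentiated coefficients multiply frame vectors only, so brackets of
  arbitrary sections are controlled by the frame and its own brackets. The extension to a full frame
  makes the coefficients differentiable.\<close>

lemma lie_bracket_in_subspace:
  fixes X :: "nat \<Rightarrow> real ^ 'n \<Rightarrow> real ^ 'n"
  assumes X: "\<And>i. i < b \<Longrightarrow> smooth_on W (X i)" and W: "open W" "x \<in> W" and ab: "a \<le> b"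
    and dim: "dim ((\<lambda>i. X i x) ` {..<b}) = b"
    and U: "smooth_on N U" "\<And>y. y \<in> N \<inter> W \<Longrightarrow> U y \<in> frame_span X a y"
    and V: "smooth_on N V" "\<And>y. y \<in> N \<inter> W \<Longrightarrow> V y \<in> frame_span X b y"
    and x: "x \<in> N"
    and T: "subspace T" "\<And>i. i < b \<Longrightarrow> X i x \<in> T"
      "\<And>i j. i < a \<Longrightarrow> j < b \<Longrightarrow> lie_bracket (X i) (X j) x \<in> T"
  shows "lie_bracket U V x \<in> T"
proof -
  have bn: "b \<le> CARD('n)" using dim dim_subset_UNIV[of "(\<lambda>i. X i x) ` {..<b}"] by simp
  obtain W' X' \<theta> where W': "x \<in> W'" "W' \<subseteq> W" and X': "\<And>i. i < b \<Longrightarrow> X' i = X i" and fr: "frame W' X' \<theta>"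
    using frame_extension[OF X W dim] by blast
  have Xd: "X i differentiable (at x)" if "i < b" for i
    using smooth_on_differentiable[OF X[OF that]] W(2) .
  interpret frame W' X' \<theta> by (rule fr)
  define M where "M = N \<inter> W'"
  have M: "open M" "x \<in> M" using W' x smooth_on_open[OF U(1)] frame.W[OF fr] by (auto simp: M_def)
  have img: "(\<lambda>i. X' i y) ` {..<k} = (\<lambda>i. X i y) ` {..<k}" if "k \<le> b" for k y
    using X' that by (intro image_cong) auto
  have coeff: "F y = (\<Sum>i<k. (\<theta> i y \<bullet> F y) *\<^sub>R X i y)"
    if "k \<le> b" "F y \<in> frame_span X k y" "y \<in> M" for F k y
    using coeff_span[of y k "F y"] that X' bn img[OF that(1)] by (auto simp: M_def)
  have diff: "(\<lambda>y. \<theta> i y \<bullet> F y) differentiable (at x)" if "i < b" "smooth_on N F" for i F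
  proof -
    have "smooth_on M (\<lambda>y. \<theta> i y \<bullet> F y)"
      using that bn smooth_on_subset[OF \<theta>[of i] M(1)] smooth_on_subset[OF that(2) M(1)]
      by (intro smooth_on_inner) (auto simp: M_def)
    then show ?thesis using M smooth_on_differentiable by blast
  qed
  have eq: "(\<lambda>y. y) (lie_bracket U V x) = (\<Sum>j<b. fderiv (\<lambda>y. \<theta> j y \<bullet> V y) x (U x) *\<^sub>R X j x)
     - (\<Sum>i<a. fderiv (\<lambda>y. \<theta> i y \<bullet> U y) x (V x) *\<^sub>R X i x)
     + (\<Sum>i<a. \<Sum>j<b. ((\<theta> i x \<bullet> U x) * (\<theta> j x \<bullet> V x)) *\<^sub>R lie_bracket (X i) (X j) x)"
    using ab x U(1) V(1) Xd coeff diff U(2) V(2) W'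
    by (intro lie_bracket_projection[OF _ M])
      (auto simp: M_def intro: smooth_on_differentiable linear_id[unfolded id_def])
  have "(\<lambda>y. y) (lie_bracket U V x) \<in> T"
    unfolding eq using T ab by (intro subspace_add subspace_diff subspace_sum subspace_scale) auto
  then show ?thesis .
qed

lemma lie_bracket_self: "lie_bracket X X x = 0"
  by (simp add: lie_bracket_def)

lemma lie_bracket_swap: "lie_bracket Y X x = - lie_bracket X Y x"
  by (simp add: lie_bracket_def)

text \<open>The last equation serves all indices from 4 on, so smoothness holds for every index
  without a bound. The order makes the first 2, 3 and 5 fields span the flag.\<close>

fun bracket_frame :: "('a::real_normed_vector \<Rightarrow> 'a) \<Rightarrow> ('a \<Rightarrow> 'a) \<Rightarrow> nat \<Rightarrow> 'a \<Rightarrow> 'a" where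
  "bracket_frame P Q 0 = P"
| "bracket_frame P Q (Suc 0) = Q"
| "bracket_frame P Q (Suc (Suc 0)) = lie_bracket P Q"
| "bracket_frame P Q (Suc (Suc (Suc 0))) = lie_bracket P (lie_bracket P Q)"
| "bracket_frame P Q (Suc (Suc (Suc (Suc i)))) = lie_bracket Q (lie_bracket P Q)"

text \<open>Brackets of frame fields bound each flag space from above by a span of at most 3 or 5
  vectors; the prescribed dimensions turn these inclusions into equalities.\<close>

lemma flag_frame:
  fixes \<Delta> :: "real ^ 5 \<Rightarrow> (real ^ 5) set"
  assumes PQ: "smooth_on W P" "smooth_on W Q" and WV: "W \<subseteq> V"
    and \<Delta>: "\<And>y. y \<in> W \<Longrightarrow> \<Delta> y = span {P y, Q y}"
    and dims: "\<And>y. y \<in> W \<Longrightarrow> dim (\<Delta> y) = 2" "\<And>y. y \<in> W \<Longrightarrow> dim (lie_flag V \<Delta> 2 y) = 3"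
      "\<And>y. y \<in> W \<Longrightarrow> dim (lie_flag V \<Delta> 3 y) = 5"
  shows "\<And>i. smooth_on W (bracket_frame P Q i)"
    and "\<And>y. y \<in> W \<Longrightarrow> \<Delta> y = span ((\<lambda>i. bracket_frame P Q i y) ` {..<2})"
    and "\<And>y. y \<in> W \<Longrightarrow> lie_flag V \<Delta> 2 y = span ((\<lambda>i. bracket_frame P Q i y) ` {..<3})"
    and "\<And>y. y \<in> W \<Longrightarrow> lie_flag V \<Delta> 3 y = UNIV"
    and "\<And>y. y \<in> W \<Longrightarrow> span ((\<lambda>i. bracket_frame P Q i y) ` {..<5}) = UNIV"
proof -
  let ?X = "bracket_frame P Q"
  have less: "{..<2} = {0, 1::nat}" "{..<3} = {0, 1, 2::nat}" "{..<5} = {0, 1, 2, 3, 4::nat}" by auto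
  have X_simps: "?X 0 = P" "?X 1 = Q" "?X 2 = lie_bracket P Q" "?X 3 = lie_bracket P (lie_bracket P Q)"
    "?X 4 = lie_bracket Q (lie_bracket P Q)" by (simp_all add: eval_nat_numeral)
  show X: "smooth_on W (?X i)" for i
    by (cases "(P, Q, i)" rule: bracket_frame.cases) (auto intro!: smooth_on_lie_bracket PQ)
  have W: "open W" using smooth_on_open[OF PQ(1)] .
  show \<Delta>X: "\<Delta> y = frame_span ?X 2 y" if "y \<in> W" for y
    using \<Delta>[OF that] unfolding less by (simp add: X_simps)
  \<comment> \<open>One stage of the flag, used twice. Sections live on arbitrary open sets N around
    y and are expanded only on the intersection of N and W.\<close>
  have step: "lie_flag V \<Delta> (Suc (Suc k)) y \<subseteq> frame_span ?X b' y"
    if y: "y \<in> W" and b: "\<And>y. y \<in> W \<Longrightarrow> lie_flag V \<Delta> (Suc k) y = frame_span ?X b y"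
      and d: "\<And>y. y \<in> W \<Longrightarrow> dim (lie_flag V \<Delta> (Suc k) y) = b" and bb: "2 \<le> b" "b \<le> b'"
      and br: "\<And>i j. i < 2 \<Longrightarrow> j < b \<Longrightarrow> lie_bracket (?X i) (?X j) y \<in> frame_span ?X b' y"
    for k b b' y
  proof -
    have "lie_bracket U Y y \<in> frame_span ?X b' y"
      if "y \<in> N" "local_section N \<Delta> U" "local_section N (lie_flag V \<Delta> (Suc k)) Y" for N U Y
      by (rule lie_bracket_in_subspace[where X = ?X and W = W and N = N and a = 2 and b = b])
        (use that y b d[OF y] \<Delta>X bb br X W in \<open>auto simp: local_section_def intro: span_base\<close>)
    moreover have "lie_flag V \<Delta> (Suc k) y \<subseteq> frame_span ?X b' y"
      unfolding b[OF y] using bb by (intro span_mono image_mono) auto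
    ultimately show ?thesis
      unfolding lie_flag.simps by (intro span_minimal) auto
  qed
  have sub2: "lie_flag V \<Delta> 2 y \<subseteq> frame_span ?X 3 y" if y: "y \<in> W" for y
    unfolding numeral_2_eq_2
  proof (rule step[OF y, of 0 2])
    fix i j :: nat assume "i < 2" "j < 2"
    then have "(i = 0 \<or> i = 1) \<and> (j = 0 \<or> j = 1)" by auto
    then show "lie_bracket (?X i) (?X j) y \<in> frame_span ?X 3 y"
      unfolding less using lie_bracket_swap[of Q P y]
      by (auto simp: X_simps lie_bracket_self span_0 intro!: span_neg intro: span_base)
  qed (use \<Delta>X dims in auto)
  have dim_le: "dim ((\<lambda>i. ?X i y) ` {..<k}) \<le> k" for k y
    using dim_le_card'[of "(\<lambda>i. ?X i y) ` {..<k}"] card_image_le[of "{..<k}" "\<lambda>i. ?X i y"] by simp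
  show eq2: "lie_flag V \<Delta> 2 y = frame_span ?X 3 y" if y: "y \<in> W" for y
  proof (rule subspace_dim_equal)
    show "subspace (lie_flag V \<Delta> 2 y)" by (simp add: numeral_2_eq_2)
    show "dim (lie_flag V \<Delta> 2 y) \<ge> dim (frame_span ?X 3 y)"
      using dims(2)[OF y] dim_le[of y 3] by (simp add: dim_span)
  qed (use sub2[OF y] in auto)
  have sub3: "lie_flag V \<Delta> 3 y \<subseteq> frame_span ?X 5 y" if y: "y \<in> W" for y
    unfolding numeral_3_eq_3
  proof (rule step[OF y, of "Suc 0" 3])
    fix i j :: nat assume "i < 2" "j < 3"
    then have "(i = 0 \<or> i = 1) \<and> (j = 0 \<or> j = 1 \<or> j = 2)" by auto
    then show "lie_bracket (?X i) (?X j) y \<in> frame_span ?X 5 y"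
      unfolding less using lie_bracket_swap[of Q P y]
      by (auto simp: X_simps lie_bracket_self span_0 intro!: span_neg intro: span_base)
  qed (use eq2 dims in \<open>auto simp: numeral_2_eq_2\<close>)
  have "lie_flag V \<Delta> 3 y = UNIV \<and> frame_span ?X 5 y = UNIV" if y: "y \<in> W" for y
  proof -
    have "subspace (lie_flag V \<Delta> 3 y)" by (simp add: numeral_3_eq_3)
    then have "lie_flag V \<Delta> 3 y = UNIV"
      using dims(3)[OF y] dim_eq_full[of "lie_flag V \<Delta> 3 y"] span_eq_iff[of "lie_flag V \<Delta> 3 y"]
      by simp
    with sub3[OF y] show ?thesis by auto
  qed
  then show "\<And>y. y \<in> W \<Longrightarrow> lie_flag V \<Delta> 3 y = UNIV"
    and "\<And>y. y \<in> W \<Longrightarrow> frame_span ?X 5 y = UNIV" by auto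
qed

section \<open>Tangent spaces and symplectic kernels of zero loci of momenta\<close>

lemma smooth_curve_in_restrict:
  assumes \<gamma>: "smooth_curve_in P x v \<gamma>" and N: "open N" "x \<in> N"
  shows "smooth_curve_in (P \<inter> N) x v \<gamma>"
proof -
  obtain \<epsilon> where \<epsilon>: "\<epsilon> > 0" "smooth_on {-\<epsilon><..<\<epsilon>} \<gamma>" "\<gamma> ` {-\<epsilon><..<\<epsilon>} \<subseteq> P"
    using \<gamma> by (auto simp: smooth_curve_in_def)
  have "open ({-\<epsilon><..<\<epsilon>} \<inter> \<gamma> -` N)"
    by (rule continuous_open_preimage[OF smooth_on_continuous[OF \<epsilon>(2)] _ N(1)]) simp
  moreover have "0 \<in> {-\<epsilon><..<\<epsilon>} \<inter> \<gamma> -` N" using \<gamma> N \<epsilon> by (auto simp: smooth_curve_in_def)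
  ultimately obtain d where d: "d > 0" "ball 0 d \<subseteq> {-\<epsilon><..<\<epsilon>} \<inter> \<gamma> -` N"
    using open_contains_ball by blast
  have "{-d<..<d} \<subseteq> {-\<epsilon><..<\<epsilon>} \<inter> \<gamma> -` N"
    using d(2) by (auto simp: ball_def dist_real_def subset_iff abs_less_iff)
  then show ?thesis
    using \<gamma> \<epsilon> d(1) unfolding smooth_curve_in_def
    by (auto intro!: exI[of _ d] intro: smooth_on_subset simp: subset_iff image_subset_iff)
qed

lemma smooth_curve_in_mono: "smooth_curve_in P x v \<gamma> \<Longrightarrow> P \<subseteq> Q \<Longrightarrow> smooth_curve_in Q x v \<gamma>"
  unfolding smooth_curve_in_def by blast

text \<open>Tangent vectors are velocities at time 0, and a curve through x stays in the open set N
  for a short time. This allows an annihilator to be replaced by its description over the domain of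
  a frame.\<close>

lemma tangent_at_local:
  assumes "open N" "x \<in> N" "P \<inter> N = Q \<inter> N"
  shows "tangent_at P x = tangent_at Q x"
proof -
  have "tangent_at P x \<subseteq> tangent_at Q x" if "P \<inter> N = Q \<inter> N" for P Q
  proof
    fix v assume "v \<in> tangent_at P x"
    then obtain \<gamma> where "smooth_curve_in P x v \<gamma>" by (auto simp: tangent_at_def)
    then have "smooth_curve_in (Q \<inter> N) x v \<gamma>"
      using smooth_curve_in_restrict[OF _ assms(1,2)] that by metis
    then show "v \<in> tangent_at Q x"
      using smooth_curve_in_mono[of "Q \<inter> N" x v \<gamma> Q] by (auto simp: tangent_at_def)
  qed
  with assms(3) show ?thesis by blast
qed

lemma symp_kernel_local:
  assumes "open N" "x \<in> N" "P \<inter> N = Q \<inter> N"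
  shows "symp_kernel P x = symp_kernel Q x"
  unfolding symp_kernel_def tangent_at_local[OF assms] ..

lemma symp_eq: "symp \<xi> u v = snd v \<bullet> fst u - snd u \<bullet> fst v"
proof -
  have "fderiv (\<lambda>y. tautological_form y w) \<xi> = (\<lambda>u. snd u \<bullet> fst w)" for w :: "'a \<times> 'a"
    unfolding tautological_form_def
    by (rule frechet_derivative_at[symmetric]) (auto intro!: derivative_eq_intros)
  then show ?thesis by (simp add: symp_def exterior_derivative_def)
qed

context frame
begin

text \<open>The differential at \<xi> = (q, p) of the momentum function p . X_i(q).\<close>

definition dmom :: "nat \<Rightarrow> 'a \<times> 'a \<Rightarrow> 'a \<times> 'a \<Rightarrow> real" where
  "dmom i \<xi> u = snd u \<bullet> X i (fst \<xi>) + snd \<xi> \<bullet> fderiv (X i) (fst \<xi>) (fst u)"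

text \<open>The Hamiltonian field of the momentum p . X_i(q), the cotangent lift of X_i; the sum is
  the transpose of the derivative of X_i applied to p.\<close>

definition ham :: "nat \<Rightarrow> 'a \<times> 'a \<Rightarrow> 'a \<times> 'a" where
  "ham i \<xi> = (X i (fst \<xi>), - (\<Sum>b\<in>Basis. (snd \<xi> \<bullet> fderiv (X i) (fst \<xi>) b) *\<^sub>R b))"

definition zero_locus :: "nat set \<Rightarrow> ('a \<times> 'a) set" where
  "zero_locus K = {\<xi>. fst \<xi> \<in> W \<and> (\<forall>i\<in>K. snd \<xi> \<bullet> X i (fst \<xi>) = 0)}"

lemma linear_DX: "y \<in> W \<Longrightarrow> i < DIM('a) \<Longrightarrow> linear (fderiv (X i) y)"
  using smooth_on_linear_derivative[OF X] by blast

lemma fst_ham: "fst (ham i \<xi>) = X i (fst \<xi>)"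
  by (simp add: ham_def)

lemma inner_expand:
  assumes "y \<in> W"
  shows "(\<Sum>i<DIM('a). (p \<bullet> X i y) * (\<theta> i y \<bullet> w)) = p \<bullet> w"
proof -
  have "p \<bullet> w = (\<Sum>i<DIM('a). (p \<bullet> X i y) *\<^sub>R \<theta> i y) \<bullet> w" using expand_dual[OF assms, of p] by metis
  then show ?thesis by (simp add: inner_sum_left)
qed

lemma snd_ham_inner:
  assumes "fst \<xi> \<in> W" "i < DIM('a)"
  shows "snd (ham i \<xi>) \<bullet> v = - (snd \<xi> \<bullet> fderiv (X i) (fst \<xi>) v)"
proof -
  have l: "linear (\<lambda>v. snd \<xi> \<bullet> fderiv (X i) (fst \<xi>) v)"
    using linear_compose[OF linear_DX[OF assms] bounded_linear.linear[OF bounded_linear_inner_right]]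
    by (simp add: o_def)
  have "(\<Sum>b\<in>Basis. (snd \<xi> \<bullet> fderiv (X i) (fst \<xi>) b) *\<^sub>R b) \<bullet> v
     = snd \<xi> \<bullet> fderiv (X i) (fst \<xi>) v"
    using linear_euclidean_sum[OF l, of v]
    by (simp add: inner_sum_left mult.commute) (simp add: inner_commute)
  then show ?thesis by (simp add: ham_def)
qed

text \<open>The Poisson bracket of two momenta is the momentum of the Lie bracket.\<close>

lemma dmom_ham:
  assumes "fst \<xi> \<in> W" "i < DIM('a)" "j < DIM('a)"
  shows "dmom i \<xi> (ham j \<xi>) = snd \<xi> \<bullet> lie_bracket (X j) (X i) (fst \<xi>)"
  using assms by (simp add: dmom_def snd_ham_inner lie_bracket_def inner_diff_right) (simp add: ham_def)

lemma linear_dmom: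
  assumes "fst \<xi> \<in> W" "i < DIM('a)"
  shows "linear (dmom i \<xi>)"
  using linear_DX[OF assms]
  by (auto simp: dmom_def linear_iff inner_add_left inner_add_right algebra_simps)

lemma moment_derivative:
  assumes "fst \<xi> \<in> W" "i < DIM('a)"
  shows "((\<lambda>\<xi>. snd \<xi> \<bullet> X i (fst \<xi>)) has_derivative dmom i \<xi>) (at \<xi>)"
proof -
  have "((\<lambda>\<xi>. X i (fst \<xi>)) has_derivative (\<lambda>u. fderiv (X i) (fst \<xi>) (fst u))) (at \<xi>)"
    using diff_chain_at[OF has_derivative_fst[OF has_derivative_ident] smooth_on_has_derivative[OF X[OF assms(2)] assms(1)]]
    by (simp add: o_def)
  then show ?thesis
    unfolding dmom_def[abs_def]
    by (auto intro!: derivative_eq_intros simp: algebra_simps)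
qed

lemma dtheta:
  assumes "y \<in> W" "i < DIM('a)" "j < DIM('a)"
  shows "fderiv (\<theta> i) y v \<bullet> X j y = - (\<theta> i y \<bullet> fderiv (X j) y v)"
proof -
  have "((\<lambda>y. \<theta> i y \<bullet> X j y) has_derivative
      (\<lambda>v. \<theta> i y \<bullet> fderiv (X j) y v + fderiv (\<theta> i) y v \<bullet> X j y)) (at y)"
    using assms by (intro has_derivative_inner smooth_on_has_derivative[OF X] smooth_on_has_derivative[OF \<theta>])
  moreover have "((\<lambda>y. \<theta> i y \<bullet> X j y) has_derivative (\<lambda>v. 0)) (at y)"
    by (rule has_derivative_transform_within_open[of "\<lambda>y. if i = j then 1 else 0" _ _ _ W])
      (use dual assms W in auto)
  ultimately have "\<theta> i y \<bullet> fderiv (X j) y v + fderiv (\<theta> i) y v \<bullet> X j y = 0"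
    by (rule has_derivative_unique[THEN fun_cong])
  then show ?thesis by simp
qed

lemma eq_by_frame:
  assumes "y \<in> W" "\<And>j. j < DIM('a) \<Longrightarrow> p \<bullet> X j y = p' \<bullet> X j y"
  shows "p = p'"
  using expand_dual[OF assms(1), of p] expand_dual[OF assms(1), of p'] assms(2) by simp

text \<open>One inclusion differentiates the equations. For the other an explicit curve does the
  work of the implicit function theorem: the base point moves on a line and the covector is
  prescribed by its momenta through the coframe.\<close>

lemma tangent_zero_locus:
  assumes K: "K \<subseteq> {..<DIM('a)}" and \<xi>: "\<xi> \<in> zero_locus K"
  shows "tangent_at (zero_locus K) \<xi> = {u. \<forall>i\<in>K. dmom i \<xi> u = 0}"
proof (intro equalityI subsetI CollectI ballI)
  fix u i assume u: "u \<in> tangent_at (zero_locus K) \<xi>" and i: "i \<in> K"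
  then obtain \<gamma> \<epsilon> where \<gamma>: "\<gamma> 0 = \<xi>" "(\<gamma> has_vector_derivative u) (at 0)" "\<epsilon> > 0"
    "\<gamma> ` {-\<epsilon><..<\<epsilon>} \<subseteq> zero_locus K"
    by (auto simp: tangent_at_def smooth_curve_in_def)
  have "((\<lambda>t. snd (\<gamma> t) \<bullet> X i (fst (\<gamma> t))) has_vector_derivative dmom i \<xi> u) (at 0)"
    by (rule has_vector_derivative_chain[OF \<gamma>(2)])
      (use \<gamma>(1) \<xi> K i moment_derivative[of \<xi> i] in \<open>auto simp: zero_locus_def\<close>)
  moreover have "((\<lambda>t. snd (\<gamma> t) \<bullet> X i (fst (\<gamma> t))) has_vector_derivative 0) (at 0)"
    by (rule has_vector_derivative_transform_within_open[OF has_vector_derivative_const[of 0], of "{-\<epsilon><..<\<epsilon>}"])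
      (use \<gamma>(3,4) i in \<open>auto simp: zero_locus_def image_subset_iff\<close>)
  ultimately show "dmom i \<xi> u = 0" by (rule vector_derivative_unique_at)
next
  fix u assume u: "u \<in> {u. \<forall>i\<in>K. dmom i \<xi> u = 0}"
  let ?q = "fst \<xi>" and ?p = "snd \<xi>" and ?n = "DIM('a)"
  have q: "?q \<in> W" using \<xi> by (simp add: zero_locus_def)
  \<comment> \<open>The momenta along the curve, affine in t with slope
    \<open>dmom i \<xi> u\<close>; for i in K value and slope are 0, so the curve stays in the
    locus.\<close>
  define c where "c i t = ?p \<bullet> X i ?q + t * dmom i \<xi> u" for i t
  define \<gamma> where "\<gamma> t = (?q + t *\<^sub>R fst u, \<Sum>i<?n. c i t *\<^sub>R \<theta> i (?q + t *\<^sub>R fst u))" for t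
  have "open ((\<lambda>t. ?q + t *\<^sub>R fst u) -` W)"
    by (intro open_vimage W continuous_intros)
  moreover have "0 \<in> (\<lambda>t. ?q + t *\<^sub>R fst u) -` W" using q by simp
  ultimately obtain \<epsilon> where \<epsilon>: "\<epsilon> > 0" "ball 0 \<epsilon> \<subseteq> (\<lambda>t. ?q + t *\<^sub>R fst u) -` W"
    using open_contains_ball by blast
  then have in_W: "?q + t *\<^sub>R fst u \<in> W" if "t \<in> {-\<epsilon><..<\<epsilon>}" for t
    using that by (auto simp: subset_iff dist_real_def)
  have line: "smooth_on {-\<epsilon><..<\<epsilon>} (\<lambda>t. ?q + t *\<^sub>R fst u)"
    by (intro smooth_on_add smooth_on_scaleR smooth_on_const smooth_on_id) auto
  have "smooth_on {-\<epsilon><..<\<epsilon>} \<gamma>"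
    unfolding \<gamma>_def[abs_def] c_def
    by (intro smooth_on_Pair smooth_on_sum smooth_on_scaleR smooth_on_add smooth_on_mult
        smooth_on_compose[OF \<theta> line] smooth_on_const smooth_on_id line) (auto intro: in_W)
  moreover have "\<gamma> t \<in> zero_locus K" if t: "t \<in> {-\<epsilon><..<\<epsilon>}" for t
  proof -
    have "(\<Sum>i<?n. c i t *\<^sub>R \<theta> i (?q + t *\<^sub>R fst u)) \<bullet> X j (?q + t *\<^sub>R fst u) = 0" if j: "j \<in> K" for j
    proof -
      have "(\<Sum>i<?n. c i t *\<^sub>R \<theta> i (?q + t *\<^sub>R fst u)) \<bullet> X j (?q + t *\<^sub>R fst u)
          = (\<Sum>i<?n. if i = j then c i t else 0)"
        unfolding inner_sum_left
        by (rule sum.cong) (use dual[OF in_W[OF t]] j K in auto)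
      also have "\<dots> = 0" using u \<xi> j K by (auto simp: c_def zero_locus_def)
      finally show ?thesis .
    qed
    then show ?thesis using in_W[OF t] by (simp add: zero_locus_def \<gamma>_def)
  qed
  moreover have "\<gamma> 0 = \<xi>"
    using expand_dual[OF q, of ?p] by (simp add: \<gamma>_def c_def prod_eq_iff)
  moreover have "(\<gamma> has_vector_derivative u) (at 0)"
  proof -
    have line': "((\<lambda>t. ?q + t *\<^sub>R fst u) has_vector_derivative fst u) (at 0)"
      by (auto intro!: derivative_eq_intros)
    let ?v = "\<Sum>i<?n. c i 0 *\<^sub>R fderiv (\<theta> i) ?q (fst u) + dmom i \<xi> u *\<^sub>R \<theta> i (?q + 0 *\<^sub>R fst u)"
    have "((\<lambda>t. \<theta> i (?q + t *\<^sub>R fst u)) has_vector_derivative fderiv (\<theta> i) ?q (fst u)) (at 0)"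
      if "i < ?n" for i
      by (rule has_vector_derivative_chain[OF line']) (use smooth_on_has_derivative[OF \<theta>[OF that] q] in simp)
    moreover have "(c i has_real_derivative dmom i \<xi> u) (at 0)" for i
      unfolding c_def[abs_def] by (auto intro!: derivative_eq_intros)
    ultimately have "((\<lambda>t. \<Sum>i<?n. c i t *\<^sub>R \<theta> i (?q + t *\<^sub>R fst u)) has_vector_derivative
        ?v) (at 0)"
      by (intro has_vector_derivative_sum has_vector_derivative_scaleR) auto
    \<comment> \<open>Tested against X_j: by \<open>dtheta\<close> the derivatives of the coframe
      contribute the negative of the term that \<open>dmom j\<close> contains besides the pairing
      with \<open>snd u\<close>.\<close>
    moreover have "?v = snd u"
    proof (rule eq_by_frame[OF q])
      fix j assume j: "j < ?n"
      have "?v \<bullet> X j ?q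
        = (\<Sum>i<?n. - ((?p \<bullet> X i ?q) *\<^sub>R \<theta> i ?q \<bullet> fderiv (X j) ?q (fst u)) + (if i = j then dmom i \<xi> u else 0))"
        unfolding inner_sum_left
        by (rule sum.cong) (use j in \<open>simp_all add: inner_add_left dtheta[OF q] dual[OF q] c_def\<close>)
      also have "\<dots> = - (?p \<bullet> fderiv (X j) ?q (fst u)) + dmom j \<xi> u"
        using j by (simp add: sum_subtractf inner_expand[OF q])
      also have "\<dots> = snd u \<bullet> X j ?q" by (simp add: dmom_def)
      finally show "?v \<bullet> X j ?q
        = snd u \<bullet> X j ?q" .
    qed
    ultimately show ?thesis
      unfolding \<gamma>_def[abs_def] using has_vector_derivative_Pair[OF line'] by fastforce
  qed
  ultimately show "u \<in> tangent_at (zero_locus K) \<xi>"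
    using \<epsilon>(1) unfolding tangent_at_def smooth_curve_in_def by blast
qed

text \<open>Since \<sigma>(ham j, v) = dmom j v, the tangent space is the skew-complement of the
  span of the Hamiltonian fields. The kernel is thus the part of that span that is itself tangent,
  and tangency is a linear system with Poisson brackets as coefficients.\<close>

lemma symp_kernel_zero_locus:
  assumes K: "K \<subseteq> {..<DIM('a)}" and \<xi>: "\<xi> \<in> zero_locus K"
  shows "symp_kernel (zero_locus K) \<xi> =
    {\<Sum>j\<in>K. a j *\<^sub>R ham j \<xi> | a. \<forall>i\<in>K. (\<Sum>j\<in>K. a j * (snd \<xi> \<bullet> lie_bracket (X j) (X i) (fst \<xi>))) = 0}"
    (is "_ = ?R")
proof -
  let ?q = "fst \<xi>" and ?p = "snd \<xi>" and ?n = "DIM('a)"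
  have q: "?q \<in> W" using \<xi> by (simp add: zero_locus_def)
  have fK: "finite K" using K finite_subset by blast
  have less: "i < ?n" if "i \<in> K" for i using K that by auto
  note T = tangent_zero_locus[OF K \<xi>]
  have dmom_sum: "dmom i \<xi> (\<Sum>j\<in>K. a j *\<^sub>R ham j \<xi>) = (\<Sum>j\<in>K. a j * (?p \<bullet> lie_bracket (X j) (X i) ?q))"
    if "i \<in> K" for i a
    using less that by (simp add: linear_sum[OF linear_dmom[OF q]] linear_scale[OF linear_dmom[OF q]] dmom_ham[OF q])
  show ?thesis
  proof (intro equalityI subsetI)
    fix u assume "u \<in> symp_kernel (zero_locus K) \<xi>"
    then have uT: "\<And>i. i \<in> K \<Longrightarrow> dmom i \<xi> u = 0"
      and u: "\<And>v. (\<And>i. i \<in> K \<Longrightarrow> dmom i \<xi> v = 0) \<Longrightarrow> snd v \<bullet> fst u = snd u \<bullet> fst v"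
      unfolding symp_kernel_def T symp_eq by auto
    define a where "a i = \<theta> i ?q \<bullet> fst u" for i
    have zero: "a i = 0" if i: "i < ?n" "i \<notin> K" for i
    proof -
      \<comment> \<open>Vertical vectors along \<theta>_i with i outside K are tangent; pairing u
        with them removes the X_i components of its base part.\<close>
      have "dmom j \<xi> (0, \<theta> i ?q) = 0" if "j \<in> K" for j
        using that less[OF that] i by (auto simp: dmom_def dual[OF q] linear_0[OF linear_DX[OF q]])
      then show ?thesis using u[of "(0, \<theta> i ?q)"] by (simp add: a_def)
    qed
    have fst_u: "fst u = (\<Sum>j\<in>K. a j *\<^sub>R X j ?q)"
    proof -
      have "fst u = (\<Sum>j<?n. a j *\<^sub>R X j ?q)" unfolding a_def by (rule expand[OF q])
      also have "\<dots> = (\<Sum>j\<in>K. a j *\<^sub>R X j ?q)"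
        by (rule sum.mono_neutral_right) (use K zero in auto)
      finally show ?thesis .
    qed
    have "snd u \<bullet> v = (\<Sum>j\<in>K. a j *\<^sub>R snd (ham j \<xi>)) \<bullet> v" for v
    proof -
      let ?D = "\<lambda>j. ?p \<bullet> fderiv (X j) ?q v"
      \<comment> \<open>A tangent vector over an arbitrary base direction v: the coframe correction
        cancels the differentials of the momenta in K.\<close>
      let ?v = "(v, - (\<Sum>j\<in>K. ?D j *\<^sub>R \<theta> j ?q))"
      have "dmom i \<xi> ?v = 0" if i: "i \<in> K" for i
      proof -
        have "(\<Sum>j\<in>K. ?D j *\<^sub>R \<theta> j ?q) \<bullet> X i ?q = (\<Sum>j\<in>K. if j = i then ?D j else 0)"
          unfolding inner_sum_left by (rule sum.cong) (use i less dual[OF q] in auto)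
        then show ?thesis using i fK by (simp add: dmom_def)
      qed
      then have "snd u \<bullet> v = - (\<Sum>j\<in>K. ?D j *\<^sub>R \<theta> j ?q) \<bullet> fst u"
        using u[of ?v] by simp
      also have "\<dots> = (\<Sum>j\<in>K. a j *\<^sub>R snd (ham j \<xi>)) \<bullet> v"
        using less by (simp add: inner_sum_left snd_ham_inner[OF q] a_def sum_negf mult.commute)
      finally show ?thesis .
    qed
    then have snd_u: "snd u = (\<Sum>j\<in>K. a j *\<^sub>R snd (ham j \<xi>))" by (metis vector_eq_rdot)
    have ueq: "u = (\<Sum>j\<in>K. a j *\<^sub>R ham j \<xi>)"
      using fst_u snd_u by (simp add: prod_eq_iff fst_sum snd_sum) (simp add: ham_def)
    show "u \<in> ?R"
      using uT dmom_sum[of _ a] unfolding ueq by auto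
  next
    fix u assume "u \<in> ?R"
    then obtain a where ueq: "u = (\<Sum>j\<in>K. a j *\<^sub>R ham j \<xi>)"
      and a: "\<And>i. i \<in> K \<Longrightarrow> (\<Sum>j\<in>K. a j * (?p \<bullet> lie_bracket (X j) (X i) ?q)) = 0"
      by auto
    have "symp \<xi> u v = 0" if v: "\<And>i. i \<in> K \<Longrightarrow> dmom i \<xi> v = 0" for v
    proof -
      have "symp \<xi> u v = (\<Sum>j\<in>K. a j * (snd v \<bullet> fst (ham j \<xi>) - snd (ham j \<xi>) \<bullet> fst v))"
        unfolding symp_eq ueq
        by (simp add: fst_sum snd_sum inner_sum_left inner_sum_right sum_subtractf[symmetric] algebra_simps)
      also have "\<dots> = (\<Sum>j\<in>K. a j * dmom j \<xi> v)"
        by (rule sum.cong) (use less in \<open>simp_all add: snd_ham_inner[OF q] dmom_def fst_ham\<close>)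
      also have "\<dots> = 0" using v by simp
      finally show ?thesis .
    qed
    moreover have "dmom i \<xi> u = 0" if "i \<in> K" for i
      unfolding ueq using dmom_sum[OF that] a[OF that] by simp
    ultimately show "u \<in> symp_kernel (zero_locus K) \<xi>"
      unfolding symp_kernel_def T by auto
  qed
qed

lemma smooth_ham:
  assumes "i < DIM('a)"
  shows "smooth_on (W \<times> UNIV) (ham i)"
proof -
  have o: "open (W \<times> (UNIV :: 'a set))" by (intro open_Times W open_UNIV)
  have f: "smooth_on (W \<times> UNIV) (fst :: 'a \<times> 'a \<Rightarrow> 'a)" "smooth_on (W \<times> UNIV) (snd :: 'a \<times> 'a \<Rightarrow> 'a)"
    using o by (auto intro!: smooth_on_linear linear_fst linear_snd)
  show ?thesis
    unfolding ham_def[abs_def] using o assms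
    by (intro smooth_on_Pair smooth_on_uminus smooth_on_sum smooth_on_scaleR smooth_on_inner
        smooth_on_compose[OF X f(1)] smooth_on_compose[OF smooth_on_derivative_const[OF X] f(1)]
        smooth_on_const f(2)) auto
qed

end

section \<open>Coordinates on the annihilator of the derived distribution\<close>

declare One_nat_def [simp del]

text \<open>The local model delivered by \<open>bracket_frame\<close> and its dual coframe for
  growth (2, 3, 5).\<close>

locale rank2_frame = frame W X \<theta>
  for W :: "(real ^ 5) set" and X \<theta> :: "nat \<Rightarrow> real ^ 5 \<Rightarrow> real ^ 5" +
  fixes V :: "(real ^ 5) set" and \<Delta> :: "real ^ 5 \<Rightarrow> (real ^ 5) set"
  assumes brackets: "lie_bracket (X 0) (X 1) = X 2" "lie_bracket (X 0) (X 2) = X 3"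
      "lie_bracket (X 1) (X 2) = X 4"
    and W_subset: "W \<subseteq> V"
    and \<Delta>_eq: "\<And>y. y \<in> W \<Longrightarrow> \<Delta> y = frame_span X 2 y"
    and flag2_eq: "\<And>y. y \<in> W \<Longrightarrow> lie_flag V \<Delta> 2 y = frame_span X 3 y"
    and flag3_eq: "\<And>y. y \<in> W \<Longrightarrow> lie_flag V \<Delta> 3 y = UNIV"
begin

lemma brackets_swap: "lie_bracket (X 1) (X 0) y = - X 2 y" "lie_bracket (X 2) (X 0) y = - X 3 y"
  "lie_bracket (X 2) (X 1) y = - X 4 y"
  using lie_bracket_swap[of "X 1" "X 0" y] lie_bracket_swap[of "X 2" "X 0" y]
    lie_bracket_swap[of "X 2" "X 1" y] by (simp_all only: brackets)

lemma less_simps: "{..<2} = {0, 1::nat}" "{..<3} = {0, 1, 2::nat}" "{..<5} = {0, 1, 2, 3, 4::nat}"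
  by auto

lemma \<Delta>_iff: "y \<in> W \<Longrightarrow> v \<in> \<Delta> y \<longleftrightarrow> (\<exists>a b. v = a *\<^sub>R X 0 y + b *\<^sub>R X 1 y)"
  by (auto simp: \<Delta>_eq less_simps span_breakdown_eq algebra_simps)

lemma orthogonal_span:
  "(\<forall>v\<in>span S. p \<bullet> v = 0) \<longleftrightarrow> (\<forall>v\<in>S. p \<bullet> v = 0)" for p :: "'b::real_inner"
proof
  assume *: "\<forall>v\<in>S. p \<bullet> v = 0"
  have "p \<bullet> v = 0" if "v \<in> span S" for v
    using that by (induction rule: span_induct_alt) (use * in \<open>auto simp: inner_add_right\<close>)
  then show "\<forall>v\<in>span S. p \<bullet> v = 0" by blast
qed (auto intro: span_base)

lemma ann_1: "fst \<xi> \<in> W \<Longrightarrow> \<xi> \<in> ann V \<Delta> 1 \<longleftrightarrow> \<xi> \<in> zero_locus {0, 1}"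
  using W_subset \<Delta>_eq[of "fst \<xi>"]
  by (cases \<xi>) (auto simp: ann_def zero_locus_def orthogonal_span less_simps One_nat_def)

lemma ann_2: "fst \<xi> \<in> W \<Longrightarrow> \<xi> \<in> ann V \<Delta> 2 \<longleftrightarrow> \<xi> \<in> zero_locus {0, 1, 2}"
  using W_subset flag2_eq[of "fst \<xi>"]
  by (cases \<xi>) (auto simp: ann_def zero_locus_def orthogonal_span less_simps)

lemma ann_3: "fst \<xi> \<in> W \<Longrightarrow> \<xi> \<in> ann V \<Delta> 3 \<longleftrightarrow> snd \<xi> = 0"
proof -
  have "(\<forall>v. p \<bullet> v = 0) \<longleftrightarrow> p = 0" for p :: "real ^ 5" by (metis inner_eq_zero_iff inner_zero_left)
  then show "fst \<xi> \<in> W \<Longrightarrow> \<xi> \<in> ann V \<Delta> 3 \<longleftrightarrow> snd \<xi> = 0"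
    using W_subset flag3_eq[of "fst \<xi>"] by (cases \<xi>) (auto simp: ann_def)
qed

lemma open_W_times: "open (W \<times> (UNIV :: 'b::topological_space set))"
  by (intro open_Times W open_UNIV)

text \<open>The combination of \<open>ham 0\<close> and \<open>ham 1\<close> whose Poisson bracket
  with the momentum of X 2 vanishes: with coefficients a, b that bracket is a m3 + b m4.\<close>

definition h0 :: "(real ^ 5) \<times> (real ^ 5) \<Rightarrow> (real ^ 5) \<times> (real ^ 5)" where
  "h0 \<xi> = (snd \<xi> \<bullet> X 4 (fst \<xi>)) *\<^sub>R ham 0 \<xi> - (snd \<xi> \<bullet> X 3 (fst \<xi>)) *\<^sub>R ham 1 \<xi>"

lemma covector_nonzero:
  assumes "fst \<xi> \<in> W" "\<xi> \<in> ann V \<Delta> 2" "snd \<xi> \<noteq> 0"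
  shows "(snd \<xi> \<bullet> X 3 (fst \<xi>))\<^sup>2 + (snd \<xi> \<bullet> X 4 (fst \<xi>))\<^sup>2 > 0"
proof (rule ccontr)
  assume "\<not> ?thesis"
  then have "snd \<xi> \<bullet> X 3 (fst \<xi>) = 0 \<and> snd \<xi> \<bullet> X 4 (fst \<xi>) = 0"
    by (metis sum_power2_gt_zero_iff)
  then have "snd \<xi> \<bullet> X i (fst \<xi>) = 0" if "i < 5" for i
  proof -
    have "i = 0 \<or> i = 1 \<or> i = 2 \<or> i = 3 \<or> i = 4" using that by arith
    then show ?thesis
      using \<open>snd \<xi> \<bullet> X 3 (fst \<xi>) = 0 \<and> snd \<xi> \<bullet> X 4 (fst \<xi>) = 0\<close> assms(2)
      unfolding ann_2[OF assms(1)] zero_locus_def by auto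
  qed
  then have "snd \<xi> = 0" using eq_by_frame[OF assms(1), of "snd \<xi>" 0] by simp
  with assms show False by simp
qed

text \<open>The brackets of the three defining momenta are {0,1} = m2 = 0, {0,2} = m3 and {1,2} =
  m4. This skew 3 by 3 matrix has rank 2 off the zero section, with kernel spanned by (m4, -m3,
  0).\<close>

lemma symp_kernel_ann_2:
  assumes \<xi>: "fst \<xi> \<in> W" "\<xi> \<in> ann V \<Delta> 2" "snd \<xi> \<noteq> 0"
  shows "symp_kernel (ann V \<Delta> 2) \<xi> = span {h0 \<xi>}" and "h0 \<xi> \<noteq> 0"
proof -
  define m3 m4 where m: "m3 = snd \<xi> \<bullet> X 3 (fst \<xi>)" "m4 = snd \<xi> \<bullet> X 4 (fst \<xi>)"
  have pos: "m3\<^sup>2 + m4\<^sup>2 > 0" using covector_nonzero[OF \<xi>] by (simp add: m)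
  have z: "\<xi> \<in> zero_locus {0, 1, 2}" using \<xi> ann_2 by blast
  then have p2: "snd \<xi> \<bullet> X 2 (fst \<xi>) = 0" by (simp add: zero_locus_def)
  have "symp_kernel (ann V \<Delta> 2) \<xi> = symp_kernel (zero_locus {0, 1, 2}) \<xi>"
    by (rule symp_kernel_local[OF open_W_times[where 'b = "real ^ 5"]])
      (use \<xi> ann_2 in \<open>auto simp: mem_Times_iff\<close>)
  also have "\<dots> = {\<Sum>j\<in>{0, 1, 2}. a j *\<^sub>R ham j \<xi> | a.
      \<forall>i\<in>{0, 1, 2}. (\<Sum>j\<in>{0, 1, 2}. a j * (snd \<xi> \<bullet> lie_bracket (X j) (X i) (fst \<xi>))) = 0}"
    by (rule symp_kernel_zero_locus[OF _ z]) auto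
  also have "\<dots> = {a 0 *\<^sub>R ham 0 \<xi> + a 1 *\<^sub>R ham 1 \<xi> + a 2 *\<^sub>R ham 2 \<xi> | a :: nat \<Rightarrow> real.
      a 2 * m3 = 0 \<and> a 2 * m4 = 0 \<and> a 0 * m3 + a 1 * m4 = (0::real)}" (is "_ = ?K")
    using p2 brackets_swap[of "fst \<xi>"]
    by (simp add: lie_bracket_self brackets m[symmetric] add.assoc cong: conj_cong)
  also have "\<dots> = span {h0 \<xi>}"
  proof (intro equalityI subsetI)
    fix u assume "u \<in> ?K"
    then obtain a :: "nat \<Rightarrow> real" where u: "u = a 0 *\<^sub>R ham 0 \<xi> + a 1 *\<^sub>R ham 1 \<xi> + a 2 *\<^sub>R ham 2 \<xi>"
      and a: "a 2 * m3 = 0" "a 2 * m4 = 0" "a 0 * m3 + a 1 * m4 = 0" by auto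
    have "a 2 = 0" using a pos by auto
    \<comment> \<open>The coefficient of the orthogonal projection of (a 0, a 1) to (m4, -m3);
      orthogonality to (m3, m4) says that nothing else remains.\<close>
    define f where "f = (a 0 * m4 - a 1 * m3) / (m3\<^sup>2 + m4\<^sup>2)"
    have "a 0 * (m3\<^sup>2 + m4\<^sup>2) = (a 0 * m4 - a 1 * m3) * m4"
      using a(3) by (simp add: algebra_simps power2_eq_square) (metis mult.assoc mult.commute distrib_left mult_zero_right)
    then have 1: "a 0 = f * m4"
      by (simp only: f_def times_divide_eq_left nonzero_eq_divide_eq[OF less_imp_neq[OF pos, symmetric]])
    have "a 1 * (m3\<^sup>2 + m4\<^sup>2) = - (a 0 * m4 - a 1 * m3) * m3"
      using a(3) by (simp add: algebra_simps power2_eq_square) (metis mult.assoc mult.commute distrib_left mult_zero_right)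
    then have 2: "a 1 = - f * m3"
      by (simp only: f_def minus_divide_left times_divide_eq_left
          nonzero_eq_divide_eq[OF less_imp_neq[OF pos, symmetric]])
    have "u = f *\<^sub>R h0 \<xi>"
      unfolding u 1 2 \<open>a 2 = 0\<close> h0_def m[symmetric] by (simp add: algebra_simps)
    then show "u \<in> span {h0 \<xi>}" by (auto simp: span_singleton)
  next
    fix u assume "u \<in> span {h0 \<xi>}"
    then obtain f where "u = f *\<^sub>R h0 \<xi>" by (auto simp: span_singleton)
    then show "u \<in> ?K"
      by (intro CollectI exI[of _ "\<lambda>j. if j = 0 then f * m4 else if j = Suc 0 then - f * m3 else 0"])
        (simp add: h0_def m[symmetric] algebra_simps)
  qed
  finally show "symp_kernel (ann V \<Delta> 2) \<xi> = span {h0 \<xi>}" .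
  have "\<theta> 0 (fst \<xi>) \<bullet> fst (h0 \<xi>) = m4" "\<theta> 1 (fst \<xi>) \<bullet> fst (h0 \<xi>) = - m3"
    using \<xi>(1) by (simp_all add: h0_def fst_ham inner_diff_right dual m)
  then show "h0 \<xi> \<noteq> 0" using pos by auto
qed

text \<open>On the annihilator of the second flag space the bracket of the first two momenta
  vanishes, so the kernel of \<sigma> on the larger annihilator contains both \<open>ham 0\<close>
  and \<open>ham 1\<close>. Adding vertical vectors leaves only the condition that the base
  component lies in the distribution.\<close>

lemma jacobi_space_eq:
  assumes \<xi>: "fst \<xi> \<in> W" "\<xi> \<in> ann V \<Delta> 2"
  shows "jacobi_space V \<Delta> \<xi> = {u \<in> tangent_at (ann V \<Delta> 2) \<xi>. fst u \<in> \<Delta> (fst \<xi>)}"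
proof -
  have p: "snd \<xi> \<bullet> X 2 (fst \<xi>) = 0" and z: "\<xi> \<in> zero_locus {0, 1}"
    using \<xi> ann_2 by (auto simp: zero_locus_def)
  have "symp_kernel (ann V \<Delta> 1) \<xi> = symp_kernel (zero_locus {0, 1}) \<xi>"
    by (rule symp_kernel_local[OF open_W_times[where 'b = "real ^ 5"]])
      (use \<xi> ann_1 in \<open>auto simp: mem_Times_iff\<close>)
  also have "\<dots> = {\<Sum>j\<in>{0, 1}. a j *\<^sub>R ham j \<xi> | a.
      \<forall>i\<in>{0, 1}. (\<Sum>j\<in>{0, 1}. a j * (snd \<xi> \<bullet> lie_bracket (X j) (X i) (fst \<xi>))) = 0}"
    by (rule symp_kernel_zero_locus[OF _ z]) auto
  also have "\<dots> = {a 0 *\<^sub>R ham 0 \<xi> + a 1 *\<^sub>R ham 1 \<xi> | a :: nat \<Rightarrow> real. True}"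
    using p brackets_swap[of "fst \<xi>"] by (simp add: lie_bracket_self brackets)
  finally have ker: "symp_kernel (ann V \<Delta> 1) \<xi> = {a 0 *\<^sub>R ham 0 \<xi> + a 1 *\<^sub>R ham 1 \<xi> | a :: nat \<Rightarrow> real. True}" .
  have "(\<exists>w v. u = w + v \<and> w \<in> vertical \<and> v \<in> symp_kernel (ann V \<Delta> 1) \<xi>) \<longleftrightarrow> fst u \<in> \<Delta> (fst \<xi>)" for u
  proof
    assume "\<exists>w v. u = w + v \<and> w \<in> vertical \<and> v \<in> symp_kernel (ann V \<Delta> 1) \<xi>"
    then obtain w and a :: "nat \<Rightarrow> real" where
      "u = w + (a 0 *\<^sub>R ham 0 \<xi> + a 1 *\<^sub>R ham 1 \<xi>)" "w \<in> vertical"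
      unfolding ker by blast
    then have "fst u = a 0 *\<^sub>R X 0 (fst \<xi>) + a 1 *\<^sub>R X 1 (fst \<xi>)"
      by (auto simp: vertical_def fst_ham)
    then show "fst u \<in> \<Delta> (fst \<xi>)" unfolding \<Delta>_iff[OF \<xi>(1)] by blast
  next
    assume "fst u \<in> \<Delta> (fst \<xi>)"
    then obtain a b where ab: "fst u = a *\<^sub>R X 0 (fst \<xi>) + b *\<^sub>R X 1 (fst \<xi>)"
      using \<Delta>_iff[OF \<xi>(1)] by auto
    let ?v = "a *\<^sub>R ham 0 \<xi> + b *\<^sub>R ham 1 \<xi>"
    have "u = (u - ?v) + ?v" by simp
    moreover have "u - ?v \<in> vertical" using ab by (auto simp: vertical_def fst_ham mem_Times_iff)
    moreover have "?v \<in> symp_kernel (ann V \<Delta> 1) \<xi>"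
      unfolding ker by (intro CollectI exI[of _ "\<lambda>j. if j = 0 then a else b"]) simp
    ultimately show "\<exists>w v. u = w + v \<and> w \<in> vertical \<and> v \<in> symp_kernel (ann V \<Delta> 1) \<xi>" by blast
  qed
  then show ?thesis unfolding jacobi_space_def by auto
qed

lemma smooth_moment: "i < 5 \<Longrightarrow> smooth_on (W \<times> UNIV) (\<lambda>\<xi> :: (real ^ 5) \<times> (real ^ 5). snd \<xi> \<bullet> X i (fst \<xi>))"
  by (intro smooth_on_inner smooth_on_compose[OF X] smooth_on_linear linear_fst linear_snd open_W_times) auto

lemma char_field_exists:
  assumes "q \<in> W" "(q, p) \<in> ann V \<Delta> 2 - ann V \<Delta> 3"
  shows "\<exists>U H. (q, p) \<in> U \<and> char_field V \<Delta> U H"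
proof (intro exI conjI)
  let ?U = "(ann V \<Delta> 2 - ann V \<Delta> 3) \<inter> (W \<times> UNIV)"
  show "(q, p) \<in> ?U" using assms by simp
  have h0: "smooth_on (W \<times> UNIV) h0"
    unfolding h0_def[abs_def]
    by (intro smooth_on_diff smooth_on_scaleR smooth_moment smooth_ham) auto
  show "char_field V \<Delta> ?U h0"
    unfolding char_field_def
  proof (intro conjI ballI)
    show "openin (top_of_set (ann V \<Delta> 2 - ann V \<Delta> 3)) ?U"
      using open_W_times by (rule openin_open_Int)
    show "smooth_map_on ?U h0"
      unfolding smooth_map_on_def
      by (intro ballI exI[of _ "W \<times> UNIV"] exI[of _ h0]) (use h0 in simp)
    fix \<mu> assume "\<mu> \<in> ?U"
    then have "fst \<mu> \<in> W" "\<mu> \<in> ann V \<Delta> 2" "snd \<mu> \<noteq> 0" using ann_3[of \<mu>] by (auto simp: mem_Times_iff)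
    then show "h0 \<mu> \<noteq> 0" "symp_kernel (ann V \<Delta> 2) \<mu> = span {h0 \<mu>}"
      by (rule symp_kernel_ann_2)+
  qed
qed

text \<open>Over \<open>W\<close>, the manifold \<open>ann V \<Delta> 2\<close> is parametrized by the base point and the two
  momenta of \<open>X 3\<close> and \<open>X 4\<close>.\<close>

definition cov :: "(real ^ 5) \<times> real \<times> real \<Rightarrow> real ^ 5" where
  "cov z = fst (snd z) *\<^sub>R \<theta> 3 (fst z) + snd (snd z) *\<^sub>R \<theta> 4 (fst z)"

definition par :: "(real ^ 5) \<times> real \<times> real \<Rightarrow> (real ^ 5) \<times> (real ^ 5)" where
  "par z = (fst z, cov z)"

definition coord :: "(real ^ 5) \<times> (real ^ 5) \<Rightarrow> (real ^ 5) \<times> real \<times> real" where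
  "coord \<xi> = (fst \<xi>, snd \<xi> \<bullet> X 3 (fst \<xi>), snd \<xi> \<bullet> X 4 (fst \<xi>))"

definition dpar where "dpar z = fderiv par z"
definition dcov where "dcov z = fderiv cov z"
definition dcoord where "dcoord \<xi> = fderiv coord \<xi>"

abbreviation param_domain :: "((real ^ 5) \<times> real \<times> real) set" where
  "param_domain \<equiv> W \<times> (- {0})"

lemma fst_par [simp]: "fst (par z) = fst z" and snd_par [simp]: "snd (par z) = cov z"
  by (simp_all add: par_def)

lemma fst_coord [simp]: "fst (coord \<xi>) = fst \<xi>"
  by (simp add: coord_def)

lemma open_param_domain: "open param_domain"
  by (intro open_Times W) auto

lemma smooth_cov: "smooth_on (W \<times> UNIV) cov"
proof -
  have f: "smooth_on (W \<times> UNIV) (fst :: (real ^ 5) \<times> real \<times> real \<Rightarrow> _)"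
    by (intro smooth_on_linear linear_fst open_W_times)
  have l: "linear (\<lambda>z :: (real ^ 5) \<times> real \<times> real. fst (snd z))" "linear (\<lambda>z :: (real ^ 5) \<times> real \<times> real. snd (snd z))"
    by (auto simp: linear_iff)
  show ?thesis
    unfolding cov_def[abs_def]
    by (intro smooth_on_add smooth_on_scaleR smooth_on_compose[OF \<theta> f] smooth_on_linear l open_W_times) auto
qed

lemma smooth_par: "smooth_on (W \<times> UNIV) par"
  unfolding par_def[abs_def]
  by (intro smooth_on_Pair smooth_cov smooth_on_linear linear_fst open_W_times)

lemma smooth_coord: "smooth_on (W \<times> UNIV) coord"
  unfolding coord_def[abs_def]
  by (intro smooth_on_Pair smooth_moment smooth_on_linear linear_fst open_W_times) auto

lemma cov_X: "fst z \<in> W \<Longrightarrow> i < 5 \<Longrightarrow>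
    cov z \<bullet> X i (fst z) = (if i = 3 then fst (snd z) else if i = 4 then snd (snd z) else 0)"
  by (auto simp: cov_def inner_add_left dual)

lemma coord_par: "fst z \<in> W \<Longrightarrow> coord (par z) = z"
  by (simp add: coord_def cov_X prod_eq_iff)

lemma par_coord:
  assumes "fst \<xi> \<in> W" "\<xi> \<in> ann V \<Delta> 2"
  shows "par (coord \<xi>) = \<xi>"
proof -
  have "cov (coord \<xi>) = snd \<xi>"
  proof (rule eq_by_frame[OF assms(1)])
    fix j assume "j < DIM(real ^ 5)"
    then have j: "j < 5" by simp
    show "cov (coord \<xi>) \<bullet> X j (fst \<xi>) = snd \<xi> \<bullet> X j (fst \<xi>)"
    proof -
      have "j = 0 \<or> j = 1 \<or> j = 2 \<or> j = 3 \<or> j = 4" using j by arith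
      then show ?thesis
        using cov_X[of "coord \<xi>" j] assms(1) assms(2)[unfolded ann_2[OF assms(1)] zero_locus_def]
        by (auto simp: coord_def)
    qed
  qed
  then show ?thesis by (simp add: prod_eq_iff)
qed

lemma par_in:
  assumes "z \<in> param_domain"
  shows "par z \<in> ann V \<Delta> 2" "par z \<in> ann V \<Delta> 2 - ann V \<Delta> 3"
proof -
  have W: "fst z \<in> W" and z: "snd z \<noteq> 0" using assms by auto
  show *: "par z \<in> ann V \<Delta> 2" using W ann_2[of "par z"] by (simp add: zero_locus_def cov_X)
  have "cov z \<noteq> 0"
    using z cov_X[OF W, of 3] cov_X[OF W, of 4] by (auto simp: prod_eq_iff)
  then show "par z \<in> ann V \<Delta> 2 - ann V \<Delta> 3" using * ann_3[of "par z"] W by simp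
qed

lemma coord_in:
  assumes "fst \<xi> \<in> W" "\<xi> \<in> ann V \<Delta> 2 - ann V \<Delta> 3"
  shows "coord \<xi> \<in> param_domain"
  using covector_nonzero[of \<xi>] assms ann_3[of \<xi>] by (auto simp: mem_Times_iff coord_def zero_prod_def)

lemma par_derivative: "fst z \<in> W \<Longrightarrow> (par has_derivative dpar z) (at z)"
  unfolding dpar_def by (rule smooth_on_has_derivative[OF smooth_par]) (simp add: mem_Times_iff)

lemma cov_derivative: "fst z \<in> W \<Longrightarrow> (cov has_derivative dcov z) (at z)"
  unfolding dcov_def by (rule smooth_on_has_derivative[OF smooth_cov]) (simp add: mem_Times_iff)

lemma coord_derivative: "fst \<xi> \<in> W \<Longrightarrow> (coord has_derivative dcoord \<xi>) (at \<xi>)"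
  unfolding dcoord_def by (rule smooth_on_has_derivative[OF smooth_coord]) (simp add: mem_Times_iff)

lemma dpar_eq: "fst z \<in> W \<Longrightarrow> dpar z u = (fst u, dcov z u)"
proof -
  assume z: "fst z \<in> W"
  have "(par has_derivative (\<lambda>u. (fst u, dcov z u))) (at z)"
    unfolding par_def[abs_def]
    by (intro has_derivative_Pair cov_derivative[OF z]) (auto intro!: derivative_eq_intros)
  from has_derivative_unique[OF par_derivative[OF z] this] show ?thesis by simp
qed

lemma dcoord_eq: "fst \<xi> \<in> W \<Longrightarrow> dcoord \<xi> u = (fst u, dmom 3 \<xi> u, dmom 4 \<xi> u)"
proof -
  assume \<xi>: "fst \<xi> \<in> W"
  have "(coord has_derivative (\<lambda>u. (fst u, dmom 3 \<xi> u, dmom 4 \<xi> u))) (at \<xi>)"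
    unfolding coord_def[abs_def]
    by (intro has_derivative_Pair moment_derivative[OF \<xi>]) (auto intro!: derivative_eq_intros)
  from has_derivative_unique[OF coord_derivative[OF \<xi>] this] show ?thesis by simp
qed

lemma dcov_vertical:
  assumes z: "fst z \<in> W"
  shows "dcov z (0, c) = fst c *\<^sub>R \<theta> 3 (fst z) + snd c *\<^sub>R \<theta> 4 (fst z)"
proof -
  have "((\<lambda>t. z + t *\<^sub>R (0, c)) has_vector_derivative (0, c)) (at 0)"
    by (auto intro!: derivative_eq_intros)
  then have "((\<lambda>t. cov (z + t *\<^sub>R (0, c))) has_vector_derivative dcov z (0, c)) (at 0)"
    by (rule has_vector_derivative_chain) (use cov_derivative[OF z] in \<open>simp add: zero_prod_def[symmetric]\<close>)
  moreover have "((\<lambda>t. cov (z + t *\<^sub>R (0, c))) has_vector_derivative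
      fst c *\<^sub>R \<theta> 3 (fst z) + snd c *\<^sub>R \<theta> 4 (fst z)) (at 0)"
    unfolding cov_def by (auto intro!: derivative_eq_intros)
  ultimately show ?thesis by (rule vector_derivative_unique_at)
qed

lemma linear_dpar: "fst z \<in> W \<Longrightarrow> linear (dpar z)"
  using par_derivative has_derivative_linear by blast

lemma linear_dcoord: "fst \<xi> \<in> W \<Longrightarrow> linear (dcoord \<xi>)"
  using coord_derivative has_derivative_linear by blast

lemma dcoord_dpar:
  assumes z: "fst z \<in> W"
  shows "dcoord (par z) (dpar z u) = u"
proof -
  have "(coord \<circ> par has_derivative dcoord (par z) \<circ> dpar z) (at z)"
    using z by (intro diff_chain_at par_derivative coord_derivative) auto
  then have "((\<lambda>z. z) has_derivative dcoord (par z) \<circ> dpar z) (at z)"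
    by (rule has_derivative_transform_within_open[OF _ open_W_times])
      (use z coord_par in \<open>auto simp: mem_Times_iff\<close>)
  from has_derivative_unique[OF this has_derivative_ident] show ?thesis by (metis comp_apply)
qed

text \<open>\<open>pushforward\<close> asks for curves that avoid the zero section, so straight
  lines in coordinates are followed only while they stay in \<open>param_domain\<close>.\<close>

lemma smooth_curve_par:
  assumes z: "z \<in> param_domain"
  shows "smooth_curve_in (ann V \<Delta> 2 - ann V \<Delta> 3) (par z) (dpar z u) (\<lambda>t. par (z + t *\<^sub>R u))"
proof -
  have "open ((\<lambda>t. z + t *\<^sub>R u) -` param_domain)"
    by (intro open_vimage open_param_domain continuous_intros)
  moreover have "0 \<in> (\<lambda>t. z + t *\<^sub>R u) -` param_domain" using z by simp
  ultimately obtain \<epsilon> where \<epsilon>: "\<epsilon> > 0" "ball 0 \<epsilon> \<subseteq> (\<lambda>t. z + t *\<^sub>R u) -` param_domain"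
    using open_contains_ball by blast
  then have in_W: "z + t *\<^sub>R u \<in> param_domain" if "t \<in> {-\<epsilon><..<\<epsilon>}" for t
    using that by (auto simp: subset_iff dist_real_def)
  have line: "smooth_on {-\<epsilon><..<\<epsilon>} (\<lambda>t. z + t *\<^sub>R u)"
    by (intro smooth_on_add smooth_on_scaleR smooth_on_const smooth_on_id) auto
  have "smooth_on {-\<epsilon><..<\<epsilon>} (\<lambda>t. par (z + t *\<^sub>R u))"
  proof (rule smooth_on_compose[OF smooth_par line])
    show "(\<lambda>t. z + t *\<^sub>R u) ` {-\<epsilon><..<\<epsilon>} \<subseteq> W \<times> UNIV"
      using in_W by (auto simp: image_subset_iff mem_Times_iff)
  qed
  moreover have "((\<lambda>t. par (z + t *\<^sub>R u)) has_vector_derivative dpar z u) (at 0)"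
    by (rule has_vector_derivative_chain[of "\<lambda>t. z + t *\<^sub>R u"])
      (use z par_derivative[of z] in \<open>auto intro!: derivative_eq_intros\<close>)
  ultimately show ?thesis
    using \<epsilon>(1) image_subsetI[of "{-\<epsilon><..<\<epsilon>}" "\<lambda>t. par (z + t *\<^sub>R u)", OF par_in(2)[OF in_W]]
    unfolding smooth_curve_in_def by auto
qed

text \<open>A curve in the annihilator over W satisfies \<gamma> = par (coord \<gamma>);
  differentiation exhibits its velocity in the range of \<open>dpar\<close>.\<close>

lemma tangent_par:
  assumes z: "z \<in> param_domain"
  shows "tangent_at (ann V \<Delta> 2) (par z) = range (dpar z)"
proof (intro equalityI subsetI)
  have zW: "fst z \<in> W" using z by auto
  fix u assume u: "u \<in> tangent_at (ann V \<Delta> 2) (par z)"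
  then obtain \<gamma> where "smooth_curve_in (ann V \<Delta> 2) (par z) u \<gamma>" by (auto simp: tangent_at_def)
  from smooth_curve_in_restrict[OF this open_W_times]
  have \<gamma>: "smooth_curve_in (ann V \<Delta> 2 \<inter> (W \<times> UNIV)) (par z) u \<gamma>"
    using zW by (simp add: mem_Times_iff)
  then obtain \<epsilon> where \<epsilon>: "\<epsilon> > 0" "\<gamma> ` {-\<epsilon><..<\<epsilon>} \<subseteq> ann V \<Delta> 2 \<inter> (W \<times> UNIV)" "\<gamma> 0 = par z"
    "(\<gamma> has_vector_derivative u) (at 0)"
    by (auto simp: smooth_curve_in_def)
  have "((\<lambda>t. coord (\<gamma> t)) has_vector_derivative dcoord (par z) u) (at 0)"
    by (rule has_vector_derivative_chain[OF \<epsilon>(4)]) (use \<epsilon>(3) zW coord_derivative[of "par z"] in simp)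
  then have "((\<lambda>t. par (coord (\<gamma> t))) has_vector_derivative dpar z (dcoord (par z) u)) (at 0)"
    by (rule has_vector_derivative_chain) (use \<epsilon>(3) zW par_derivative[OF zW] coord_par in simp)
  then have "(\<gamma> has_vector_derivative dpar z (dcoord (par z) u)) (at 0)"
    by (rule has_vector_derivative_transform_within_open[of _ _ _ "{-\<epsilon><..<\<epsilon>}"])
      (use \<epsilon>(1,2) par_coord in \<open>auto simp: image_subset_iff mem_Times_iff\<close>)
  with \<epsilon>(4) have "u = dpar z (dcoord (par z) u)" by (rule vector_derivative_unique_at)
  then show "u \<in> range (dpar z)" by (metis rangeI)
next
  fix u assume "u \<in> range (dpar z)"
  then show "u \<in> tangent_at (ann V \<Delta> 2) (par z)"
    using smooth_curve_par[OF z] smooth_curve_in_mono[of "ann V \<Delta> 2 - ann V \<Delta> 3" _ _ _ "ann V \<Delta> 2"]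
    unfolding tangent_at_def by blast
qed

lemma dpar_euler: "fst z \<in> W \<Longrightarrow> dpar z (0, snd z) = euler (par z)"
  by (simp add: dpar_eq dcov_vertical euler_def cov_def)

lemma jacobi_space_par:
  assumes z: "z \<in> param_domain"
  shows "jacobi_space V \<Delta> (par z) = dpar z ` {u. fst u \<in> \<Delta> (fst z)}"
proof -
  have "fst z \<in> W" using z by auto
  then show ?thesis
    using jacobi_space_eq[of "par z"] par_in(1)[OF z] tangent_par[OF z] by (auto simp: dpar_eq)
qed

text \<open>Pairing with the Euler field is minus the tautological form, so the complement consists
  of the vectors whose base component is killed by the covector.\<close>

lemma euler_complement_par:
  assumes z: "z \<in> param_domain"
  shows "{u \<in> tangent_at (ann V \<Delta> 2) (par z). symp (par z) (euler (par z)) u = 0} =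
    dpar z ` {u. cov z \<bullet> fst u = 0}"
proof -
  have "fst z \<in> W" using z by auto
  then show ?thesis
    unfolding tangent_par[OF z] symp_eq euler_def by (auto simp: dpar_eq)
qed

end

section \<open>Fields generating the reduced Jacobi curve\<close>

text \<open>\<open>Hf\<close> is an arbitrary characteristic field in coordinates: on each ray it is
  a multiple of \<open>h0\<close> by a nonzero factor that varies with the point.\<close>

locale char_frame = rank2_frame +
  fixes M :: "((real ^ 5) \<times> real \<times> real) set"
    and Hf :: "(real ^ 5) \<times> real \<times> real \<Rightarrow> (real ^ 5) \<times> real \<times> real"
  assumes M: "M \<subseteq> param_domain" and Hf: "smooth_on M Hf"
    and Hf_kernel: "\<And>z. z \<in> M \<Longrightarrow> dpar z (Hf z) \<in> span {h0 (par z)}"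
    and Hf_nonzero: "\<And>z. z \<in> M \<Longrightarrow> Hf z \<noteq> 0"
begin

definition m3 :: "(real ^ 5) \<times> real \<times> real \<Rightarrow> real" where "m3 z = fst (snd z)"
definition m4 :: "(real ^ 5) \<times> real \<times> real \<Rightarrow> real" where "m4 z = snd (snd z)"

definition r2 where "r2 z = (m3 z)\<^sup>2 + (m4 z)\<^sup>2"

text \<open>The factor by which \<open>Hf\<close> differs from \<open>H0\<close>, recovered by
  projecting the X 0, X 1 coefficients of \<open>Hf\<close> to (m4, -m3); in this form it is visibly
  smooth.\<close>

definition f where
  "f z = (m4 z * (\<theta> 0 (fst z) \<bullet> fst (Hf z)) - m3 z * (\<theta> 1 (fst z) \<bullet> fst (Hf z))) / r2 z"

text \<open>The field \<open>h0\<close> in the coordinates (q, m3, m4): its last two components are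
  its derivatives of the momenta of X 3 and X 4, that is, Poisson brackets.\<close>

definition H0 where
  "H0 z = (m4 z *\<^sub>R X 0 (fst z) - m3 z *\<^sub>R X 1 (fst z),
     m4 z * (cov z \<bullet> lie_bracket (X 0) (X 3) (fst z)) - m3 z * (cov z \<bullet> lie_bracket (X 1) (X 3) (fst z)),
     m4 z * (cov z \<bullet> lie_bracket (X 0) (X 4) (fst z)) - m3 z * (cov z \<bullet> lie_bracket (X 1) (X 4) (fst z)))"

definition E :: "(real ^ 5) \<times> real \<times> real \<Rightarrow> (real ^ 5) \<times> real \<times> real" where
  "E z = (0, m3 z, m4 z)"
definition F0 :: "(real ^ 5) \<times> real \<times> real \<Rightarrow> (real ^ 5) \<times> real \<times> real" where
  "F0 z = (0, - m4 z, m3 z)"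
definition F1 where "F1 = lie_bracket Hf F0"
definition F2 where "F2 = lie_bracket Hf F1"
definition F3 where "F3 = lie_bracket Hf F2"

text \<open>The u's are the X 0, X 1 coefficients of \<open>Hf\<close>, the v's those of its bracket
  with the rotation field.\<close>

definition u0 where "u0 z = f z * m4 z"
definition u1 where "u1 z = - f z * m3 z"
definition v0 where "v0 z = - fderiv f z (F0 z) * m4 z - f z * m3 z"
definition v1 where "v1 z = fderiv f z (F0 z) * m3 z - f z * m4 z"

lemma open_M: "open M" using smooth_on_open[OF Hf] .

lemma M_W: "z \<in> M \<Longrightarrow> fst z \<in> W" using M by auto

lemma r2_pos: "z \<in> M \<Longrightarrow> r2 z > 0"
  using M by (auto simp: r2_def m3_def m4_def sum_power2_gt_zero_iff zero_prod_def)

lemma linear_m: "linear m3" "linear m4" and linear_E: "linear E" and linear_F0: "linear F0"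
  by (auto simp: linear_iff m3_def m4_def E_def F0_def)

lemma smooth_m: "smooth_on M m3" "smooth_on M m4"
  by (intro smooth_on_linear open_M linear_m)+

lemma smooth_fst: "smooth_on M (fst :: (real ^ 5) \<times> real \<times> real \<Rightarrow> _)"
  by (intro smooth_on_linear open_M linear_fst)

lemma smooth_fst_coeff:
  fixes Y :: "(real ^ 5) \<times> real \<times> real \<Rightarrow> (real ^ 5) \<times> real \<times> real"
  assumes "i < 5" "smooth_on M Y"
  shows "smooth_on M (\<lambda>z. \<theta> i (fst z) \<bullet> fst (Y z))"
  by (intro smooth_on_inner smooth_on_compose[OF \<theta> smooth_fst]
      smooth_on_compose_linear[OF linear_fst assms(2)])
    (use assms(1) M_W in auto)

lemma smooth_f: "smooth_on M f"
  unfolding f_def[abs_def]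
proof (intro smooth_on_divide smooth_on_diff smooth_on_mult smooth_m smooth_fst_coeff Hf)
  show "smooth_on M r2"
    unfolding r2_def[abs_def] power2_eq_square by (intro smooth_on_add smooth_on_mult smooth_m)
  show "r2 z \<noteq> 0" if "z \<in> M" for z using r2_pos[OF that] by simp
qed auto

lemma smooth_F0: "smooth_on M F0" and smooth_E: "smooth_on M E"
  by (intro smooth_on_linear open_M linear_F0 linear_E)+

lemma smooth_F1: "smooth_on M F1" unfolding F1_def by (intro smooth_on_lie_bracket Hf smooth_F0)
lemma smooth_F2: "smooth_on M F2" unfolding F2_def by (intro smooth_on_lie_bracket Hf smooth_F1)
lemma Hf_eq:
  assumes z: "z \<in> M"
  shows "Hf z = f z *\<^sub>R H0 z"
proof -
  have zW: "fst z \<in> W" by (rule M_W[OF z])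
  obtain c where c: "dpar z (Hf z) = c *\<^sub>R h0 (par z)"
    using Hf_kernel[OF z] by (auto simp: span_singleton)
  have l: "linear (dcoord (par z))" using linear_dcoord[of "par z"] zW by simp
  have "dcoord (par z) (h0 (par z)) = H0 z"
    using zW
    by (simp add: dcoord_eq linear_diff[OF linear_dmom] linear_scale[OF linear_dmom]
        h0_def H0_def dmom_ham fst_ham cov_X m3_def m4_def)
  then have H: "Hf z = c *\<^sub>R H0 z"
    using dcoord_dpar[OF zW, of "Hf z"] by (simp add: c linear_scale[OF l])
  have "\<theta> 0 (fst z) \<bullet> fst (Hf z) = c * m4 z" "\<theta> 1 (fst z) \<bullet> fst (Hf z) = - (c * m3 z)"
    using zW by (simp_all add: H H0_def inner_diff_right dual)
  then have "f z = c * r2 z / r2 z"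
    unfolding f_def by (simp add: r2_def power2_eq_square algebra_simps)
  then have "f z = c" using r2_pos[OF z] by simp
  with H show ?thesis by simp
qed

lemma f_nonzero: "z \<in> M \<Longrightarrow> f z \<noteq> 0"
  using Hf_eq[of z] Hf_nonzero[of z] by auto

lemma fst_Hf: "z \<in> M \<Longrightarrow> fst (Hf z) = u0 z *\<^sub>R X 0 (fst z) + u1 z *\<^sub>R X 1 (fst z)"
  by (simp add: Hf_eq H0_def u0_def u1_def algebra_simps)

lemma deriv_along:
  assumes "smooth_on M Y" "z \<in> M"
  shows "((\<lambda>s. Y (z + s *\<^sub>R v)) has_vector_derivative fderiv Y z v) (at 0)"
  by (rule has_vector_derivative_chain[of "\<lambda>s. z + s *\<^sub>R v"])
    (use smooth_on_has_derivative[OF assms] in \<open>auto intro!: derivative_eq_intros\<close>)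

lemma eventually_line:
  assumes "z \<in> M"
  obtains N where "open N" "0 \<in> N" "\<And>s :: real. s \<in> N \<Longrightarrow> z + s *\<^sub>R v \<in> M"
proof (rule that[of "(\<lambda>s. z + s *\<^sub>R v) -` M"])
  show "open ((\<lambda>s. z + s *\<^sub>R v) -` M)" by (intro open_vimage open_M continuous_intros)
qed (use assms in auto)

lemma m_line: "m3 (z + s *\<^sub>R v) = m3 z + s * m3 v" "m4 (z + s *\<^sub>R v) = m4 z + s * m4 v"
  by (simp_all add: m3_def m4_def)

lemma frechet_linear: "linear h \<Longrightarrow> fderiv h z = h" for h :: "'x::euclidean_space \<Rightarrow> 'y::real_normed_vector"
  by (rule frechet_derivative_at[symmetric], rule bounded_linear_imp_has_derivative)
    (simp add: linear_conv_bounded_linear)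

text \<open>The rotation field is vertical, so the base part of the bracket is minus the derivative
  of the base part of \<open>Hf\<close> in a fibre direction, along which the frame vectors do not
  change.\<close>

lemma fst_F1:
  assumes z: "z \<in> M"
  shows "fst (F1 z) = v0 z *\<^sub>R X 0 (fst z) + v1 z *\<^sub>R X 1 (fst z)"
proof -
  let ?g = "fderiv f z (F0 z)"
  obtain N where N: "open N" "0 \<in> N" "\<And>s. s \<in> N \<Longrightarrow> z + s *\<^sub>R F0 z \<in> M"
    using eventually_line[OF z] by blast
  have "((\<lambda>s. fst (Hf (z + s *\<^sub>R F0 z))) has_vector_derivative fst (fderiv Hf z (F0 z))) (at 0)"
    by (rule bounded_linear.has_vector_derivative[OF bounded_linear_fst deriv_along[OF Hf z]])
  moreover have "((\<lambda>s. fst (Hf (z + s *\<^sub>R F0 z))) has_vector_derivative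
     - (v0 z *\<^sub>R X 0 (fst z) + v1 z *\<^sub>R X 1 (fst z))) (at 0)"
  \<comment> \<open>Along the line in direction \<open>F0 z\<close> the pair (m3, m4) becomes (m3 -
    s m4, m4 + s m3).\<close>
  proof (rule has_vector_derivative_transform_within_open[of "\<lambda>s. f (z + s *\<^sub>R F0 z) *\<^sub>R
        ((m4 z + s * m3 z) *\<^sub>R X 0 (fst z) - (m3 z - s * m4 z) *\<^sub>R X 1 (fst z))"])
    have df: "((\<lambda>s. f (z + s *\<^sub>R F0 z)) has_real_derivative ?g) (at 0)"
      using deriv_along[OF smooth_f z, of "F0 z"] by (simp add: has_real_derivative_iff_has_vector_derivative)
    have dl: "((\<lambda>s. (m4 z + s * m3 z) *\<^sub>R X 0 (fst z) - (m3 z - s * m4 z) *\<^sub>R X 1 (fst z)) has_vector_derivative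
        (m3 z *\<^sub>R X 0 (fst z) + m4 z *\<^sub>R X 1 (fst z))) (at 0)"
      by (auto intro!: derivative_eq_intros)
    show "((\<lambda>s. f (z + s *\<^sub>R F0 z) *\<^sub>R
        ((m4 z + s * m3 z) *\<^sub>R X 0 (fst z) - (m3 z - s * m4 z) *\<^sub>R X 1 (fst z))) has_vector_derivative
        - (v0 z *\<^sub>R X 0 (fst z) + v1 z *\<^sub>R X 1 (fst z))) (at 0)"
      using has_vector_derivative_scaleR[OF df dl] by (simp add: v0_def v1_def algebra_simps)
    fix s assume "s \<in> N"
    then have "fst (Hf (z + s *\<^sub>R F0 z)) = f (z + s *\<^sub>R F0 z) *\<^sub>R fst (H0 (z + s *\<^sub>R F0 z))"
      using Hf_eq[OF N(3)] by simp
    then show "f (z + s *\<^sub>R F0 z) *\<^sub>R ((m4 z + s * m3 z) *\<^sub>R X 0 (fst z) - (m3 z - s * m4 z) *\<^sub>R X 1 (fst z))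
        = fst (Hf (z + s *\<^sub>R F0 z))"
      by (simp add: H0_def m_line) (simp add: F0_def m3_def m4_def)
  qed (rule N)+
  ultimately have "fst (fderiv Hf z (F0 z)) = - (v0 z *\<^sub>R X 0 (fst z) + v1 z *\<^sub>R X 1 (fst z))"
    by (rule vector_derivative_unique_at)
  moreover have "fst (F1 z) = fst (F0 (Hf z)) - fst (fderiv Hf z (F0 z))"
    by (simp add: F1_def lie_bracket_def frechet_linear[OF linear_F0])
  ultimately show ?thesis by (simp add: F0_def)
qed

text \<open>The derivative of f contributes a multiple of \<open>Hf\<close> to the base part of
  \<open>F1\<close> and drops out of the determinant. Hence the base parts of \<open>Hf\<close> and
  \<open>F1\<close> span the distribution whatever the factor f.\<close>

lemma wedge: "u0 z * v1 z - u1 z * v0 z = - ((f z)\<^sup>2 * r2 z)"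
  by (simp add: u0_def u1_def v0_def v1_def r2_def power2_eq_square algebra_simps)

lemma wedge_nonzero: "z \<in> M \<Longrightarrow> u0 z * v1 z - u1 z * v0 z \<noteq> 0"
  unfolding wedge using f_nonzero[of z] r2_pos[of z] by auto

text \<open>Modulo the fields already present, bracketing with \<open>Hf\<close> acts on
  coefficients without differentiating them. The 2 in \<open>max k 2\<close> accounts for the
  differentiated coefficients of \<open>Hf\<close> itself.\<close>

lemma lie_bracket_Hf:
  assumes z: "z \<in> M" and k: "k \<le> 5" and Y: "smooth_on M Y"
    and y: "\<And>z. z \<in> M \<Longrightarrow> fst (Y z) \<in> frame_span X k (fst z)"
  shows "fst (lie_bracket Hf Y z) - (\<Sum>j<k. (\<theta> j (fst z) \<bullet> fst (Y z)) *\<^sub>R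
      (u0 z *\<^sub>R lie_bracket (X 0) (X j) (fst z) + u1 z *\<^sub>R lie_bracket (X 1) (X j) (fst z)))
    \<in> frame_span X (max k 2) (fst z)"
proof -
  let ?u = "\<lambda>i. if i = (0::nat) then u0 else u1" and ?v = "\<lambda>j z. \<theta> j (fst z) \<bullet> fst (Y z)"
  have dX: "X i differentiable (at (fst z))" if "i < 5" for i
    using that by (intro smooth_on_differentiable[OF X] M_W[OF z]) auto
  have du: "?u i differentiable (at z)" for i
  proof -
    have "smooth_on M (?u i)"
      unfolding u0_def[abs_def] u1_def[abs_def]
      by (auto intro!: smooth_on_mult smooth_on_uminus smooth_f smooth_m)
    then show ?thesis using z by (rule smooth_on_differentiable)
  qed
  have "fst (lie_bracket Hf Y z) =
     (\<Sum>j<k. fderiv (?v j) z (Hf z) *\<^sub>R X j (fst z))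
     - (\<Sum>i<2. fderiv (?u i) z (Y z) *\<^sub>R X i (fst z))
     + (\<Sum>i<2. \<Sum>j<k. (?u i z * ?v j z) *\<^sub>R lie_bracket (X i) (X j) (fst z))"
  proof (rule lie_bracket_projection[OF linear_fst open_M z])
    show "fst (Hf y) = (\<Sum>i<2. ?u i y *\<^sub>R X i (fst y))" if "y \<in> M" for y
      using fst_Hf[OF that] by (simp add: less_simps)
    show "fst (Y z) = (\<Sum>j<k. ?v j z *\<^sub>R X j (fst z))" if "z \<in> M" for z
      using coeff_span[OF M_W[OF that] _ y[OF that]] k by simp
    show "?v j differentiable (at z)" if "j \<in> {..<k}" for j
      using smooth_fst_coeff[OF _ Y, of j] that k z by (auto intro: smooth_on_differentiable)
  qed (use du dX k z smooth_on_differentiable[OF Hf] smooth_on_differentiable[OF Y] in auto)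
  then have eq: "fst (lie_bracket Hf Y z) - (\<Sum>j<k. ?v j z *\<^sub>R
      (u0 z *\<^sub>R lie_bracket (X 0) (X j) (fst z) + u1 z *\<^sub>R lie_bracket (X 1) (X j) (fst z)))
    = (\<Sum>j<k. fderiv (?v j) z (Hf z) *\<^sub>R X j (fst z))
     - (\<Sum>i<2. fderiv (?u i) z (Y z) *\<^sub>R X i (fst z))"
    by (simp add: less_simps(1) sum.distrib scaleR_add_right mult.commute)
  show ?thesis
    unfolding eq by (intro span_diff span_sum span_scale span_base) auto
qed

lemma span_X_mono:
  assumes "j \<le> k" "v \<in> frame_span X j y"
  shows "v \<in> frame_span X k y"
proof -
  have "(\<lambda>i. X i y) ` {..<j} \<subseteq> (\<lambda>i. X i y) ` {..<k}" using assms(1) by auto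
  then show ?thesis using span_mono assms(2) by blast
qed

lemma dual_span_zero:
  assumes "y \<in> W" "v \<in> frame_span X k y" "k \<le> j" "j < 5"
  shows "\<theta> j y \<bullet> v = 0"
  using assms(2)
proof (induction rule: span_induct_alt)
  case (step c x z)
  then show ?case using assms(1,3,4) by (auto simp: inner_add_right dual)
qed simp

lemma X_span_base: "i < k \<Longrightarrow> X i y \<in> frame_span X k y"
  by (auto intro: span_base)

lemma fst_F1_span: "z \<in> M \<Longrightarrow> fst (F1 z) \<in> frame_span X 2 (fst z)"
  unfolding fst_F1 by (intro span_add span_scale X_span_base) auto

text \<open>Both \<open>Hf\<close> and \<open>F1\<close> lie over the distribution, so the X 2
  component of their bracket is the determinant of their coefficients, which is
  \<open>wedge\<close>.\<close>

lemma fst_F2: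
  assumes z: "z \<in> M"
  shows "fst (F2 z) + ((f z)\<^sup>2 * r2 z) *\<^sub>R X 2 (fst z) \<in> frame_span X 2 (fst z)"
proof -
  have c: "\<theta> 0 (fst z) \<bullet> fst (F1 z) = v0 z" "\<theta> 1 (fst z) \<bullet> fst (F1 z) = v1 z"
    using M_W[OF z] by (simp_all add: fst_F1[OF z] inner_add_right dual)
  have "(\<Sum>j<2. (\<theta> j (fst z) \<bullet> fst (F1 z)) *\<^sub>R
      (u0 z *\<^sub>R lie_bracket (X 0) (X j) (fst z) + u1 z *\<^sub>R lie_bracket (X 1) (X j) (fst z)))
      = (u0 z * v1 z - u1 z * v0 z) *\<^sub>R X 2 (fst z)"
    by (simp add: less_simps c lie_bracket_self brackets brackets_swap algebra_simps)
  with lie_bracket_Hf[OF z _ smooth_F1 fst_F1_span] show ?thesis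
    by (simp add: F2_def wedge)
qed

lemma fst_F2_span: "z \<in> M \<Longrightarrow> fst (F2 z) \<in> frame_span X 3 (fst z)"
  using span_diff[OF span_X_mono[OF _ fst_F2[of z], of 3] span_scale[OF X_span_base[of 2 3 "fst z"], of "(f z)\<^sup>2 * r2 z"]]
  by simp

lemma theta_F2: "z \<in> M \<Longrightarrow> \<theta> 2 (fst z) \<bullet> fst (F2 z) = - ((f z)\<^sup>2 * r2 z)"
  using dual_span_zero[OF M_W fst_F2, of z 2] M_W[of z] by (simp add: inner_add_right dual)

text \<open>Only the X 2 component of \<open>F2\<close> leaves the first three fields when bracketed
  with \<open>Hf\<close>; it produces u0 X 3 + u1 X 4 = f (m4 X 3 - m3 X 4).\<close>

lemma fst_F3:
  assumes z: "z \<in> M"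
  shows "fst (F3 z) + ((f z)\<^sup>2 * r2 z) *\<^sub>R (u0 z *\<^sub>R X 3 (fst z) + u1 z *\<^sub>R X 4 (fst z))
    \<in> frame_span X 3 (fst z)"
proof -
  have "(\<Sum>j<3. (\<theta> j (fst z) \<bullet> fst (F2 z)) *\<^sub>R
      (u0 z *\<^sub>R lie_bracket (X 0) (X j) (fst z) + u1 z *\<^sub>R lie_bracket (X 1) (X j) (fst z)))
      = ((\<theta> 1 (fst z) \<bullet> fst (F2 z)) * u0 z - (\<theta> 0 (fst z) \<bullet> fst (F2 z)) * u1 z) *\<^sub>R X 2 (fst z)
       - ((f z)\<^sup>2 * r2 z) *\<^sub>R (u0 z *\<^sub>R X 3 (fst z) + u1 z *\<^sub>R X 4 (fst z))"
    by (simp add: less_simps theta_F2[OF z] lie_bracket_self brackets brackets_swap algebra_simps)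
  with lie_bracket_Hf[OF z _ smooth_F2 fst_F2_span]
  have "fst (F3 z) - (((\<theta> 1 (fst z) \<bullet> fst (F2 z)) * u0 z - (\<theta> 0 (fst z) \<bullet> fst (F2 z)) * u1 z) *\<^sub>R X 2 (fst z)
       - ((f z)\<^sup>2 * r2 z) *\<^sub>R (u0 z *\<^sub>R X 3 (fst z) + u1 z *\<^sub>R X 4 (fst z))) \<in> frame_span X 3 (fst z)"
    by (simp add: F3_def)
  from span_add[OF this span_scale[OF X_span_base[of 2 3 "fst z"],
        of "(\<theta> 1 (fst z) \<bullet> fst (F2 z)) * u0 z - (\<theta> 0 (fst z) \<bullet> fst (F2 z)) * u1 z"]]
  show ?thesis by (simp add: algebra_simps)
qed

text \<open>Triangular elimination: \<theta> 3 and \<theta> 4 see only \<open>F3\<close>, then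
  \<theta> 2 sees only \<open>F2\<close>, then \<theta> 0 and \<theta> 1 separate \<open>Hf\<close>
  from \<open>F1\<close> by \<open>wedge_nonzero\<close>. The fibre part is left with the dilation
  and rotation fields, of determinant \<open>r2\<close>.\<close>

lemma relation_trivial:
  assumes z: "z \<in> M"
    and rel: "c0 *\<^sub>R Hf z + c1 *\<^sub>R E z + k0 *\<^sub>R F0 z + k1 *\<^sub>R F1 z + k2 *\<^sub>R F2 z + k3 *\<^sub>R F3 z = 0"
  shows "c0 = 0 \<and> c1 = 0 \<and> k0 = 0 \<and> k1 = 0 \<and> k2 = 0 \<and> k3 = 0"
proof -
  note zW = M_W[OF z]
  have R: "(f z)\<^sup>2 * r2 z \<noteq> 0" using f_nonzero[OF z] r2_pos[OF z] by simp
  have "fst (c0 *\<^sub>R Hf z + c1 *\<^sub>R E z + k0 *\<^sub>R F0 z + k1 *\<^sub>R F1 z + k2 *\<^sub>R F2 z + k3 *\<^sub>R F3 z) = 0"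
    unfolding rel by simp
  then have fst_rel: "c0 *\<^sub>R fst (Hf z) + k1 *\<^sub>R fst (F1 z) + k2 *\<^sub>R fst (F2 z) + k3 *\<^sub>R fst (F3 z) = 0"
    by (simp add: E_def F0_def)
  have theta_rel: "c0 * (\<theta> j (fst z) \<bullet> fst (Hf z)) + k1 * (\<theta> j (fst z) \<bullet> fst (F1 z))
      + k2 * (\<theta> j (fst z) \<bullet> fst (F2 z)) + k3 * (\<theta> j (fst z) \<bullet> fst (F3 z)) = 0" for j
    using arg_cong[OF fst_rel, of "\<lambda>v. \<theta> j (fst z) \<bullet> v"] by (simp add: inner_add_right)
  have H: "\<theta> 2 (fst z) \<bullet> fst (Hf z) = 0" "\<theta> 3 (fst z) \<bullet> fst (Hf z) = 0" "\<theta> 4 (fst z) \<bullet> fst (Hf z) = 0"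
    "\<theta> 0 (fst z) \<bullet> fst (Hf z) = u0 z" "\<theta> 1 (fst z) \<bullet> fst (Hf z) = u1 z"
    using zW by (simp_all add: fst_Hf[OF z] inner_add_right dual)
  have 1: "\<theta> 2 (fst z) \<bullet> fst (F1 z) = 0" "\<theta> 3 (fst z) \<bullet> fst (F1 z) = 0" "\<theta> 4 (fst z) \<bullet> fst (F1 z) = 0"
    "\<theta> 0 (fst z) \<bullet> fst (F1 z) = v0 z" "\<theta> 1 (fst z) \<bullet> fst (F1 z) = v1 z"
    using zW by (simp_all add: fst_F1[OF z] inner_add_right dual)
  have 2: "\<theta> 3 (fst z) \<bullet> fst (F2 z) = 0" "\<theta> 4 (fst z) \<bullet> fst (F2 z) = 0"
    using dual_span_zero[OF zW fst_F2_span[OF z]] by auto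
  have 3: "\<theta> 3 (fst z) \<bullet> fst (F3 z) = - ((f z)\<^sup>2 * r2 z) * u0 z" "\<theta> 4 (fst z) \<bullet> fst (F3 z) = - ((f z)\<^sup>2 * r2 z) * u1 z"
    using dual_span_zero[OF zW fst_F3[OF z], of 3] dual_span_zero[OF zW fst_F3[OF z], of 4] zW
    by (simp_all add: inner_add_right dual algebra_simps)
  have "k3 * u0 z = 0" "k3 * u1 z = 0"
    using theta_rel[of 3] theta_rel[of 4] R by (simp_all add: H 1 2 3)
  then have k3: "k3 = 0" using wedge_nonzero[OF z] by auto
  have k2: "k2 = 0" using theta_rel[of 2] R by (simp add: k3 H 1 theta_F2[OF z])
  have a: "c0 * u0 z + k1 * v0 z = 0" and b: "c0 * u1 z + k1 * v1 z = 0"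
    using theta_rel[of 0] theta_rel[of 1] by (simp_all add: k2 k3 H 1)
  have "c0 * (u0 z * v1 z - u1 z * v0 z) = (c0 * u0 z + k1 * v0 z) * v1 z - (c0 * u1 z + k1 * v1 z) * v0 z"
    "k1 * (u0 z * v1 z - u1 z * v0 z) = (c0 * u1 z + k1 * v1 z) * u0 z - (c0 * u0 z + k1 * v0 z) * u1 z"
    by (simp_all add: algebra_simps)
  then have "c0 * (u0 z * v1 z - u1 z * v0 z) = 0" "k1 * (u0 z * v1 z - u1 z * v0 z) = 0"
    unfolding a b by simp_all
  then have c0: "c0 = 0" and k1: "k1 = 0" using wedge_nonzero[OF z] by (simp_all only: mult_eq_0_iff) auto
  have s: "c1 * m3 z - k0 * m4 z = 0" "c1 * m4 z + k0 * m3 z = 0"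
    using rel by (simp_all add: c0 k1 k2 k3 E_def F0_def zero_prod_def)
  have "c1 * r2 z = (c1 * m3 z - k0 * m4 z) * m3 z + (c1 * m4 z + k0 * m3 z) * m4 z"
    "k0 * r2 z = (c1 * m4 z + k0 * m3 z) * m3 z - (c1 * m3 z - k0 * m4 z) * m4 z"
    by (simp_all add: r2_def power2_eq_square algebra_simps)
  then have "c1 * r2 z = 0" "k0 * r2 z = 0" unfolding s by simp_all
  then have "c1 = 0" "k0 = 0" using r2_pos[OF z] by simp_all
  with c0 k1 k2 k3 show ?thesis by simp
qed

lemma cov_span_zero: 
  assumes "fst z \<in> W" "v \<in> frame_span X 3 (fst z)"
  shows "cov z \<bullet> v = 0"
  using assms(2)
proof (induction rule: span_induct_alt)
  case (step c x y)
  then show ?case using assms(1) by (auto simp: inner_add_right cov_X)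
qed simp

lemma cov_fields:
  assumes z: "z \<in> M"
  shows "cov z \<bullet> fst (Hf z) = 0" "cov z \<bullet> fst (E z) = 0" "cov z \<bullet> fst (F0 z) = 0"
    "cov z \<bullet> fst (F1 z) = 0" "cov z \<bullet> fst (F2 z) = 0" "cov z \<bullet> fst (F3 z) = 0"
proof -
  note zW = M_W[OF z]
  show "cov z \<bullet> fst (Hf z) = 0" using zW by (simp add: fst_Hf[OF z] inner_add_right cov_X)
  show "cov z \<bullet> fst (F1 z) = 0" using zW by (simp add: fst_F1[OF z] inner_add_right cov_X)
  show "cov z \<bullet> fst (F2 z) = 0" by (rule cov_span_zero[OF zW fst_F2_span[OF z]])
  \<comment> \<open>Outside the first three fields the pairing is a multiple of f (m4 m3 - m3 m4) =
    0.\<close>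
  show "cov z \<bullet> fst (F3 z) = 0"
    using cov_span_zero[OF zW fst_F3[OF z]] zW
    by (simp add: inner_add_right inner_diff_right cov_X u0_def u1_def m3_def m4_def)
qed (simp_all add: E_def F0_def)

text \<open>This is the Jacobi space in coordinates. Its two base directions are covered by
  \<open>Hf\<close> and \<open>F1\<close>, its two fibre directions by \<open>E\<close> and
  \<open>F0\<close>.\<close>

lemma span_fields:
  assumes z: "z \<in> M"
  shows "span {Hf z, E z, F0 z, F1 z} = {u. fst u \<in> \<Delta> (fst z)}"
proof (intro equalityI subsetI)
  note zW = M_W[OF z]
  have "subspace {u :: (real ^ 5) \<times> real \<times> real. fst u \<in> \<Delta> (fst z)}"
    unfolding \<Delta>_eq[OF zW] by (auto simp: subspace_def span_0 intro: span_add span_scale)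
  moreover have "{Hf z, E z, F0 z, F1 z} \<subseteq> {u. fst u \<in> \<Delta> (fst z)}"
    unfolding \<Delta>_eq[OF zW] using fst_F1_span[OF z]
    by (auto simp: E_def F0_def fst_Hf[OF z] span_0 intro!: span_add span_scale X_span_base)
  ultimately show "u \<in> {u. fst u \<in> \<Delta> (fst z)}" if "u \<in> span {Hf z, E z, F0 z, F1 z}" for u
    using span_minimal that by blast
next
  note zW = M_W[OF z]
  fix u assume "u \<in> {u :: (real ^ 5) \<times> real \<times> real. fst u \<in> \<Delta> (fst z)}"
  then obtain a b where ab: "fst u = a *\<^sub>R X 0 (fst z) + b *\<^sub>R X 1 (fst z)"
    using \<Delta>_iff[OF zW] by auto
  define D where "D = u0 z * v1 z - u1 z * v0 z"
  have D: "D \<noteq> 0" using wedge_nonzero[OF z] by (simp add: D_def)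
  \<comment> \<open>Cramer's rule for the base part in terms of \<open>Hf\<close> and
    \<open>F1\<close>.\<close>
  define c0 k1 where c: "c0 = (a * v1 z - b * v0 z) / D" "k1 = (u0 z * b - u1 z * a) / D"
  have a: "c0 * u0 z + k1 * v0 z = a" and b: "c0 * u1 z + k1 * v1 z = b"
  proof -
    have "D * a = (a * v1 z - b * v0 z) * u0 z + (u0 z * b - u1 z * a) * v0 z"
      "D * b = (a * v1 z - b * v0 z) * u1 z + (u0 z * b - u1 z * a) * v1 z"
      by (simp_all add: D_def algebra_simps)
    then show "c0 * u0 z + k1 * v0 z = a" "c0 * u1 z + k1 * v1 z = b"
      unfolding c times_divide_eq_left add_divide_distrib[symmetric] using D
      by (metis nonzero_mult_div_cancel_left)+
  qed
  define w where "w = u - c0 *\<^sub>R Hf z - k1 *\<^sub>R F1 z"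
  have "fst w = 0"
    unfolding w_def fst_diff fst_scaleR ab fst_Hf[OF z] fst_F1[OF z] a[symmetric] b[symmetric]
    by (simp add: algebra_simps)
  \<comment> \<open>In the fibre (m3, m4) and (-m4, m3) are orthogonal of squared length
    \<open>r2\<close>, so the coefficients are inner products divided by \<open>r2\<close>.\<close>
  define c1 k0 where ck: "c1 = (m3 w * m3 z + m4 w * m4 z) / r2 z" "k0 = (m4 w * m3 z - m3 w * m4 z) / r2 z"
  have R: "r2 z \<noteq> 0" using r2_pos[OF z] by simp
  have "r2 z * m3 w = (m3 w * m3 z + m4 w * m4 z) * m3 z - (m4 w * m3 z - m3 w * m4 z) * m4 z"
    "r2 z * m4 w = (m3 w * m3 z + m4 w * m4 z) * m4 z + (m4 w * m3 z - m3 w * m4 z) * m3 z"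
    by (simp_all add: r2_def power2_eq_square algebra_simps)
  then have "c1 * m3 z - k0 * m4 z = m3 w" "c1 * m4 z + k0 * m3 z = m4 w"
    unfolding ck times_divide_eq_left add_divide_distrib[symmetric] diff_divide_distrib[symmetric] using R
    by (metis nonzero_mult_div_cancel_left)+
  then have "w = c1 *\<^sub>R E z + k0 *\<^sub>R F0 z"
    using \<open>fst w = 0\<close> by (simp add: E_def F0_def prod_eq_iff m3_def m4_def)
  then have "u = c0 *\<^sub>R Hf z + c1 *\<^sub>R E z + k0 *\<^sub>R F0 z + k1 *\<^sub>R F1 z"
    by (simp add: w_def algebra_simps)
  then show "u \<in> span {Hf z, E z, F0 z, F1 z}"
    by (auto intro!: span_add span_scale intro: span_base)
qed

text \<open>\<open>H0\<close> is homogeneous under dilations, and rescaling by f keeps its bracket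
  with the Euler field a multiple of \<open>Hf\<close>. The span of \<open>Hf\<close> and
  \<open>E\<close> is therefore preserved by the flow, so that the quotient makes sense along the
  orbit.\<close>

lemma lie_bracket_euler:
  assumes z: "z \<in> M"
  shows "\<exists>k. lie_bracket Hf E z = k *\<^sub>R Hf z"
proof -
  let ?g = "fderiv f z (E z)"
  obtain N where N: "open N" "0 \<in> N" "\<And>s. s \<in> N \<Longrightarrow> z + s *\<^sub>R E z \<in> M"
    using eventually_line[OF z] by blast
  have line: "fst (z + s *\<^sub>R E z) = fst z" "m3 (z + s *\<^sub>R E z) = (1 + s) * m3 z"
    "m4 (z + s *\<^sub>R E z) = (1 + s) * m4 z" "cov (z + s *\<^sub>R E z) = (1 + s) *\<^sub>R cov z" for s
    by (simp_all add: m_line) (simp_all add: E_def m3_def m4_def cov_def algebra_simps)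
  \<comment> \<open>The base part is linear in the momenta; the fibre part is quadratic, being
    momenta times \<open>cov\<close>.\<close>
  have H0_line: "H0 (z + s *\<^sub>R E z) = ((1 + s) *\<^sub>R fst (H0 z), (1 + s)\<^sup>2 *\<^sub>R snd (H0 z))" for s
    unfolding H0_def line by (simp add: power2_eq_square algebra_simps)
  have "((\<lambda>s. Hf (z + s *\<^sub>R E z)) has_vector_derivative ?g *\<^sub>R H0 z + f z *\<^sub>R (fst (H0 z), 2 *\<^sub>R snd (H0 z))) (at 0)"
  proof (rule has_vector_derivative_transform_within_open[of "\<lambda>s. f (z + s *\<^sub>R E z) *\<^sub>R
        ((1 + s) *\<^sub>R fst (H0 z), (1 + s)\<^sup>2 *\<^sub>R snd (H0 z))"])
    have df: "((\<lambda>s. f (z + s *\<^sub>R E z)) has_real_derivative ?g) (at 0)"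
      using deriv_along[OF smooth_f z, of "E z"] by (simp add: has_real_derivative_iff_has_vector_derivative)
    have "((\<lambda>s. (1 + s) *\<^sub>R fst (H0 z)) has_vector_derivative fst (H0 z)) (at 0)"
      by (auto intro!: derivative_eq_intros)
    moreover have "((\<lambda>s. (1 + s)\<^sup>2) has_real_derivative 2) (at 0)"
      by (auto intro!: derivative_eq_intros)
    then have "((\<lambda>s. (1 + s)\<^sup>2 *\<^sub>R snd (H0 z)) has_vector_derivative 2 *\<^sub>R snd (H0 z)) (at 0)"
      using has_vector_derivative_scaleR[OF _ has_vector_derivative_const] by fastforce
    ultimately have "((\<lambda>s. ((1 + s) *\<^sub>R fst (H0 z), (1 + s)\<^sup>2 *\<^sub>R snd (H0 z))) has_vector_derivative
        (fst (H0 z), 2 *\<^sub>R snd (H0 z))) (at 0)"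
      by (rule has_vector_derivative_Pair)
    from has_vector_derivative_scaleR[OF df this]
    show "((\<lambda>s. f (z + s *\<^sub>R E z) *\<^sub>R ((1 + s) *\<^sub>R fst (H0 z), (1 + s)\<^sup>2 *\<^sub>R snd (H0 z)))
        has_vector_derivative ?g *\<^sub>R H0 z + f z *\<^sub>R (fst (H0 z), 2 *\<^sub>R snd (H0 z))) (at 0)"
      by (simp add: add.commute)
    fix s assume "s \<in> N"
    then show "f (z + s *\<^sub>R E z) *\<^sub>R ((1 + s) *\<^sub>R fst (H0 z), (1 + s)\<^sup>2 *\<^sub>R snd (H0 z)) = Hf (z + s *\<^sub>R E z)"
      using Hf_eq[OF N(3)] H0_line by simp
  qed (rule N)+
  with deriv_along[OF Hf z, of "E z"]
  have "fderiv Hf z (E z) = ?g *\<^sub>R H0 z + f z *\<^sub>R (fst (H0 z), 2 *\<^sub>R snd (H0 z))"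
    by (rule vector_derivative_unique_at)
  moreover have "E (Hf z) = f z *\<^sub>R (0, snd (H0 z))"
    using Hf_eq[OF z] by (simp add: E_def m3_def m4_def prod_eq_iff)
  ultimately have "lie_bracket Hf E z = - (?g + f z) *\<^sub>R H0 z"
    unfolding lie_bracket_def frechet_linear[OF linear_E] by (simp add: prod_eq_iff algebra_simps)
  also have "\<dots> = (- (?g + f z) / f z) *\<^sub>R Hf z"
    using f_nonzero[OF z] by (simp add: Hf_eq[OF z])
  finally show ?thesis by blast
qed

text \<open>By Cartan's formula, \<open>Hf\<close> being in the kernel of the symplectic form, its flow preserves
  the tautological form.\<close>

lemma cov_invariant:
  assumes z: "z \<in> M"
  shows "dcov z (Hf z) \<bullet> fst u + cov z \<bullet> fst (fderiv Hf z u) = 0"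
proof -
  note zW = M_W[OF z]
  have zp: "z \<in> param_domain" using z M by auto
  \<comment> \<open>The contraction of the tautological form with \<open>Hf\<close> vanishes
    identically, so its differential does too.\<close>
  have "((\<lambda>z. cov z \<bullet> fst (Hf z)) has_derivative
      (\<lambda>u. cov z \<bullet> fst (fderiv Hf z u) + dcov z u \<bullet> fst (Hf z))) (at z)"
    by (intro has_derivative_inner cov_derivative[OF zW] has_derivative_fst smooth_on_has_derivative[OF Hf z])
  moreover have "((\<lambda>z. cov z \<bullet> fst (Hf z)) has_derivative (\<lambda>u. 0)) (at z)"
    by (rule has_derivative_transform_within_open[OF has_derivative_const[of 0] open_M z])
      (simp add: cov_fields)
  ultimately have 1: "cov z \<bullet> fst (fderiv Hf z u) + dcov z u \<bullet> fst (Hf z) = 0"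
    by (rule has_derivative_unique[THEN fun_cong])
  have "snd (par z) \<noteq> 0" using par_in(2)[OF zp] ann_3[of "par z"] zW by auto
  then have "dpar z (Hf z) \<in> symp_kernel (ann V \<Delta> 2) (par z)"
    using symp_kernel_ann_2(1)[of "par z"] par_in(1)[OF zp] zW Hf_kernel[OF z] by simp
  then have "symp (par z) (dpar z (Hf z)) (dpar z u) = 0"
    unfolding symp_kernel_def tangent_par[OF zp] by blast
  then show ?thesis using 1 zW by (simp add: symp_eq dpar_eq)
qed

end

section \<open>The curve pulled back along the characteristic flow\<close>

lemma constant_on_interval:
  fixes g :: "real \<Rightarrow> 'a::real_normed_vector"
  assumes "\<And>t. \<bar>t\<bar> < e \<Longrightarrow> (g has_vector_derivative 0) (at t)" "\<bar>t\<bar> < e"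
  shows "g t = g 0"
proof -
  have "(g has_vector_derivative 0) (at t within {-e<..<e})" if "t \<in> {-e<..<e}" for t
    by (rule has_vector_derivative_at_within, rule assms(1)) (use that in auto)
  then obtain c where "\<And>t. t \<in> {-e<..<e} \<Longrightarrow> g t = c"
    by (rule has_vector_derivative_zero_constant[of "{-e<..<e}" g, rotated]) auto
  moreover have "t \<in> {-e<..<e}" "0 \<in> {-e<..<e}" using assms(2) by auto
  ultimately show ?thesis by metis
qed

text \<open>Distinctness is recorded because a set forgets repetitions: the dimension count for the
  adapted coordinates needs six elements.\<close>

lemma independent_six:
  fixes a b c d x y :: "'a::euclidean_space"
  assumes rel: "\<And>k1 k2 k3 k4 k5 k6. k1 *\<^sub>R a + k2 *\<^sub>R b + k3 *\<^sub>R c + k4 *\<^sub>R d + k5 *\<^sub>R x + k6 *\<^sub>R y = 0 \<Longrightarrow>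
      k1 = 0 \<and> k2 = 0 \<and> k3 = 0 \<and> k4 = 0 \<and> k5 = 0 \<and> k6 = 0"
  shows "independent {a, b, c, d, x, y} \<and> distinct [a, b, c, d, x, y]"
proof
  show dist: "distinct [a, b, c, d, x, y]"
    using rel[of 1 "-1" 0 0 0 0] rel[of 1 0 "-1" 0 0 0] rel[of 1 0 0 "-1" 0 0] rel[of 1 0 0 0 "-1" 0]
      rel[of 1 0 0 0 0 "-1"] rel[of 0 1 "-1" 0 0 0] rel[of 0 1 0 "-1" 0 0] rel[of 0 1 0 0 "-1" 0]
      rel[of 0 1 0 0 0 "-1"] rel[of 0 0 1 "-1" 0 0] rel[of 0 0 1 0 "-1" 0] rel[of 0 0 1 0 0 "-1"]
      rel[of 0 0 0 1 "-1" 0] rel[of 0 0 0 1 0 "-1"] rel[of 0 0 0 0 1 "-1"]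
    by auto
  have "\<forall>v\<in>{a, b, c, d, x, y}. u v = 0" if "(\<Sum>v\<in>{a, b, c, d, x, y}. u v *\<^sub>R v) = 0" for u
  proof -
    have "u a *\<^sub>R a + u b *\<^sub>R b + u c *\<^sub>R c + u d *\<^sub>R d + u x *\<^sub>R x + u y *\<^sub>R y = 0"
      using that dist by (simp add: add.assoc)
    then show ?thesis using rel by blast
  qed
  then show "independent {a, b, c, d, x, y}"
    by (subst independent_explicit) auto
qed

lemma span_shear: "span {a, b + c *\<^sub>R a, x, y} = span {a, b, x, y}"
proof -
  have "b = (b + c *\<^sub>R a) - c *\<^sub>R a" by simp
  then have "b \<in> span {a, b + c *\<^sub>R a, x, y}"
    by (metis insertCI span_base span_diff span_scale)
  moreover have "b + c *\<^sub>R a \<in> span {a, b, x, y}"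
    by (intro span_add span_scale) (auto intro: span_base)
  ultimately show ?thesis
    by (intro subset_antisym span_minimal) (auto intro: span_base)
qed

locale char_flow = char_frame W X \<theta> V \<Delta> M Hf + smooth_flow_inverse M G Hf \<phi> \<delta> \<zeta> e
  for W :: "(real ^ 5) set" and X \<theta> V \<Delta> M Hf G \<phi> \<delta> \<zeta> e
begin

lemma orbit_M: "\<bar>t\<bar> < e \<Longrightarrow> orbit t \<in> M"
  using orbit_in G by auto

lemma \<zeta>_M: "\<zeta> \<in> M" using G by auto
lemma \<zeta>_W: "fst \<zeta> \<in> W" using \<zeta>_M M_W by auto

lemma B_Hf: "\<bar>t\<bar> < e \<Longrightarrow> B t (Hf (orbit t)) = Hf \<zeta>"
proof -
  assume t: "\<bar>t\<bar> < e"
  have "((\<lambda>s. B s (Hf (orbit s))) has_vector_derivative 0) (at s)" if "\<bar>s\<bar> < e" for s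
    using pullback_ode[OF Hf that] linear_0[OF linear_B[OF that]] by (simp add: lie_bracket_self)
  from constant_on_interval[OF this t] show ?thesis by (simp add: B_zero orbit_zero)
qed

text \<open>The derivative of the pulled-back Euler field is the pull-back of a multiple of
  \<open>Hf\<close>, hence a multiple of the constant vector \<open>Hf \<zeta>\<close>; modulo that
  vector the pull-back is constant.\<close>

lemma B_E:
  assumes t: "\<bar>t\<bar> < e"
  shows "\<exists>c. B t (E (orbit t)) = E \<zeta> + c *\<^sub>R Hf \<zeta>"
proof -
  let ?h = "Hf \<zeta>"
  define k where "k = inverse (?h \<bullet> ?h)"
  \<comment> \<open>The orthogonal projection with kernel spanned by \<open>Hf \<zeta>\<close>;
    applying it makes "constant modulo \<open>Hf \<zeta>\<close>" an honest constant.\<close>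
  define P where "P v = v - ((v \<bullet> ?h) * k) *\<^sub>R ?h" for v
  have P: "linear P"
    by (rule linearI) (simp_all add: P_def inner_add_left distrib_right scaleR_add_left scaleR_diff_right mult.assoc)
  have Ph: "P ?h = 0" using Hf_nonzero[OF \<zeta>_M] by (simp add: P_def k_def)
  have "((\<lambda>s. P (B s (E (orbit s)))) has_vector_derivative 0) (at s)" if s: "\<bar>s\<bar> < e" for s
  proof -
    obtain k where k: "lie_bracket Hf E (orbit s) = k *\<^sub>R Hf (orbit s)"
      using lie_bracket_euler[OF orbit_M[OF s]] by blast
    have "((\<lambda>s. P (B s (E (orbit s)))) has_vector_derivative P (B s (lie_bracket Hf E (orbit s)))) (at s)"
      by (rule bounded_linear.has_vector_derivative[OF _ pullback_ode[OF smooth_E s]])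
        (use P in \<open>simp add: linear_conv_bounded_linear\<close>)
    then show ?thesis
      by (simp add: k linear_scale[OF linear_B[OF s]] B_Hf[OF s] linear_scale[OF P] Ph)
  qed
  from constant_on_interval[OF this t] have "P (B t (E (orbit t))) = P (E \<zeta>)"
    by (simp add: B_zero orbit_zero)
  then have "B t (E (orbit t)) = E \<zeta> + ((B t (E (orbit t)) \<bullet> ?h) * k - (E \<zeta> \<bullet> ?h) * k) *\<^sub>R ?h"
    by (simp add: P_def scaleR_diff_left algebra_simps del: scaleR_scaleR)
  then show ?thesis by blast
qed

text \<open>By \<open>cov_invariant\<close> the pairing of the covector with the pushed-forward
  vector has derivative 0. So the pull-back maps the Euler complement at the orbit point into the
  fixed one at \<zeta>.\<close>

lemma cov_B:
  assumes t: "\<bar>t\<bar> < e"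
  shows "cov \<zeta> \<bullet> fst (B t u) = cov (orbit t) \<bullet> fst u"
proof -
  have "((\<lambda>s. cov (orbit s) \<bullet> fst (A s v)) has_vector_derivative 0) (at s)" if s: "\<bar>s\<bar> < e" for s v
  proof -
    have 1: "((\<lambda>s. cov (orbit s)) has_vector_derivative dcov (orbit s) (Hf (orbit s))) (at s)"
      by (rule has_vector_derivative_chain[OF orbit_ode[OF s] cov_derivative[OF M_W[OF orbit_M[OF s]]]])
    have 2: "((\<lambda>s. fst (A s v)) has_vector_derivative fst (fderiv Hf (orbit s) (A s v))) (at s)"
      by (rule bounded_linear.has_vector_derivative[OF bounded_linear_fst A_ode[OF s]])
    show ?thesis
      using bounded_bilinear.has_vector_derivative[OF bounded_bilinear_inner 1 2]
        cov_invariant[OF orbit_M[OF s], of "A s v"] by (simp add: add.commute)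
  qed
  from constant_on_interval[OF this t, of "B t u"]
  have "cov (orbit t) \<bullet> fst (A t (B t u)) = cov \<zeta> \<bullet> fst (A 0 (B t u))"
    by (simp add: orbit_zero)
  moreover have "A 0 v = v" for v using A_B[of 0 v] e by (simp add: B_zero)
  ultimately show ?thesis by (simp add: A_B[OF t])
qed

text \<open>The four curves are the pull-backs of \<open>F0\<close> to \<open>F3\<close>, each the
  derivative of the preceding one by \<open>pullback_ode\<close>. Their independence modulo
  \<open>Hf\<close> and \<open>E\<close> at \<zeta> is \<open>relation_trivial\<close> at the orbit
  point, carried back by injective linear maps.\<close>

lemma has_weight_jacobi:
  assumes \<tau>: "\<bar>\<tau>\<bar> < e"
    and \<Lambda>: "\<And>t. \<bar>t\<bar> < e \<Longrightarrow> \<Lambda> t = dpar \<zeta> ` B t ` {u. fst u \<in> \<Delta> (fst (orbit t))}"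
  shows "has_weight TYPE(2) (dpar \<zeta> ` {u. cov \<zeta> \<bullet> fst u = 0})
    (span {dpar \<zeta> (Hf \<zeta>), dpar \<zeta> (E \<zeta>)}) \<Lambda> \<tau> 4"
proof -
  let ?D = "dpar \<zeta>"
  have D: "linear ?D" by (rule linear_dpar[OF \<zeta>_W])
  have D_inj: "?D u = 0 \<Longrightarrow> u = 0" for u
    using dcoord_dpar[OF \<zeta>_W, of u] linear_0[OF linear_dcoord[of "par \<zeta>"]] \<zeta>_W by simp
  have B_inj: "B t u = 0 \<Longrightarrow> u = 0" if "\<bar>t\<bar> < e" for t u
    using A_B[OF that, of u] linear_0[OF linear_A[OF that]] by simp
  define w where "w F t = ?D (B t (F (orbit t)))" for F t
  have smooth_w: "smooth_on {-e<..<e} (w F)" if "smooth_on M F" for F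
    unfolding w_def[abs_def] by (rule smooth_on_compose_linear[OF D smooth_pullback[OF that]])
  have deriv_w: "(w F has_vector_derivative w (lie_bracket Hf F) t) (at t)" if "smooth_on M F" "\<bar>t\<bar> < e" for F t
    unfolding w_def[abs_def]
    by (rule bounded_linear.has_vector_derivative[OF _ pullback_ode[OF that]])
      (use D in \<open>simp add: linear_conv_bounded_linear\<close>)
  show ?thesis
  proof (rule has_weight_four[where e = e and ?w0.0 = "w F0" and ?w1.0 = "w F1" and ?w2.0 = "w F2" and ?w3.0 = "w F3"])
    show "smooth_on {-e<..<e} (w F0)" "smooth_on {-e<..<e} (w F1)"
      by (intro smooth_w smooth_F0 smooth_F1)+
    fix t assume t: "\<bar>t\<bar> < e"
    show "(w F0 has_vector_derivative w F1 t) (at t)" "(w F1 has_vector_derivative w F2 t) (at t)"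
      "(w F2 has_vector_derivative w F3 t) (at t)"
      unfolding F1_def[symmetric] F2_def[symmetric] F3_def[symmetric]
      using deriv_w[OF smooth_F0 t] deriv_w[OF smooth_F1 t] deriv_w[OF smooth_F2 t]
      by (simp_all add: F1_def[symmetric] F2_def[symmetric] F3_def[symmetric])
    obtain c where c: "B t (E (orbit t)) = E \<zeta> + c *\<^sub>R Hf \<zeta>" using B_E[OF t] by blast
    note lins = linear_add[OF D] linear_scale[OF D] linear_diff[OF D] linear_add[OF linear_B[OF t]]
      linear_scale[OF linear_B[OF t]]
    show "independent {?D (Hf \<zeta>), ?D (E \<zeta>), w F0 t, w F1 t, w F2 t, w F3 t}
        \<and> distinct [?D (Hf \<zeta>), ?D (E \<zeta>), w F0 t, w F1 t, w F2 t, w F3 t]"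
    proof (rule independent_six)
      fix c0 c1 k0 k1 k2 k3
      assume "c0 *\<^sub>R ?D (Hf \<zeta>) + c1 *\<^sub>R ?D (E \<zeta>) + k0 *\<^sub>R w F0 t + k1 *\<^sub>R w F1 t + k2 *\<^sub>R w F2 t + k3 *\<^sub>R w F3 t = 0"
      \<comment> \<open>The pull-back of \<open>E\<close> is \<open>E \<zeta>\<close> sheared by c
        times \<open>Hf \<zeta>\<close>; the coefficient c0 - c1 c compensates for the
        shear.\<close>
      then have "?D (B t ((c0 - c1 * c) *\<^sub>R Hf (orbit t) + c1 *\<^sub>R E (orbit t) + k0 *\<^sub>R F0 (orbit t)
          + k1 *\<^sub>R F1 (orbit t) + k2 *\<^sub>R F2 (orbit t) + k3 *\<^sub>R F3 (orbit t))) = 0"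
        unfolding lins B_Hf[OF t] c w_def by (simp add: algebra_simps)
      then have "(c0 - c1 * c) *\<^sub>R Hf (orbit t) + c1 *\<^sub>R E (orbit t) + k0 *\<^sub>R F0 (orbit t)
          + k1 *\<^sub>R F1 (orbit t) + k2 *\<^sub>R F2 (orbit t) + k3 *\<^sub>R F3 (orbit t) = 0"
        using D_inj B_inj[OF t] by blast
      from relation_trivial[OF orbit_M[OF t] this]
      show "c0 = 0 \<and> c1 = 0 \<and> k0 = 0 \<and> k1 = 0 \<and> k2 = 0 \<and> k3 = 0" by auto
    qed
    have w_A: "w F t \<in> ?D ` {u. cov \<zeta> \<bullet> fst u = 0}" if "cov (orbit t) \<bullet> fst (F (orbit t)) = 0" for F
      unfolding w_def using cov_B[OF t] that by auto
    show "{?D (Hf \<zeta>), ?D (E \<zeta>), w F0 t, w F1 t, w F2 t, w F3 t} \<subseteq> ?D ` {u. cov \<zeta> \<bullet> fst u = 0}"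
      using cov_fields[OF \<zeta>_M] w_A cov_fields[OF orbit_M[OF t]] by auto
    have "?D ` B t ` span {Hf (orbit t), E (orbit t), F0 (orbit t), F1 (orbit t)}
      = span (?D ` B t ` {Hf (orbit t), E (orbit t), F0 (orbit t), F1 (orbit t)})"
      by (simp only: linear_span_image[OF linear_B[OF t]] linear_span_image[OF D])
    also have "\<dots> = span {?D (Hf \<zeta>), ?D (E \<zeta>) + c *\<^sub>R ?D (Hf \<zeta>), w F0 t, w F1 t}"
      by (simp add: B_Hf[OF t] c lins w_def)
    finally show "\<Lambda> t = span {?D (Hf \<zeta>), ?D (E \<zeta>), w F0 t, w F1 t}"
      unfolding \<Lambda>[OF t] span_fields[OF orbit_M[OF t]] by (simp only: span_shear)
  next
    \<comment> \<open>A hyperplane in the 7-dimensional coordinate space.\<close>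
    have "{u. cov \<zeta> \<bullet> fst u = 0} = {u. (cov \<zeta>, 0 :: real \<times> real) \<bullet> u = 0}" by auto
    moreover have "cov \<zeta> \<noteq> 0"
      using par_in(2)[of \<zeta>] ann_3[of "par \<zeta>"] \<zeta>_M M \<zeta>_W by auto
    ultimately have "dim {u :: (real ^ 5) \<times> real \<times> real. cov \<zeta> \<bullet> fst u = 0} = 6"
      using dim_hyperplane[of "(cov \<zeta>, 0 :: real \<times> real)"] by (simp add: zero_prod_def)
    then show "dim (?D ` {u. cov \<zeta> \<bullet> fst u = 0}) \<le> 6"
      using dim_image_le[OF D] by metis
    have "subspace {u :: (real ^ 5) \<times> real \<times> real. cov \<zeta> \<bullet> fst u = 0}"
      by (auto simp: subspace_def inner_add_right)
    then show "subspace (?D ` {u. cov \<zeta> \<bullet> fst u = 0})"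
      by (rule linear_subspace_image[OF D])
  qed (rule \<tau>)
qed

end

section \<open>Transfer between the annihilator and its coordinates\<close>

lemma smooth_map_onE:
  assumes "smooth_map_on S f" "x \<in> S"
  obtains U F where "x \<in> U" "smooth_on U F" "\<And>y. y \<in> S \<Longrightarrow> y \<in> U \<Longrightarrow> F y = f y"
proof -
  from assms have "\<exists>U F. x \<in> U \<and> smooth_on U F \<and> (\<forall>y\<in>S \<inter> U. F y = f y)"
    by (simp add: smooth_map_on_def)
  then obtain U F where "x \<in> U" "smooth_on U F" "\<forall>y\<in>S \<inter> U. F y = f y" by blast
  then show ?thesis by (intro that[of U F]) auto
qed

lemma smooth_map_on_continuous: "smooth_map_on S f \<Longrightarrow> continuous_on S f"
  unfolding continuous_on_eq_continuous_within
proof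
  fix x assume "smooth_map_on S f" "x \<in> S"
  then obtain U F where F: "x \<in> U" "smooth_on U F" "\<And>y. y \<in> S \<Longrightarrow> y \<in> U \<Longrightarrow> F y = f y"
    by (rule smooth_map_onE) blast
  have U: "open U" by (rule smooth_on_open[OF F(2)])
  have "isCont F x"
    using smooth_on_continuous[OF F(2)] U F(1) by (simp add: continuous_on_eq_continuous_at)
  then have "(F \<longlongrightarrow> F x) (at x within S)"
    by (simp add: continuous_at_imp_continuous_within flip: continuous_within)
  moreover have "\<forall>\<^sub>F y in at x within S. F y = f y"
    using U F(1,3) unfolding eventually_at_topological by blast
  ultimately have "(f \<longlongrightarrow> F x) (at x within S)" by (rule Lim_transform_eventually)
  then show "continuous (at x within S) f"
    using F(1,3) \<open>x \<in> S\<close> by (simp add: continuous_within)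
qed

context rank2_frame
begin

text \<open>Differentiating \<open>coord\<close> along H yields a coordinate field that is smooth
  because near each point H may be replaced by an ambient extension, which agrees with it at all
  points \<open>par z\<close>.\<close>

lemma char_field_frame:
  assumes cf: "char_field V \<Delta> U H" and U: "U = (ann V \<Delta> 2 - ann V \<Delta> 3) \<inter> N" "open N"
  defines "M \<equiv> {z \<in> param_domain. par z \<in> N}"
    and "Hf \<equiv> (\<lambda>z. dcoord (par z) (H (par z)))"
  shows "char_frame W X \<theta> V \<Delta> M Hf" and "\<And>z. z \<in> M \<Longrightarrow> dpar z (Hf z) = H (par z)"
proof -
  have par_cont: "continuous_on param_domain par"
    by (rule continuous_on_subset[OF smooth_on_continuous[OF smooth_par]]) auto
  have M_eq: "M = param_domain \<inter> par -` N" by (auto simp: M_def)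
  have oM: "open M"
    unfolding M_eq by (rule continuous_open_preimage[OF par_cont open_param_domain U(2)])
  have par_U: "par z \<in> U" if "z \<in> M" for z
    using that par_in(2)[of z] by (auto simp: M_def U)
  have M_W: "fst z \<in> W" "z \<in> param_domain" if "z \<in> M" for z using that by (auto simp: M_def)
  have kernel: "symp_kernel (ann V \<Delta> 2) (par z) = span {H (par z)}" "H (par z) \<noteq> 0" if "z \<in> M" for z
    using cf par_U[OF that] by (auto simp: char_field_def)
  show dH: "dpar z (Hf z) = H (par z)" if z: "z \<in> M" for z
  proof -
    \<comment> \<open>Kernel vectors are tangent, so H lies in the range of \<open>dpar\<close> and
      is recovered from its coordinate expression.\<close>
    have "H (par z) \<in> symp_kernel (ann V \<Delta> 2) (par z)" unfolding kernel(1)[OF z] by (simp add: span_base)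
    then have "H (par z) \<in> range (dpar z)"
      unfolding symp_kernel_def tangent_par[OF M_W(2)[OF z]] by blast
    then obtain u where "H (par z) = dpar z u" by blast
    then show ?thesis using dcoord_dpar[OF M_W(1)[OF z], of u] by (simp add: Hf_def)
  qed
  show "char_frame W X \<theta> V \<Delta> M Hf"
  proof unfold_locales
    show "M \<subseteq> param_domain" by (auto simp: M_def)
    show "smooth_on M Hf"
    proof (rule smooth_on_local[OF oM])
      fix z assume z: "z \<in> M"
      have "smooth_map_on U H" using cf by (simp add: char_field_def)
      then obtain O' F where F: "par z \<in> O'" "smooth_on O' F" "\<And>y. y \<in> U \<Longrightarrow> y \<in> O' \<Longrightarrow> F y = H y"
        by (rule smooth_map_onE[OF _ par_U[OF z]]) blast
      let ?M' = "M \<inter> par -` O'"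
      have oM': "open ?M'"
        using M_W(2) by (intro continuous_open_preimage[OF continuous_on_subset[OF par_cont] oM smooth_on_open[OF F(2)]]) auto
      have par': "smooth_on ?M' par"
        by (rule smooth_on_subset[OF smooth_par oM']) (use M_W(1) in \<open>simp add: subset_iff mem_Times_iff\<close>)
      have "smooth_on ?M' (\<lambda>z. fderiv coord (par z) (F (par z)))"
        by (rule smooth_on_derivative_at[OF smooth_coord par' _ smooth_on_compose[OF F(2) par']])
          (use M_W(1) in \<open>auto simp: mem_Times_iff image_subset_iff\<close>)
      then have "smooth_on ?M' Hf"
        by (rule smooth_on_cong) (use F(3) par_U in \<open>auto simp: Hf_def dcoord_def\<close>)
      then show "\<exists>T. z \<in> T \<and> smooth_on T Hf" using z F(1) by (intro exI[of _ ?M']) auto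
    qed
    fix z assume z: "z \<in> M"
    have "snd (par z) \<noteq> 0" using par_in(2)[OF M_W(2)[OF z]] ann_3[of "par z"] M_W(1)[OF z] by auto
    then have "span {h0 (par z)} = span {H (par z)}"
      using symp_kernel_ann_2(1)[of "par z"] par_in(1)[OF M_W(2)[OF z]] M_W(1)[OF z] kernel(1)[OF z] by simp
    then show "dpar z (Hf z) \<in> span {h0 (par z)}" using dH[OF z] by (simp add: span_base)
    show "Hf z \<noteq> 0"
      using dH[OF z] kernel(2)[OF z] linear_0[OF linear_dpar[OF M_W(1)[OF z]]] by auto
  qed
qed

text \<open>The given flow is conjugated to the coordinates. Since it may leave the domain W of the
  frame, time and neighbourhood are shrunk first; this is harmless because constancy is asserted
  only for small \<tau>.\<close>

lemma constant_weight:
  assumes \<xi>: "fst \<xi> \<in> W" "\<xi> \<in> U" and cf: "char_field V \<Delta> U H" and lf: "local_flow U H \<xi> \<delta> G \<Phi>"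
  shows "\<exists>m. \<exists>\<epsilon>>0. \<forall>\<tau>\<in>{-\<epsilon><..<\<epsilon>}. has_weight TYPE(2)
             {u \<in> tangent_at (ann V \<Delta> 2) \<xi>. symp \<xi> (euler \<xi>) u = 0}
             (span {H \<xi>, euler \<xi>}) (jacobi_curve V \<Delta> \<Phi> \<xi>) \<tau> m"
proof -
  let ?P = "ann V \<Delta> 2 - ann V \<Delta> 3"
  obtain N where N: "open N" "U = ?P \<inter> N"
    using cf by (auto simp: char_field_def openin_open)
  obtain N' where N': "open N'" "G = U \<inter> N'"
    using lf by (auto simp: local_flow_def openin_open)
  have lf': "\<delta> > 0" "\<xi> \<in> G" "smooth_map_on ({-\<delta><..<\<delta>} \<times> G) (\<lambda>(t, \<mu>). \<Phi> t \<mu>)"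
    "\<And>\<mu>. \<mu> \<in> G \<Longrightarrow> \<Phi> 0 \<mu> = \<mu>"
    "\<And>\<mu> t. \<mu> \<in> G \<Longrightarrow> \<bar>t\<bar> < \<delta> \<Longrightarrow> \<Phi> t \<mu> \<in> U"
    "\<And>\<mu> t. \<mu> \<in> G \<Longrightarrow> \<bar>t\<bar> < \<delta> \<Longrightarrow> ((\<lambda>s. \<Phi> s \<mu>) has_vector_derivative H (\<Phi> t \<mu>)) (at t)"
    using lf unfolding local_flow_def abs_less_iff by (auto simp: minus_less_iff)
  define M where "M = {z \<in> param_domain. par z \<in> N}"
  define Hf where "Hf = (\<lambda>z. dcoord (par z) (H (par z)))"
  have cfr: "char_frame W X \<theta> V \<Delta> M Hf" and dpar_Hf: "\<And>z. z \<in> M \<Longrightarrow> dpar z (Hf z) = H (par z)"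
    using char_field_frame[OF cf N(2,1)] unfolding M_def Hf_def by auto
  interpret cfr: char_frame W X \<theta> V \<Delta> M Hf by (rule cfr)
  have par_U: "par z \<in> U" if "z \<in> M" for z
    using that par_in(2)[of z] by (auto simp: M_def N(2))
  have par_cont: "continuous_on M par"
    by (rule continuous_on_subset[OF smooth_on_continuous[OF smooth_par]]) (use cfr.M in auto)
  define \<zeta> where "\<zeta> = coord \<xi>"
  have par_\<zeta>: "par \<zeta> = \<xi>" using par_coord \<xi> N(2) by (auto simp: \<zeta>_def)
  have \<zeta>_M: "\<zeta> \<in> M" using coord_in[of \<xi>] \<xi> N par_\<zeta> by (auto simp: M_def \<zeta>_def)
  define G1 where "G1 = M \<inter> par -` N'"
  have G1: "open G1" unfolding G1_def by (rule continuous_open_preimage[OF par_cont cfr.open_M N'(1)])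
  have par_G: "par z \<in> G" if "z \<in> G1" for z using that par_U by (auto simp: G1_def N'(2))
  have \<zeta>_G1: "\<zeta> \<in> G1" using \<zeta>_M par_\<zeta> lf'(2) N'(2) by (auto simp: G1_def)
  let ?S = "{-\<delta><..<\<delta>} \<times> G1"
  \<comment> \<open>Continuity of the base point of the flow gives a product neighbourhood of (0,
    \<zeta>) on which trajectories stay over W.\<close>
  have "continuous_on ?S (\<lambda>p. (\<lambda>(t, \<mu>). \<Phi> t \<mu>) (fst p, par (snd p)))"
    by (rule continuous_on_compose2[OF smooth_map_on_continuous[OF lf'(3)]])
      (auto intro!: continuous_intros continuous_on_compose2[OF par_cont] par_G simp: G1_def[symmetric],
        auto simp: G1_def)
  then have "continuous_on ?S (\<lambda>p. fst (\<Phi> (fst p) (par (snd p))))"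
    by (auto intro!: continuous_intros)
  then have "open (?S \<inter> (\<lambda>p. fst (\<Phi> (fst p) (par (snd p)))) -` W)"
    by (rule continuous_open_preimage) (auto intro!: open_Times G1 W)
  moreover have "(0, \<zeta>) \<in> ?S \<inter> (\<lambda>p. fst (\<Phi> (fst p) (par (snd p)))) -` W"
    using lf'(1,2,4) \<xi>(1) \<zeta>_G1 par_\<zeta> by simp
  ultimately obtain T G2 where TG: "open T" "open G2" "0 \<in> T" "\<zeta> \<in> G2"
    "T \<times> G2 \<subseteq> ?S \<inter> (\<lambda>p. fst (\<Phi> (fst p) (par (snd p)))) -` W"
    by (rule open_prod_elim) auto
  obtain d where d: "d > 0" "ball 0 d \<subseteq> T" using TG(1,3) open_contains_ball by blast
  have box: "\<bar>t\<bar> < \<delta> \<and> z \<in> G1 \<and> fst (\<Phi> t (par z)) \<in> W" if "\<bar>t\<bar> < d" "z \<in> G2" for t z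
  proof -
    have "t \<in> T" using d(2) that(1) by (auto simp: dist_real_def)
    then show ?thesis using TG(5) that(2) by (auto simp: abs_less_iff)
  qed
  have G2_G1: "G2 \<subseteq> G1" using box[of 0] d(1) by auto
  define \<phi> where "\<phi> t z = coord (\<Phi> t (par z))" for t z
  have par_\<phi>: "par (\<phi> t z) = \<Phi> t (par z)" and \<phi>_M: "\<phi> t z \<in> M" if "\<bar>t\<bar> < d" "z \<in> G2" for t z
  proof -
    note b = box[OF that]
    have U: "\<Phi> t (par z) \<in> U" using lf'(5)[OF par_G] b by auto
    then show *: "par (\<phi> t z) = \<Phi> t (par z)" using par_coord b N(2) by (auto simp: \<phi>_def)
    have "coord (\<Phi> t (par z)) \<in> param_domain" using coord_in[of "\<Phi> t (par z)"] b U N(2) by auto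
    then show "\<phi> t z \<in> M" using U N(2) * by (simp add: M_def \<phi>_def)
  qed
  have flow: "smooth_flow M G2 Hf \<phi> d \<zeta>"
  proof
    show "smooth_on M Hf" by (rule cfr.Hf)
    show "open G2" "\<zeta> \<in> G2" "d > 0" using TG d by auto
    show "G2 \<subseteq> M" using G2_G1 by (auto simp: G1_def)
    show "\<phi> 0 z = z" if "z \<in> G2" for z
    proof -
      have "z \<in> G1" using that G2_G1 by blast
      then show ?thesis
        using lf'(4)[OF par_G] coord_par[OF cfr.M_W] by (simp add: \<phi>_def) (simp add: G1_def)
    qed
    fix t z assume tz: "\<bar>t\<bar> < d" "z \<in> G2"
    show "\<phi> t z \<in> M" by (rule \<phi>_M[OF tz])
    have "((\<lambda>s. \<phi> s z) has_vector_derivative dcoord (\<Phi> t (par z)) (H (\<Phi> t (par z)))) (at t)"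
      unfolding \<phi>_def using box[OF tz] G2_G1 tz(2)
      by (intro has_vector_derivative_chain[OF lf'(6)] coord_derivative par_G) auto
    then show "((\<lambda>s. \<phi> s z) has_vector_derivative Hf (\<phi> t z)) (at t)"
      unfolding Hf_def par_\<phi>[OF tz] .
  next
    show "smooth_on ({-d<..<d} \<times> G2) (\<lambda>(t, z). \<phi> t z)"
    proof (rule smooth_on_local)
      show o: "open ({-d<..<d} \<times> G2)" by (intro open_Times TG(2)) simp
      fix p assume "p \<in> {-d<..<d} \<times> G2"
      then obtain t z where p: "p = (t, z)" and t: "\<bar>t\<bar> < d" and z: "z \<in> G2" by auto
      have "(t, par z) \<in> {-\<delta><..<\<delta>} \<times> G" using box[OF t z] par_G by auto
      then obtain Q F where F: "(t, par z) \<in> Q" "smooth_on Q F"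
        "\<And>y. y \<in> {-\<delta><..<\<delta>} \<times> G \<Longrightarrow> y \<in> Q \<Longrightarrow> F y = (\<lambda>(t, \<mu>). \<Phi> t \<mu>) y"
        by (rule smooth_map_onE[OF lf'(3)]) blast
      let ?g = "\<lambda>p :: real \<times> (real ^ 5) \<times> real \<times> real. (fst p, par (snd p))"
      let ?R = "{-d<..<d} \<times> G2"
      have g: "smooth_on ?R ?g"
        using G2_G1 cfr.M_W o
        by (intro smooth_on_Pair smooth_on_compose[OF smooth_par] smooth_on_linear linear_fst linear_snd)
          (auto simp: G1_def mem_Times_iff)
      let ?R' = "?R \<inter> ?g -` Q"
      have R': "open ?R'"
        by (rule continuous_open_preimage[OF smooth_on_continuous[OF g] o smooth_on_open[OF F(2)]])
      have eq: "F (s, par y) = \<Phi> s (par y) \<and> fst (\<Phi> s (par y)) \<in> W" if "(s, y) \<in> ?R'" for s y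
      proof -
        have "\<bar>s\<bar> < d" "y \<in> G2" using that by auto
        moreover from this have "s \<in> {-\<delta><..<\<delta>}" using box[of s y] by (auto simp: abs_less_iff)
        ultimately show ?thesis using box[of s y] F(3)[of "(s, par y)"] par_G that by auto
      qed
      have "smooth_on ?R' (\<lambda>p. F (?g p))"
        by (rule smooth_on_compose[OF F(2) smooth_on_subset[OF g R']]) auto
      then have "smooth_on ?R' (\<lambda>p. coord (F (?g p)))"
      proof (rule smooth_on_compose[OF smooth_coord])
        have "F (?g p) \<in> W \<times> UNIV" if "p \<in> ?R'" for p
          using eq[of "fst p" "snd p"] that by (simp add: mem_Times_iff)
        then show "(\<lambda>p. F (?g p)) ` ?R' \<subseteq> W \<times> UNIV" by blast
      qed
      then have "smooth_on ?R' (\<lambda>(t, z). \<phi> t z)"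
        by (rule smooth_on_cong) (use eq in \<open>auto simp: \<phi>_def\<close>)
      then show "\<exists>T. p \<in> T \<and> smooth_on T (\<lambda>(t, z). \<phi> t z)"
        using p t z F(1) by (intro exI[of _ ?R']) auto
    qed
  qed
  interpret fl: smooth_flow M G2 Hf \<phi> d \<zeta> by (rule flow)
  obtain e where e: "0 < e" "e \<le> d" "ball \<zeta> e \<subseteq> G2"
    "\<And>t x. \<bar>t\<bar> < e \<Longrightarrow> x \<in> ball \<zeta> e \<Longrightarrow> \<phi> t x \<in> G2"
    "\<And>t x. \<bar>t\<bar> < e \<Longrightarrow> x \<in> ball \<zeta> e \<Longrightarrow> \<phi> (- t) (\<phi> t x) = x"
    by (rule fl.flow_local_group) blast
  interpret fl: char_flow W X \<theta> V \<Delta> M Hf G2 \<phi> d \<zeta> e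
    by unfold_locales (use e in auto)
  have curve: "jacobi_curve V \<Delta> \<Phi> \<xi> t = dpar \<zeta> ` fl.B t ` {u. fst u \<in> \<Delta> (fst (fl.orbit t))}"
    if t: "\<bar>t\<bar> < e" for t
  proof -
    define z where "z = fl.orbit t"
    have z_G: "z \<in> G2" using fl.orbit_in[OF t] by (simp add: z_def)
    have z_M: "z \<in> M" "z \<in> param_domain" "fst z \<in> W"
      using fl.orbit_M[OF t] cfr.M cfr.M_W by (auto simp: z_def)
    have par_z: "par z = \<Phi> t \<xi>"
      using par_\<phi>[of t \<zeta>] t e TG(4) par_\<zeta> by (simp add: z_def fl.orbit_def)
    have \<phi>_z: "\<phi> (- t) z = \<zeta>" using e(5)[OF t, of \<zeta>] e(1) by (simp add: z_def fl.orbit_def)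
    \<comment> \<open>\<open>pushforward\<close> allows every curve with the given velocity. Near
      time 0 the image of such a curve equals its coordinate image under \<phi> (- t) followed by
      \<open>par\<close>, so the derivative depends on the velocity only.\<close>
    have along: "(\<Phi> (- t) \<circ> \<gamma> has_vector_derivative dpar \<zeta> (fl.B t u)) (at 0)"
      if \<gamma>: "smooth_curve_in ?P (par z) (dpar z u) \<gamma>" for \<gamma> u
    proof -
      let ?Q = "(W \<times> UNIV) \<inter> coord -` G2"
      have "open ?Q"
        by (rule continuous_open_preimage[OF smooth_on_continuous[OF smooth_coord] open_W_times TG(2)])
      moreover have "par z \<in> ?Q" using z_M z_G coord_par by (simp add: mem_Times_iff)
      ultimately have "smooth_curve_in (?P \<inter> ?Q) (par z) (dpar z u) \<gamma>"
        by (rule smooth_curve_in_restrict[OF \<gamma>])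
      then obtain \<epsilon> where \<epsilon>: "\<epsilon> > 0" "\<gamma> ` {-\<epsilon><..<\<epsilon>} \<subseteq> ?P \<inter> ?Q" "\<gamma> 0 = par z"
        "(\<gamma> has_vector_derivative dpar z u) (at 0)"
        by (auto simp: smooth_curve_in_def)
      have "((\<lambda>s. coord (\<gamma> s)) has_vector_derivative dcoord (par z) (dpar z u)) (at 0)"
        by (rule has_vector_derivative_chain[OF \<epsilon>(4)]) (use \<epsilon>(3) z_M coord_derivative[of "par z"] in simp)
      then have "((\<lambda>s. coord (\<gamma> s)) has_vector_derivative u) (at 0)"
        using dcoord_dpar[OF z_M(3)] by simp
      then have "((\<lambda>s. \<phi> (- t) (coord (\<gamma> s))) has_vector_derivative fl.B t u) (at 0)"
        by (rule has_vector_derivative_chain)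
          (use fl.B_derivative[OF t] \<epsilon>(3) coord_par[OF z_M(3)] in \<open>simp add: z_def\<close>)
      then have "((\<lambda>s. par (\<phi> (- t) (coord (\<gamma> s)))) has_vector_derivative dpar \<zeta> (fl.B t u)) (at 0)"
        by (rule has_vector_derivative_chain)
          (use par_derivative[OF fl.\<zeta>_W] \<epsilon>(3) coord_par[OF z_M(3)] \<phi>_z in simp)
      then show ?thesis
      proof (rule has_vector_derivative_transform_within_open[of _ _ _ "{-\<epsilon><..<\<epsilon>}"])
        fix s assume "s \<in> {-\<epsilon><..<\<epsilon>}"
        then have s: "\<gamma> s \<in> ?P" "fst (\<gamma> s) \<in> W" "coord (\<gamma> s) \<in> G2"
          using \<epsilon>(2) by (auto simp: image_subset_iff mem_Times_iff)
        then show "par (\<phi> (- t) (coord (\<gamma> s))) = (\<Phi> (- t) \<circ> \<gamma>) s"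
          using par_\<phi>[of "- t" "coord (\<gamma> s)"] t e par_coord by simp
      qed (use \<epsilon>(1) in auto)
    qed
    have "jacobi_curve V \<Delta> \<Phi> \<xi> t =
      {w. \<exists>u. fst u \<in> \<Delta> (fst z) \<and> (\<exists>\<gamma>. smooth_curve_in ?P (par z) (dpar z u) \<gamma> \<and>
          (\<Phi> (- t) \<circ> \<gamma> has_vector_derivative w) (at 0))}" (is "_ = ?C")
      unfolding jacobi_curve_def pushforward_def par_z[symmetric] jacobi_space_par[OF z_M(2)] by auto
    also have "\<dots> = dpar \<zeta> ` fl.B t ` {u. fst u \<in> \<Delta> (fst z)}"
    proof (intro equalityI subsetI)
      fix w assume "w \<in> ?C"
      then obtain u \<gamma> where u: "fst u \<in> \<Delta> (fst z)" "smooth_curve_in ?P (par z) (dpar z u) \<gamma>"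
        "(\<Phi> (- t) \<circ> \<gamma> has_vector_derivative w) (at 0)" by auto
      have "w = dpar \<zeta> (fl.B t u)" by (rule vector_derivative_unique_at[OF u(3) along[OF u(2)]])
      then show "w \<in> dpar \<zeta> ` fl.B t ` {u. fst u \<in> \<Delta> (fst z)}" using u(1) by blast
    next
      fix w assume "w \<in> dpar \<zeta> ` fl.B t ` {u. fst u \<in> \<Delta> (fst z)}"
      then obtain u where u: "fst u \<in> \<Delta> (fst z)" "w = dpar \<zeta> (fl.B t u)" by blast
      show "w \<in> ?C"
        using u smooth_curve_par[OF z_M(2), of u] along[OF smooth_curve_par[OF z_M(2)], of u] by blast
    qed
    finally show ?thesis by (simp add: z_def)
  qed
  have "{u \<in> tangent_at (ann V \<Delta> 2) \<xi>. symp \<xi> (euler \<xi>) u = 0} = dpar \<zeta> ` {u. cov \<zeta> \<bullet> fst u = 0}"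
    using euler_complement_par[of \<zeta>] \<zeta>_M cfr.M par_\<zeta> by auto
  moreover have "dpar \<zeta> (Hf \<zeta>) = H \<xi>" using dpar_Hf[OF \<zeta>_M] par_\<zeta> by simp
  moreover have "dpar \<zeta> (cfr.E \<zeta>) = euler \<xi>"
    using dpar_euler[OF fl.\<zeta>_W] par_\<zeta> by (simp add: cfr.E_def cfr.m3_def cfr.m4_def)
  ultimately have "has_weight TYPE(2) {u \<in> tangent_at (ann V \<Delta> 2) \<xi>. symp \<xi> (euler \<xi>) u = 0}
             (span {H \<xi>, euler \<xi>}) (jacobi_curve V \<Delta> \<Phi> \<xi>) \<tau> 4" if "\<bar>\<tau>\<bar> < e" for \<tau>
    using fl.has_weight_jacobi[OF that curve] by simp
  then show ?thesis using e(1) by (intro exI[of _ 4] exI[of _ e]) auto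
qed

end

section \<open>From the local model to the manifold\<close>

lemma constant_weight_germ_235:
  fixes \<Delta> :: "real ^ 5 \<Rightarrow> (real ^ 5) set"
  assumes \<Delta>: "smooth_distribution V 2 \<Delta>"
    and dims: "\<And>x. x \<in> V \<Longrightarrow> dim (lie_flag V \<Delta> 2 x) = 3" "\<And>x. x \<in> V \<Longrightarrow> dim (lie_flag V \<Delta> 3 x) = 5"
    and \<xi>: "\<xi> \<in> ann V \<Delta> 2" "snd \<xi> \<noteq> 0"
  shows "constant_weight_germ V \<Delta> \<xi>"
proof -
  have "fst \<xi> \<in> V" using \<xi>(1) by (auto simp: ann_def)
  then obtain W Y where W: "fst \<xi> \<in> W" "W \<subseteq> V" and Y: "\<And>i. i < 2 \<Longrightarrow> smooth_on W (Y i)"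
    and \<Delta>_eq: "\<And>y. y \<in> W \<Longrightarrow> \<Delta> y = span ((\<lambda>i. Y i y) ` {..<2::nat})"
    using \<Delta> unfolding smooth_distribution_def by metis
  let ?X = "bracket_frame (Y 0) (Y 1)"
  have two: "{..<2::nat} = {0, 1}" by auto
  have flag: "\<And>i. smooth_on W (?X i)" "\<And>y. y \<in> W \<Longrightarrow> \<Delta> y = frame_span ?X 2 y"
    "\<And>y. y \<in> W \<Longrightarrow> lie_flag V \<Delta> 2 y = frame_span ?X 3 y"
    "\<And>y. y \<in> W \<Longrightarrow> lie_flag V \<Delta> 3 y = UNIV"
    "\<And>y. y \<in> W \<Longrightarrow> frame_span ?X 5 y = UNIV"
  proof -
    have *: "smooth_on W (Y 0)" "smooth_on W (Y 1)" using Y by auto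
    have **: "\<Delta> y = span {Y 0 y, Y 1 y}" if "y \<in> W" for y using \<Delta>_eq[OF that] by (simp add: two)
    have d: "dim (\<Delta> y) = 2" "dim (lie_flag V \<Delta> 2 y) = 3" "dim (lie_flag V \<Delta> 3 y) = 5" if "y \<in> W" for y
      using \<Delta> dims W(2) that unfolding smooth_distribution_def by blast+
    note ff = flag_frame[OF * W(2) ** d]
    show "\<And>i. smooth_on W (?X i)" "\<And>y. y \<in> W \<Longrightarrow> \<Delta> y = frame_span ?X 2 y"
      "\<And>y. y \<in> W \<Longrightarrow> lie_flag V \<Delta> 2 y = frame_span ?X 3 y"
      "\<And>y. y \<in> W \<Longrightarrow> lie_flag V \<Delta> 3 y = UNIV"
      "\<And>y. y \<in> W \<Longrightarrow> frame_span ?X 5 y = UNIV"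
      by (rule ff; assumption)+
  qed
  have oW: "open W" using smooth_on_open[OF flag(1)] .
  obtain \<theta> where \<theta>: "\<And>i. i < CARD(5) \<Longrightarrow> smooth_on W (\<theta> i)"
    "\<And>i j y. y \<in> W \<Longrightarrow> i < CARD(5) \<Longrightarrow> j < CARD(5) \<Longrightarrow> \<theta> i y \<bullet> ?X j y = (if i = j then 1 else 0)"
    by (rule dual_coframe[of W ?X]) (use oW flag in auto)
  have "rank2_frame W ?X \<theta> V \<Delta>"
  proof unfold_locales
    show "lie_bracket (?X 0) (?X 1) = ?X 2" "lie_bracket (?X 0) (?X 2) = ?X 3" "lie_bracket (?X 1) (?X 2) = ?X 4"
      by (simp_all add: eval_nat_numeral One_nat_def)
  qed (use oW flag \<theta> W in auto)
  then interpret fr: rank2_frame W ?X \<theta> V \<Delta> .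
  have \<xi>': "\<xi> \<in> ann V \<Delta> 2 - ann V \<Delta> 3" using \<xi> fr.ann_3[OF W(1)] by simp
  show ?thesis
    unfolding constant_weight_germ_def
  proof (intro conjI allI impI)
    show "\<exists>U H. \<xi> \<in> U \<and> char_field V \<Delta> U H"
      using fr.char_field_exists[of "fst \<xi>" "snd \<xi>"] W(1) \<xi>' by simp
    fix U H \<delta> G \<Phi> assume *: "\<xi> \<in> U \<and> char_field V \<Delta> U H \<and> local_flow U H \<xi> \<delta> G \<Phi>"
    show "\<exists>m. \<exists>\<epsilon>>0. \<forall>\<tau>\<in>{-\<epsilon><..<\<epsilon>}. has_weight TYPE(2)
             {u \<in> tangent_at (ann V \<Delta> 2) \<xi>. symp \<xi> (euler \<xi>) u = 0}
             (span {H \<xi>, euler \<xi>}) (jacobi_curve V \<Delta> \<Phi> \<xi>) \<tau> m"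
      using fr.constant_weight[OF W(1)] * by blast
  qed
qed

theorem proposition2p6:
  fixes A :: "('m::{t2_space, second_countable_topology}, real ^ 5) chart set"
    and D :: "'m \<Rightarrow> (('m, real ^ 5) chart \<Rightarrow> real ^ 5) set"
  assumes "smooth_atlas A"
    and "distribution A 2 D"
    and "\<And>q. has_small_growth_vector A D q [2, 3, 5]"
  shows "regular_locus A D = annihilator A D 2 - annihilator A D 3"
proof (intro equalityI subsetI)
  fix x assume "x \<in> regular_locus A D"
  then show "x \<in> annihilator A D 2 - annihilator A D 3" by (auto simp: regular_locus_def)
next
  fix x assume x: "x \<in> annihilator A D 2 - annihilator A D 3"
  obtain q p where qp: "x = (q, p)" by (cases x)
  have p: "p \<in> cotangent_space A q"
    and ann2: "\<And>c. c \<in> charts_at A q \<Longrightarrow> (snd c q, p c) \<in> ann (chart_image c) (in_chart c D) 2"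
    using x by (auto simp: qp annihilator_def)
  have "constant_weight_germ (chart_image c) (in_chart c D) (snd c q, p c)" if c: "c \<in> charts_at A q" for c
  proof (rule constant_weight_germ_235)
    show "smooth_distribution (chart_image c) 2 (in_chart c D)"
      using assms(2) c by (auto simp: distribution_def charts_at_def)
    \<comment> \<open>Each point of the chart image is the image of a manifold point for which this
      same chart is admissible, so the growth vector is available throughout the image.\<close>
    have growth: "dim (lie_flag (chart_image c) (in_chart c D) (Suc j) y) = [2, 3, 5] ! j"
      if y: "y \<in> chart_image c" and j: "j < 3" for y j
    proof -
      have "c \<in> charts_at A (chart_inv c y)"
        using c inv_into_into[OF y] by (simp add: charts_at_def)
      then show ?thesis
        using assms(3)[of "chart_inv c y", unfolded has_small_growth_vector_def, rule_format, of c j]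
          j f_inv_into_f[OF y] by simp
    qed
    show "dim (lie_flag (chart_image c) (in_chart c D) 2 y) = 3"
      "dim (lie_flag (chart_image c) (in_chart c D) 3 y) = 5" if "y \<in> chart_image c" for y
      using growth[OF that, of 1] growth[OF that, of 2] by (simp_all add: eval_nat_numeral One_nat_def)
    show "(snd c q, p c) \<in> ann (chart_image c) (in_chart c D) 2" by (rule ann2[OF c])
    \<comment> \<open>\<open>annihilator\<close> tests every chart at q: a covector that vanishes in
      one chart vanishes in all by the transformation rule, and would lie in the annihilator of the
      third flag space.\<close>
    show "snd (snd c q, p c) \<noteq> 0"
    proof
      assume "snd (snd c q, p c) = 0"
      then have pc: "p c = 0" by simp
      have "(snd c' q, p c') \<in> ann (chart_image c') (in_chart c' D) 3" if c': "c' \<in> charts_at A q" for c'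
      proof -
        have "p c' \<bullet> v = p c \<bullet> transition_deriv c' c q v" for v
          using p c c' unfolding cotangent_space_def by blast
        then have "p c' \<bullet> v = 0" for v by (simp add: pc)
        moreover have "snd c' q \<in> chart_image c'" using c' by (auto simp: charts_at_def)
        ultimately show ?thesis by (simp add: ann_def)
      qed
      then have "(q, p) \<in> annihilator A D 3" using p by (simp add: annihilator_def)
      with x qp show False by simp
    qed
  qed
  then show "x \<in> regular_locus A D" using x by (simp add: qp regular_locus_def)
qed

end
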